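(* For $n\in\mathbb{N}$ let $N(a_1,a_2,a_3,a_4,b_1,b_2;n)$ be the number of $(x_1,\dots,x_8)\in\mathbb{Z}^8$ with $n=\sum_{i=1}^4a_ix_i^2+b_1(x_5^2+x_5x_6+x_6^2)+b_2(x_7^2+x_7x_8+x_8^2)$. Let $(a_1,a_2,a_3,a_4)\in\{(1,1,1,3),(1,2,2,3),(1,3,3,3)\}$ and $(b_1,b_2)\in\{(1,1),(1,2),(1,4),(2,2),(2,4),(4,4)\}$. Then for every $n\in\mathbb{N}$, $$N(a_1,a_2,a_3,a_4,b_1,b_2;n)=\sum_{i=1}^{16}\gamma_iC_i(n),$$ where $C_i(n)$ are the Fourier coefficients of the functions $h_i$ in the context and $(\gamma_1,\dots,\gamma_{16})$ is the vector assigned to $(a_1a_2a_3a_4,b_1b_2)$ in the table in the context.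
   Context: $q=e^{2\pi iz}$, $\eta(z)=q^{1/24}\prod_{n\ge1}(1-q^n)$. Characters: $\chi_{12}(n)=\left(\frac{12}{n}\right)$, $\chi_{-3}(n)=\left(\frac{-3}{n}\right)$, $\chi_{-4}(n)=\left(\frac{-4}{n}\right)$, $\mathbf 1$ trivial. For primitive $\chi,\psi$ with $\chi$ of conductor $M$: $E_{4,\chi,\psi}(z)=c_0+\sum_{n\ge1}\big(\sum_{d\mid n}\psi(d)\chi(n/d)d^3\big)q^n$, $c_0=0$ if $M>1$, $c_0=-B_{4,\psi}/8$ if $M=1$ (generalized Bernoulli number; for $E_{4,\mathbf 1,\chi_{12}}$ this gives $c_0=23$). Eta-quotients: $v_1=\eta^{-1}(2z)\eta^4(3z)\eta^2(4z)\eta^5(6z)\eta^{-2}(12z)$, $v_2=\eta^4(3z)\eta^3(4z)\eta^{-2}(6z)\eta^3(12z)$, $v_3=\eta^2(2z)\eta^4(3z)\eta^{-1}(4z)\eta^{-4}(6z)\eta^7(12z)$, $v_4=\eta^4(z)\eta^{-1}(4z)\eta^{-2}(6z)\eta^7(12z)$. Set $h_1=E_{4,\mathbf 1,\chi_{12}}(z)$, $h_2=E_{4,\chi_{12},\mathbf 1}(z)$, $h_3=E_{4,\chi_{-4},\chi_{-3}}(z)$, $h_4=E_{4,\chi_{-3},\chi_{-4}}(z)$, $h_5,\dots,h_8$ the same four functions at $2z$, $h_{8+j}=v_j(z)$, $h_{12+j}=v_j(2z)$ ($1\le j\le4$); $h_i(z)=\sum_{n\ge0}C_i(n)q^n$.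 Table of $(\gamma_1,\dots,\gamma_{16})$ (all entries are over 23; listed are the numerators $23\gamma_i$): (1113,11): 1, 288, 32, 9, 0, 0, 0, 0, 84, 720, 336, 864, 0, 0, 0, 0. (1113,12): 1, 144, -16, -9, 0, 0, 0, 0, 156, -48, -168, -456, 0, 0, 0, 0. (1113,14): 1, 72, 8, 9, 0, 0, 0, 0, 186, 600, -228, 372, 0, 0, 0, 0. (1113,22): 1, 72, 8, 9, 0, 0, 0, 0, 48, 48, 48, 96, 0, 0, 0, 0. (1113,24): 1, 36, -4, -9, 0, 0, 0, 0, 114, 84, -120, -156, 0, 0, 0, 0. (1113,44): 1, 18, 2, 9, 0, 0, 0, 0, 108, 156, -162, 42, 0, 0, 0, 0. (1223,11): 0, 144, 16, 0, 1, 0, 0, -9, 162, 264, -1188, 420, 192, 864, -4704, -5760. (1223,12): 0, 72, -8, 0, 1, 0, 0, 9, 120, 96, 336, -384, -240, -912, 4368, 2784. (1223,14): 0, 36, 4, 0, 1, 0, 0, -9, 144, 480, -504, 312, -360, 1416, -1944, -1344. (1223,22): 0, 36, 4, 0, 1, 0, 0, -9, 6, -72, -228, 36, 192, -240, -1392, -1344. (1223,24): 0, 18, -2, 0, 1, 0, 0, 9, 30, 24, 84, -96, 36, -360, 504, 576. (1223,44): 0, 9, 1, 0, 1, 0, 0, -9, 36, 120, -126, 78, -84, 312, -840, -240. (1333,11): 1, 96, -32, -3, 0, 0, 0, 0, 260, 352, -544, -352, 0, 0, 0, 0. (1333,12): 1, 48, 16, 3, 0, 0, 0, 0, 116, 160,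 -40, 104, 0, 0, 0, 0. (1333,14): 1, 24, -8, -3, 0, 0, 0, 0, 170, 16, -292, -340, 0, 0, 0, 0. (1333,22): 1, 24, -8, -3, 0, 0, 0, 0, 32, 16, -16, -64, 0, 0, 0, 0. (1333,24): 1, 12, 4, 3, 0, 0, 0, 0, 26, 76, 32, 116, 0, 0, 0, 0. (1333,44): 1, 6, -2, -3, 0, 0, 0, 0, 44, -68, -22, -130, 0, 0, 0, 0. *)

theory Defs
  imports Complex_Main "HOL-Computational_Algebra.Formal_Power_Series"
begin

definition chi12 :: "nat \<Rightarrow> int" where
  "chi12 n = (if n mod 12 = 1 \<or> n mod 12 = 11 then 1
              else if n mod 12 = 5 \<or> n mod 12 = 7 then -1 else 0)"

definition chim3 :: "nat \<Rightarrow> int" where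
  "chim3 n = (if n mod 3 = 1 then 1 else if n mod 3 = 2 then -1 else 0)"

definition chim4 :: "nat \<Rightarrow> int" where
  "chim4 n = (if n mod 4 = 1 then 1 else if n mod 4 = 3 then -1 else 0)"

definition chi1 :: "nat \<Rightarrow> int" where
  "chi1 n = 1"

definition E4coeff :: "(nat \<Rightarrow> int) \<Rightarrow> (nat \<Rightarrow> int) \<Rightarrow> int \<Rightarrow> nat \<Rightarrow> rat" where
  "E4coeff chi psi c0 n =
     (if n = 0 then of_int c0
      else of_int (\<Sum>d\<in>{d. d dvd n}. psi d * chi (n div d) * int d ^ 3))"

definition fps_pow_int :: "rat fps \<Rightarrow> int \<Rightarrow> rat fps" where
  "fps_pow_int f e = (if 0 \<le> e then f ^ nat e else inverse f ^ nat (- e))"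

text \<open>For an eta quotient prod_{(d,e)} eta(d z)^e, the product part
  prod_{(d,e)} prod_{m >= 1} (1 - q^{d m})^e truncated to the factors with m <= N;
  modulo q^(N+1) this agrees with the infinite product.\<close>
definition eta_prod :: "(nat \<times> int) list \<Rightarrow> nat \<Rightarrow> rat fps" where
  "eta_prod L N = prod_list (map (\<lambda>(d, e). fps_pow_int (\<Prod>m\<in>{1..N}. 1 - fps_X ^ (d * m)) e) L)"

text \<open>Coefficient of q^n in prod_{(d,e)} eta(d z)^e = q^s * (product part),
  where s = (sum d e)/24 (an integer for all eta quotients used here).\<close>
definition eta_coeff :: "(nat \<times> int) list \<Rightarrow> nat \<Rightarrow> rat" where
  "eta_coeff L n =
     (let s = (\<Sum>(d, e)\<leftarrow>L. int d * e) div 24 in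
      if int n < s then 0 else fps_nth (eta_prod L n) (nat (int n - s)))"

definition v_list :: "nat \<Rightarrow> (nat \<times> int) list" where
  "v_list j = (if j = 1 then [(2,-1),(3,4),(4,2),(6,5),(12,-2)]
    else if j = 2 then [(3,4),(4,3),(6,-2),(12,3)]
    else if j = 3 then [(2,2),(3,4),(4,-1),(6,-4),(12,7)]
    else [(1,4),(4,-1),(6,-2),(12,7)])"

definition C1 :: "nat \<Rightarrow> nat \<Rightarrow> rat" where
  "C1 i n = (if i = 1 then E4coeff chi1 chi12 23 n
     else if i = 2 then E4coeff chi12 chi1 0 n
     else if i = 3 then E4coeff chim4 chim3 0 n
     else if i = 4 then E4coeff chim3 chim4 0 n
     else eta_coeff (v_list (i - 4)) n)"

text \<open>h_1..h_4 = Eisenstein series at z, h_5..h_8 same at 2z,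
  h_9..h_12 = v_1..v_4 at z, h_13..h_16 = v_1..v_4 at 2z.\<close>
definition C :: "nat \<Rightarrow> nat \<Rightarrow> rat" where
  "C i n = (if 1 \<le> i \<and> i \<le> 4 then C1 i n
     else if 5 \<le> i \<and> i \<le> 8 then (if even n then C1 (i - 4) (n div 2) else 0)
     else if 9 \<le> i \<and> i \<le> 12 then C1 (i - 4) n
     else if 13 \<le> i \<and> i \<le> 16 then (if even n then C1 (i - 8) (n div 2) else 0)
     else 0)"

definition Nrep :: "nat \<Rightarrow> nat \<Rightarrow> nat \<Rightarrow> nat \<Rightarrow> nat \<Rightarrow> nat \<Rightarrow> nat \<Rightarrow> nat" where
  "Nrep a1 a2 a3 a4 b1 b2 n = card {x :: int list. length x = 8 \<and>
     int n = int a1 * (x!0)^2 + int a2 * (x!1)^2 + int a3 * (x!2)^2 + int a4 * (x!3)^2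
       + int b1 * ((x!4)^2 + (x!4) * (x!5) + (x!5)^2)
       + int b2 * ((x!6)^2 + (x!6) * (x!7) + (x!7)^2)}"

definition gamma_num :: "nat \<times> nat \<times> nat \<times> nat \<Rightarrow> nat \<times> nat \<Rightarrow> int list" where
  "gamma_num a b = (
   if a = (1,1,1,3) then
     (if b = (1,1) then [1, 288, 32, 9, 0, 0, 0, 0, 84, 720, 336, 864, 0, 0, 0, 0]
      else if b = (1,2) then [1, 144, -16, -9, 0, 0, 0, 0, 156, -48, -168, -456, 0, 0, 0, 0]
      else if b = (1,4) then [1, 72, 8, 9, 0, 0, 0, 0, 186, 600, -228, 372, 0, 0, 0, 0]
      else if b = (2,2) then [1, 72, 8, 9, 0, 0, 0, 0, 48, 48, 48, 96, 0, 0, 0, 0]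
      else if b = (2,4) then [1, 36, -4, -9, 0, 0, 0, 0, 114, 84, -120, -156, 0, 0, 0, 0]
      else [1, 18, 2, 9, 0, 0, 0, 0, 108, 156, -162, 42, 0, 0, 0, 0])
   else if a = (1,2,2,3) then
     (if b = (1,1) then [0, 144, 16, 0, 1, 0, 0, -9, 162, 264, -1188, 420, 192, 864, -4704, -5760]
      else if b = (1,2) then [0, 72, -8, 0, 1, 0, 0, 9, 120, 96, 336, -384, -240, -912, 4368, 2784]
      else if b = (1,4) then [0, 36, 4, 0, 1, 0, 0, -9, 144, 480, -504, 312, -360, 1416, -1944, -1344]
      else if b = (2,2) then [0, 36, 4, 0, 1, 0, 0, -9, 6, -72, -228, 36, 192, -240, -1392, -1344]
      else if b = (2,4) then [0, 18, -2, 0, 1, 0, 0, 9, 30, 24, 84, -96, 36, -360, 504, 576]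
      else [0, 9, 1, 0, 1, 0, 0, -9, 36, 120, -126, 78, -84, 312, -840, -240])
   else
     (if b = (1,1) then [1, 96, -32, -3, 0, 0, 0, 0, 260, 352, -544, -352, 0, 0, 0, 0]
      else if b = (1,2) then [1, 48, 16, 3, 0, 0, 0, 0, 116, 160, -40, 104, 0, 0, 0, 0]
      else if b = (1,4) then [1, 24, -8, -3, 0, 0, 0, 0, 170, 16, -292, -340, 0, 0, 0, 0]
      else if b = (2,2) then [1, 24, -8, -3, 0, 0, 0, 0, 32, 16, -16, -64, 0, 0, 0, 0]
      else if b = (2,4) then [1, 12, 4, 3, 0, 0, 0, 0, 26, 76, 32, 116, 0, 0, 0, 0]
      else [1, 6, -2, -3, 0, 0, 0, 0, 44, -68, -22, -130, 0, 0, 0, 0]))"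

definition gamma :: "nat \<times> nat \<times> nat \<times> nat \<Rightarrow> nat \<times> nat \<Rightarrow> nat \<Rightarrow> rat" where
  "gamma a b i = of_int (gamma_num a b ! (i - 1)) / 23"

end

(*
  All theta functions, eta quotients and Eisenstein series here are handled as formal power
  series.  The Jacobi triple product and the three-term (Weierstrass) relation between products
  theta(xy) theta(x/y) give, at torsion points, the quadratic relations between the theta
  constants phi1 = sum q^(n^2), phi3 = sum q^(3 n^2) and four eta quotients of weight 1.
  Taylor expansion of the theta products yields the relation wp'' = 6 wp^2 + const, so a weight 4
  Eisenstein series, being a difference of two values of wp'' at torsion points, is the product of
  a difference of wp-values (an eta quotient) and of their sum (a weight 2 series).  Hence all
  series at z become polynomials in X = phi1^2, Y = phi3^2 after multiplication by (phi1 phi3)^3.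
  The series at 2z are obtained as even parts, or by substituting the doubled theta constants;
  this needs one further function uu with 16 X Y uu^2 = (X + Y) (3 Y - X).  The hexagonal theta
  series are expressed in X and Y in the same way, and each row of the table is then a polynomial
  identity in X, Y, uu.
*)
theory Submission
  imports Defs "HOL-Computational_Algebra.Formal_Laurent_Series" "HOL-Computational_Algebra.Polynomial"
begin

unbundle fps_syntax

declare [[simproc del: poly_fps_eq]]

subsection \<open>Infinite products of formal power series\<close>

text \<open>No analytic theory of modular forms is used, so an identity of series cannot be reduced
  to finitely many coefficients; every relation has to come from an algebraic identity. The source
  is theta(xt) theta(x/t): its coefficients are polynomials in s = t + 1/t - 2, so the three-term
  relation, valid for all complex s, can be compared at s (differences of wp-values as theta
  quotients) and at s^2 (differences of wp''). Such differences, added around triangles of torsion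
  points, determine phi1^2 and phi3^2 only up to sign; constant coefficients decide. X and Y have
  weight 1, so after the factor (phi1 phi3)^3 the weight 4 series at z become homogeneous of degree
  7. X/Y takes the values 0, infinity, 1, -1, 3, -3 at the six cusps of Gamma_0(12), which explains
  the linear factors X - Y, X + Y, 3Y - X, X + 3Y. Even parts need q -> -q, which sends (X, Y) to uu
  (3Y - X, X + Y); this is the origin of uu. Complex Laurent series provide roots of unity and
  division by theta constants.\<close>

definition agree :: "nat \<Rightarrow> 'a fps \<Rightarrow> 'a fps \<Rightarrow> bool" where
  "agree n f g \<longleftrightarrow> (\<forall>k\<le>n. f $ k = g $ k)"

lemma agree_refl [simp]: "agree n f f"
  by (simp add: agree_def)

lemma agree_sym: "agree n f g \<Longrightarrow> agree n g f"
  by (simp add: agree_def)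

lemma agree_trans [trans]: "agree n f g \<Longrightarrow> agree n g h \<Longrightarrow> agree n f h"
  by (simp add: agree_def)

lemma agree_mono: "agree n f g \<Longrightarrow> m \<le> n \<Longrightarrow> agree m f g"
  by (simp add: agree_def)

lemma agreeD: "agree n f g \<Longrightarrow> k \<le> n \<Longrightarrow> f $ k = g $ k"
  by (simp add: agree_def)

lemma agree_add: "agree n f g \<Longrightarrow> agree n f' g' \<Longrightarrow> agree n (f + f') (g + g')"
  for f :: "'a::comm_ring_1 fps"
  by (simp add: agree_def)

lemma agree_diff: "agree n f g \<Longrightarrow> agree n f' g' \<Longrightarrow> agree n (f - f') (g - g')"
  for f :: "'a::comm_ring_1 fps"
  by (simp add: agree_def)

lemma agree_mult: "agree n f g \<Longrightarrow> agree n f' g' \<Longrightarrow> agree n (f * f') (g * g')"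
  for f :: "'a::comm_ring_1 fps"
  unfolding agree_def fps_mult_nth by (auto intro!: sum.cong)

lemma agree_power: "agree n f g \<Longrightarrow> agree n (f ^ k) (g ^ k)"
  for f :: "'a::comm_ring_1 fps"
  by (induction k) (auto intro: agree_mult)

lemma agree_prod: "(\<And>i. i \<in> A \<Longrightarrow> agree n (f i) (g i)) \<Longrightarrow> agree n (prod f A) (prod g A)"
  for f :: "'b \<Rightarrow> 'a::comm_ring_1 fps"
  by (induction A rule: infinite_finite_induct) (auto intro: agree_mult)

lemma agree_eqI: "(\<And>n. agree n f g) \<Longrightarrow> f = g"
  by (rule fps_ext) (auto simp: agree_def)

text \<open>Factors \<open>f m \<equiv> 1 (mod q^m)\<close>, so that the infinite product converges \<open>q\<close>-adically;
  the factor \<open>f 0\<close> is irrelevant.\<close>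

definition padm :: "(nat \<Rightarrow> 'a::comm_ring_1 fps) \<Rightarrow> bool" where
  "padm f \<longleftrightarrow> (\<forall>m\<ge>1. agree (m - 1) (f m) 1)"

definition infprod :: "(nat \<Rightarrow> 'a::comm_ring_1 fps) \<Rightarrow> 'a fps" where
  "infprod f = Abs_fps (\<lambda>n. (\<Prod>m=1..n. f m) $ n)"

lemma agree_infprod:
  assumes "padm f" "n \<le> M"
  shows "agree n (infprod f) (\<Prod>m=1..M. f m)"
  unfolding agree_def
proof safe
  fix k assume k: "k \<le> n"
  have "{1..M} = {1..k} \<union> {k+1..M}" using k assms(2) by auto
  hence "(\<Prod>m=1..M. f m) = (\<Prod>m=1..k. f m) * (\<Prod>m=k+1..M. f m)"
    by (simp add: prod.union_disjoint)
  moreover have "agree k (\<Prod>m=k+1..M. f m) (\<Prod>m=k+1..M. 1)"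
  proof (intro agree_prod)
    fix i assume i: "i \<in> {k+1..M}"
    hence "agree (i - 1) (f i) 1" using assms(1) by (simp add: padm_def)
    thus "agree k (f i) 1" by (rule agree_mono) (use i in auto)
  qed
  hence "agree k ((\<Prod>m=1..k. f m) * (\<Prod>m=k+1..M. f m)) ((\<Prod>m=1..k. f m) * 1)"
    by (intro agree_mult) auto
  ultimately show "infprod f $ k = (\<Prod>m=1..M. f m) $ k"
    by (simp add: infprod_def agree_def)
qed

lemma infprod_unique:
  assumes "padm f" "\<And>n. \<exists>M\<ge>n. agree n F (\<Prod>m=1..M. f m)"
  shows "F = infprod f"
proof (rule agree_eqI)
  fix n
  obtain M where "M \<ge> n" "agree n F (\<Prod>m=1..M. f m)" using assms(2) by blast
  thus "agree n F (infprod f)"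
    using agree_infprod[OF assms(1), of n M] by (auto intro: agree_trans agree_sym)
qed

lemma padm_mult: "padm f \<Longrightarrow> padm g \<Longrightarrow> padm (\<lambda>m. f m * g m)"
  unfolding padm_def using agree_mult[of _ _ 1 _ 1] by (metis mult_1)

lemma infprod_mult: "padm f \<Longrightarrow> padm g \<Longrightarrow> infprod f * infprod g = infprod (\<lambda>m. f m * g m)"
  by (rule infprod_unique)
     (auto simp: padm_mult prod.distrib simp del: One_nat_def intro!: exI[of _ n for n] agree_mult agree_infprod)

lemma infprod_cong: "(\<And>m. m \<ge> 1 \<Longrightarrow> f m = g m) \<Longrightarrow> infprod f = infprod g"
  unfolding infprod_def by (intro arg_cong[of _ _ Abs_fps] ext arg_cong[of _ _ "\<lambda>f. fps_nth f _"] prod.cong) auto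

lemma infprod_nth_0 [simp]: "infprod f $ 0 = 1"
  by (simp add: infprod_def)

lemma infprod_nonzero [simp]: "infprod f \<noteq> 0"
  by (metis infprod_nth_0 fps_zero_nth zero_neq_one)

lemma prod_multiples:
  fixes g :: "nat \<Rightarrow> 'a::comm_monoid_mult"
  assumes "d \<ge> 1"
  shows "(\<Prod>m=1..d*M. if d dvd m then g (m div d) else 1) = (\<Prod>i=1..M. g i)"
proof -
  have "(\<Prod>m=1..d*M. if d dvd m then g (m div d) else 1)
      = prod (\<lambda>m. g (m div d)) {m \<in> {1..d*M}. d dvd m}"
    by (rule prod.inter_filter [symmetric]) simp
  also have "{m \<in> {1..d*M}. d dvd m} = (*) d ` {1..M}"
    using assms by (auto simp: image_iff elim!: dvdE)
  also have "prod (\<lambda>m. g (m div d)) \<dots> = (\<Prod>i=1..M. g i)"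
    using assms by (subst prod.reindex) (auto simp: inj_on_def)
  finally show ?thesis .
qed

lemma infprod_stretch:
  assumes "d \<ge> 1" "padm (\<lambda>m. if d dvd m then g (m div d) else 1)"
  shows "infprod (\<lambda>m. if d dvd m then g (m div d) else 1) = infprod g"
proof -
  let ?f = "\<lambda>m. if d dvd m then g (m div d) else 1"
  have "padm g" unfolding padm_def
  proof safe
    fix m :: nat assume m: "1 \<le> m"
    have "agree (d*m - 1) (?f (d*m)) 1"
      using assms(2)[unfolded padm_def, rule_format, of "d*m"] assms(1) m by simp
    moreover have "?f (d*m) = g m" using assms(1) by simp
    moreover have "m - 1 \<le> d*m - 1" using assms(1) by (intro diff_le_mono) simp
    ultimately show "agree (m-1) (g m) 1" by (auto intro: agree_mono)
  qed
  show ?thesis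
  proof (rule infprod_unique[OF \<open>padm g\<close>])
    fix n
    \<comment> \<open>Among the exponents up to \<open>d * n\<close>, the multiples of
      \<open>d\<close> are exactly those of the first \<open>n\<close> factors of
      \<open>g\<close>.\<close>
    have "agree n (infprod ?f) (\<Prod>m=1..d*n. ?f m)"
      using assms by (intro agree_infprod) auto
    thus "\<exists>M\<ge>n. agree n (infprod ?f) (\<Prod>m=1..M. g m)"
      using prod_multiples[OF assms(1), of g n] by auto
  qed
qed

section \<open>Products of 1 - c q^m over classes of exponents\<close>

definition qprod :: "'a::comm_ring_1 \<Rightarrow> (nat \<Rightarrow> bool) \<Rightarrow> 'a fps" where
  "qprod c R = infprod (\<lambda>m. if R m then 1 - fps_const c * fps_X ^ m else 1)"

lemma agree_one_minus: "k < m \<Longrightarrow> agree k (1 - fps_const c * fps_X ^ m) 1" for c :: "'a::comm_ring_1"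
  unfolding agree_def
proof safe
  fix i assume "i \<le> k" "k < m"
  thus "(1 - fps_const c * fps_X ^ m) $ i = 1 $ i"
    by simp
qed

lemma padm_qprod [simp]: "padm (\<lambda>m. if R m then 1 - fps_const c * fps_X ^ m else 1)"
  by (auto simp: padm_def intro!: agree_one_minus)

lemma qprod_nth_0 [simp]: "qprod c R $ 0 = 1"
  by (simp add: qprod_def)

lemma qprod_nonzero [simp]: "qprod c R \<noteq> 0"
  by (simp add: qprod_def)

lemma qprod_union:
  assumes "\<And>m. m \<ge> 1 \<Longrightarrow> \<not> (R m \<and> R' m)" "\<And>m. m \<ge> 1 \<Longrightarrow> S m \<longleftrightarrow> R m \<or> R' m"
  shows "qprod c S = qprod c R * qprod c R'"
  unfolding qprod_def infprod_mult[OF padm_qprod padm_qprod] using assms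
  by (intro infprod_cong) auto

lemma qprod_stretch:
  assumes "d \<ge> 1"
  shows "infprod (\<lambda>i. if R i then 1 - fps_const c * fps_X ^ (d * i) else 1)
           = qprod c (\<lambda>m. d dvd m \<and> R (m div d))"
proof -
  let ?g = "\<lambda>i. if R i then 1 - fps_const c * fps_X ^ (d * i) else 1"
  have eq: "(\<lambda>m. if d dvd m then ?g (m div d) else 1)
      = (\<lambda>m. if d dvd m \<and> R (m div d) then 1 - fps_const c * fps_X ^ m else 1)"
    by (auto simp: fun_eq_iff)
  show ?thesis
    using infprod_stretch[OF assms, of ?g] unfolding eq qprod_def by simp
qed

lemma one_minus_cube:
  fixes u w :: "'a::comm_ring_1"
  assumes "w^2 + w + 1 = 0"
  shows "(1 - u) * (1 - w * u) * (1 - w^2 * u) = 1 - u^3"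
proof -
  have "(1 - u) * (1 - w * u) * (1 - w^2 * u) = 1 - u^3
         + (w^2 + w + 1) * (w * u^2 - u + u^3 * (1 - w))"
    by (simp add: algebra_simps power2_eq_square power3_eq_cube)
  thus ?thesis using assms by simp
qed

lemma fps_monom_power: "(fps_const c * fps_X ^ m) ^ k = fps_const (c ^ k) * fps_X ^ (k * m)"
  for c :: "'a::comm_ring_1"
  by (simp add: power_mult_distrib power_mult [symmetric] mult.commute)

text \<open>(1 - u)(1 + u) = 1 - u^2 for u = c q^m, so the product lives on even exponents. This
  reduces the twelfth roots of unity to roots of lower order.\<close>

lemma qprod_double:
  "qprod c R * qprod (-c) R = qprod (c^2) (\<lambda>m. 2 dvd m \<and> R (m div 2))"
proof -
  have *: "(1 - fps_const c * fps_X ^ m) * (1 - fps_const (-c) * fps_X ^ m)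
          = 1 - fps_const (c^2) * fps_X ^ (2 * m)" for m
  proof -
    have "(1 - u) * (1 - (- u)) = 1 - u ^ 2" for u :: "'a fps"
      by (simp add: algebra_simps power2_eq_square)
    from this[of "fps_const c * fps_X ^ m"] show ?thesis
      unfolding fps_monom_power by (simp flip: fps_const_neg)
  qed
  have 2: "(1::nat) \<le> 2" by simp
  show ?thesis
    unfolding qprod_stretch[OF 2, symmetric]
    unfolding qprod_def infprod_mult[OF padm_qprod padm_qprod]
    by (intro infprod_cong) (simp add: * del: fps_const_neg)
qed

lemma qprod_triple:
  assumes w: "w^2 + w + 1 = (0::'a::comm_ring_1)"
  shows "qprod c R * qprod (w*c) R * qprod (w^2*c) R = qprod (c^3) (\<lambda>m. 3 dvd m \<and> R (m div 3))"
proof -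
  have *: "(1 - fps_const c * fps_X ^ m) * (1 - fps_const (w*c) * fps_X ^ m) * (1 - fps_const (w^2*c) * fps_X ^ m)
          = 1 - fps_const (c^3) * fps_X ^ (3 * m)" for m
  proof -
    have W: "(fps_const w)^2 + fps_const w + 1 = 0"
      using arg_cong[OF w, of fps_const] by (simp flip: fps_const_add)
    show ?thesis using one_minus_cube[OF W, of "fps_const c * fps_X ^ m"]
      unfolding fps_monom_power by (simp flip: mult.assoc)
  qed
  have 3: "(1::nat) \<le> 3" by simp
  show ?thesis
    unfolding qprod_stretch[OF 3, symmetric]
    unfolding qprod_def infprod_mult[OF padm_qprod padm_qprod] 
    by (subst infprod_mult[OF padm_mult[OF padm_qprod padm_qprod] padm_qprod])
       (intro infprod_cong, simp add: * del: fps_const_mult fps_const_power)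
qed

subsection \<open>Lambert series\<close>

text \<open>The Lambert series with terms f(d) q^(m d), over d >= 1 and m >= 1 with
  \<open>R m\<close>. The range {1..n} makes the constant coefficient 0, where every m would be a
  divisor.\<close>

definition lamb :: "(nat \<Rightarrow> 'a::comm_ring_1) \<Rightarrow> (nat \<Rightarrow> bool) \<Rightarrow> 'a fps" where
  "lamb f R = Abs_fps (\<lambda>n. \<Sum>m | m \<in> {1..n} \<and> m dvd n \<and> R m. f (n div m))"

lemma lamb_nth_0 [simp]: "lamb f R $ 0 = 0"
proof -
  have "{m. m \<in> {1..0} \<and> m dvd 0 \<and> R m} = {}" by auto
  thus ?thesis unfolding lamb_def fps_nth_Abs_fps by (metis (no_types, lifting) sum.empty)
qed

lemma lamb_cong:
  assumes "\<And>d. d \<ge> 1 \<Longrightarrow> f d = g d" "\<And>m. m \<ge> 1 \<Longrightarrow> R m = R' m"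
  shows "lamb f R = lamb g R'"
  unfolding lamb_def using assms
  by (auto simp: Suc_le_eq div_greater_zero_iff intro!: arg_cong[of _ _ Abs_fps] ext sum.cong)

lemma lamb_add: "lamb (\<lambda>d. f d + g d) R = lamb f R + lamb g R"
  by (rule fps_ext) (simp add: lamb_def sum.distrib)

lemma lamb_cmult: "lamb (\<lambda>d. c * f d) R = fps_const c * lamb f R"
  by (rule fps_ext) (simp add: lamb_def sum_distrib_left)

lemma lamb_union:
  assumes "\<And>m. m \<ge> 1 \<Longrightarrow> \<not> (R m \<and> R' m)" "\<And>m. m \<ge> 1 \<Longrightarrow> S m \<longleftrightarrow> R m \<or> R' m"
  shows "lamb f S = lamb f R + lamb f R'"
proof (rule fps_ext)
  fix n
  have "{m. m \<in> {1..n} \<and> m dvd n \<and> S m}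
      = {m. m \<in> {1..n} \<and> m dvd n \<and> R m} \<union> {m. m \<in> {1..n} \<and> m dvd n \<and> R' m}"
    using assms(2) by auto
  thus "lamb f S $ n = (lamb f R + lamb f R') $ n"
    using assms(1) by (simp add: lamb_def, subst sum.union_disjoint) auto
qed

text \<open>Both sides sum over pairs (m, d) contributing to q^(m d); a factor \<open>k\<close> is
  moved from d to m.\<close>

lemma lamb_stretch:
  assumes "k \<ge> 1"
  shows "lamb (\<lambda>d. if k dvd d then g (d div k) else 0) R = lamb g (\<lambda>m. k dvd m \<and> R (m div k))"
proof (rule fps_ext)
  fix n
  have "(\<Sum>m | m \<in> {1..n} \<and> m dvd n \<and> R m. if k dvd (n div m) then g ((n div m) div k) else 0)
      = (\<Sum>m | m \<in> {m. m \<in> {1..n} \<and> m dvd n \<and> R m} \<and> k dvd (n div m). g ((n div m) div k))"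
    by (rule sum.inter_filter [symmetric]) simp
  also have "\<dots> = (\<Sum>m | m \<in> {1..n} \<and> m dvd n \<and> k dvd m \<and> R (m div k). g (n div m))"
  proof (rule sum.reindex_bij_witness[of _ "\<lambda>m. m div k" "\<lambda>m. k * m"])
    fix m assume "m \<in> {m \<in> {m. m \<in> {1..n} \<and> m dvd n \<and> R m}. k dvd n div m}"
    then obtain a b where m: "1 \<le> m" "m \<le> n" "R m" "n = m * a" "a = k * b" 
      by (auto elim!: dvdE)
    thus "k * m div k = m" "g (n div (k * m)) = g (n div m div k)"
      "k * m \<in> {m. m \<in> {1..n} \<and> m dvd n \<and> k dvd m \<and> R (m div k)}"
      using assms by (auto simp: Suc_le_eq mult_ac div_mult2_eq intro!: dvd_imp_le)
  next
    fix m assume "m \<in> {m. m \<in> {1..n} \<and> m dvd n \<and> k dvd m \<and> R (m div k)}"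
    then obtain a b where m: "1 \<le> m" "m \<le> n" "R (m div k)" "n = m * a" "m = k * b" 
      by (auto elim!: dvdE)
    thus "k * (m div k) = m" using assms by simp
    have "b \<ge> 1" "a \<ge> 1" using m by (auto simp: Suc_le_eq intro!: Nat.gr0I)
    hence "b \<le> n" using m(4,5) assms by (simp add: dvd_imp_le)
    thus "m div k \<in> {m \<in> {m. m \<in> {1..n} \<and> m dvd n \<and> R m}. k dvd n div m}"
      using m assms \<open>b \<ge> 1\<close> by (auto simp: mult.assoc mult.left_commute)
  qed
  finally show "lamb (\<lambda>d. if k dvd d then g (d div k) else 0) R $ n
      = lamb g (\<lambda>m. k dvd m \<and> R (m div k)) $ n"
    by (simp add: lamb_def)
qed

text \<open>The sum of u / (1 - u)^2 over u = c q^m with \<open>R m\<close>, expanded in powers of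
  u.\<close>

definition lam1 :: "'a::comm_ring_1 \<Rightarrow> (nat \<Rightarrow> bool) \<Rightarrow> 'a fps" where
  "lam1 c R = lamb (\<lambda>d. of_nat d * c ^ d) R"

lemma lam1_nth_0 [simp]: "lam1 c R $ 0 = 0"
  by (simp add: lam1_def)

lemmas lam1_union = lamb_union[of _ _ _ "\<lambda>d. of_nat d * c ^ d" for c, folded lam1_def]

text \<open>c^d + (-c)^d kills the odd d. In the factor 4, one 2 comes from the doubled term and one
  from the weight d.\<close>

lemma lam1_double:
  "lam1 c R + lam1 (-c) R = 4 * lam1 (c^2) (\<lambda>m. 2 dvd m \<and> R (m div 2))"
proof -
  have "lam1 c R + lam1 (-c) R = lamb (\<lambda>d. if 2 dvd d then 4 * (of_nat (d div 2) * (c^2) ^ (d div 2)) else 0) R"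
    unfolding lam1_def lamb_add [symmetric]
    by (rule lamb_cong) (auto elim!: evenE oddE simp: power_mult [symmetric] algebra_simps power_add)
  also have "\<dots> = 4 * lam1 (c^2) (\<lambda>m. 2 dvd m \<and> R (m div 2))"
    by (subst lamb_stretch) (auto simp: lamb_cmult lam1_def numeral_fps_const)
  finally show ?thesis .
qed

lemma lam1_triple:
  assumes w: "w^2 + w + 1 = (0::'a::comm_ring_1)"
  shows "lam1 c R + lam1 (w*c) R + lam1 (w^2*c) R = 9 * lam1 (c^3) (\<lambda>m. 3 dvd m \<and> R (m div 3))"
proof -
  have w3: "w^3 = 1"
  proof -
    have "w^3 - 1 = (w - 1) * (w^2 + w + 1)" by (simp add: algebra_simps power2_eq_square power3_eq_cube)
    thus ?thesis using w by simp
  qed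
  have *: "of_nat d * c ^ d + of_nat d * (w*c) ^ d + of_nat d * (w^2*c)^d
      = (if 3 dvd d then 9 * (of_nat (d div 3) * (c^3) ^ (d div 3)) else 0)" for d
  proof -
    have "d = 3 * (d div 3) + d mod 3" "d mod 3 < 3" by auto
    then obtain k r where d: "d = 3 * k + r" "r < 3" by metis
    have wd: "w ^ d = w ^ r" by (simp add: d power_add power_mult w3)
    have "of_nat d * c ^ d + of_nat d * (w*c) ^ d + of_nat d * (w^2*c)^d
        = of_nat d * c ^ d * (1 + w ^ r + (w^r)^2)"
      by (simp add: algebra_simps power_mult_distrib wd power_mult [symmetric] mult.commute[of 2])
         (simp add: power_mult wd)
    also have "\<dots> = (if 3 dvd d then 9 * (of_nat (d div 3) * (c^3) ^ (d div 3)) else 0)"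
    proof -
      consider "r = 0" | "r = 1" | "r = 2" using d(2) by linarith
      thus ?thesis
      proof cases
        case 1 thus ?thesis by (simp add: d power_mult)
      next
        case 2 
        have "\<not> 3 dvd d" using 2 d by presburger
        thus ?thesis using 2 w by (simp add: add_ac)
      next
        case 3 
        have "\<not> 3 dvd d" using 3 d by presburger
        moreover have "1 + w^2 + (w^2)^2 = w^2 + w + 1" 
          using w3 by (simp add: power2_eq_square power3_eq_cube mult.assoc)
        ultimately show ?thesis using 3 w by simp
      qed
    qed
    finally show ?thesis .
  qed
  show ?thesis
    unfolding lam1_def lamb_add [symmetric] *
    by (subst lamb_stretch) (auto simp: lamb_cmult numeral_fps_const)
qed

section \<open>Series in a single monomial q^m\<close>

definition fmon :: "nat \<Rightarrow> (nat \<Rightarrow> 'a::comm_ring_1) \<Rightarrow> 'a fps" where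
  "fmon m f = Abs_fps (\<lambda>n. if m dvd n then f (n div m) else 0)"

lemma fmon_mult_one_minus:
  fixes c :: "'a::comm_ring_1"
  assumes "m \<ge> 1"
  shows "(1 - fps_const c * fps_X ^ m) * fmon m f
           = fmon m (\<lambda>d. f d - (if d = 0 then 0 else c * f (d - 1)))"
proof (rule fps_ext)
  fix n
  have "((1 - fps_const c * fps_X ^ m) * fmon m f) $ n
      = fmon m f $ n - c * (if n < m then 0 else fmon m f $ (n - m))"
    by (simp add: left_diff_distrib mult.assoc fps_X_power_mult_nth)
  also have "\<dots> = fmon m (\<lambda>d. f d - (if d = 0 then 0 else c * f (d - 1))) $ n"
  proof (cases "m dvd n")
    case True
    then obtain d where "n = m * d" by auto
    thus ?thesis using assms
      by (cases d) (auto simp: fmon_def)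
  next
    case False
    thus ?thesis by (auto simp: fmon_def dvd_diff_nat)
       (metis dvd_diffD dvd_refl linorder_not_less)
  qed
  finally show "((1 - fps_const c * fps_X ^ m) * fmon m f) $ n
      = fmon m (\<lambda>d. f d - (if d = 0 then 0 else c * f (d - 1))) $ n" .
qed

lemma fmon_single:
  assumes "m \<ge> 1"
  shows "fmon m (\<lambda>d. if d = k then c else 0) = fps_const c * fps_X ^ (k * m)"
  using assms by (intro fps_ext) (auto simp: fmon_def)

lemma fmon_add: "fmon m (\<lambda>d. f d + g d) = fmon m f + fmon m g"
  by (intro fps_ext) (auto simp: fmon_def)

lemma one_minus_monom_nonzero:
  fixes c :: "'a::comm_ring_1"
  assumes "m \<ge> 1" shows "1 - fps_const c * fps_X ^ m \<noteq> 0"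
proof
  assume "1 - fps_const c * fps_X ^ m = 0"
  hence "(1 - fps_const c * fps_X ^ m) $ 0 = 0" by simp
  thus False using assms by simp
qed

text \<open>\<open>kap1 c m = u/(1-u)^2\<close> and \<open>kap3 c m = u(1+4u+u^2)/(1-u)^4\<close> for \<open>u = c q^m\<close>.\<close>

definition kap1 :: "'a::comm_ring_1 \<Rightarrow> nat \<Rightarrow> 'a fps" where
  "kap1 c m = fmon m (\<lambda>d. of_nat d * c ^ d)"

definition kap3 :: "'a::comm_ring_1 \<Rightarrow> nat \<Rightarrow> 'a fps" where
  "kap3 c m = fmon m (\<lambda>d. of_nat d ^ 3 * c ^ d)"

lemma kap1_mult:
  fixes c :: "'a::comm_ring_1"
  assumes m: "m \<ge> 1" and u: "u = fps_const c * fps_X ^ m"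
  shows "(1 - u)^2 * kap1 c m = u"
proof -
  have "(1 - u) * kap1 c m = fmon m (\<lambda>d. if d = 0 then 0 else c ^ d)"
    unfolding kap1_def u fmon_mult_one_minus[OF m]
    by (intro arg_cong[of _ _ "fmon m"] ext, case_tac d) (auto simp: algebra_simps)
  hence "(1 - u) * ((1 - u) * kap1 c m) = fmon m (\<lambda>d. if d = 1 then c else 0)"
    unfolding u by (simp only: fmon_mult_one_minus[OF m])
     (intro arg_cong[of _ _ "fmon m"] ext, case_tac d, auto)
  thus ?thesis using m by (simp add: fmon_single u power2_eq_square mult.assoc)
qed

lemma kap3_mult:
  fixes c :: "'a::comm_ring_1"
  assumes m: "m \<ge> 1" and u: "u = fps_const c * fps_X ^ m"
  shows "(1 - u)^4 * kap3 c m = u + 4 * u^2 + u^3"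
proof -
  have "(1 - u) * kap3 c m = fmon m (\<lambda>d. if d = 0 then 0 else (3 * of_nat d ^ 2 - 3 * of_nat d + 1) * c ^ d)"
    unfolding kap3_def u fmon_mult_one_minus[OF m]
    by (intro arg_cong[of _ _ "fmon m"] ext, case_tac d) (auto simp: algebra_simps power2_eq_square power3_eq_cube)
  hence "(1 - u) * ((1 - u) * kap3 c m)
      = fmon m (\<lambda>d. if d = 0 then 0 else if d = 1 then c else (6 * of_nat d - 6) * c ^ d)"
    unfolding u by (simp only: fmon_mult_one_minus[OF m])
     (intro arg_cong[of _ _ "fmon m"] ext, case_tac d, auto simp: algebra_simps power2_eq_square)
  hence "(1 - u) * ((1 - u) * ((1 - u) * kap3 c m))
      = fmon m (\<lambda>d. if d = 0 then 0 else if d = 1 then c else if d = 2 then 5 * c^2 else 6 * c ^ d)"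
    unfolding u by (simp only: fmon_mult_one_minus[OF m])
     (intro arg_cong[of _ _ "fmon m"] ext, case_tac d, auto simp: algebra_simps power2_eq_square numeral_2_eq_2)
  hence "(1 - u) * ((1 - u) * ((1 - u) * ((1 - u) * kap3 c m)))
      = fmon m (\<lambda>d. ((if d = 1 then c else 0) + (if d = 2 then 4 * c^2 else 0)) + (if d = 3 then c^3 else 0))"
    unfolding u by (simp only: fmon_mult_one_minus[OF m])
     (intro arg_cong[of _ _ "fmon m"] ext, case_tac d, auto simp: algebra_simps power2_eq_square power3_eq_cube numeral_2_eq_2 numeral_3_eq_3)
  also have "\<dots> = u + 4 * u^2 + u^3"
    using m unfolding fmon_add by (simp add: fmon_single u fps_monom_power numeral_fps_const mult.assoc [symmetric])
  finally show ?thesis by (simp add: numeral_eq_Suc mult.assoc)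
qed

text \<open>Degenerate case of wp'' = 6 wp^2 + const. It turns the sums of squares of
  \<open>kap1\<close> that arise from second order Taylor coefficients into Lambert series with
  weight d^3.\<close>

lemma kap3_eq:
  fixes c :: "'a::idom"
  assumes m: "m \<ge> 1"
  shows "kap3 c m = 6 * kap1 c m ^ 2 + kap1 c m"
proof -
  define u where u: "u = fps_const c * fps_X ^ m"
  have "(1 - u)^4 * (6 * kap1 c m ^ 2 + kap1 c m)
      = 6 * ((1 - u)^2 * kap1 c m)^2 + (1 - u)^2 * ((1 - u)^2 * kap1 c m)"
    by (simp add: algebra_simps power2_eq_square numeral_eq_Suc)
  also have "\<dots> = u + 4 * u^2 + u^3"
    unfolding kap1_mult[OF m u] by (simp add: algebra_simps power2_eq_square power3_eq_cube)
  also have "\<dots> = (1 - u)^4 * kap3 c m" by (rule kap3_mult[OF m u, symmetric])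
  finally show ?thesis using one_minus_monom_nonzero[OF m, of c] by (simp add: u)
qed

definition lam3 :: "'a::comm_ring_1 \<Rightarrow> (nat \<Rightarrow> bool) \<Rightarrow> 'a fps" where
  "lam3 c R = lamb (\<lambda>d. of_nat d ^ 3 * c ^ d) R"

lemma lam3_nth_0 [simp]: "lam3 c R $ 0 = 0"
  by (simp add: lam3_def)

text \<open>Without \<open>f 0 = 0\<close> each of the summands would contribute f 0 to the constant
  coefficient.\<close>

lemma agree_lamb:
  assumes "f 0 = 0" "n \<le> M"
  shows "agree n (lamb f R) (\<Sum>m=1..M. if R m then fmon m f else 0)"
  unfolding agree_def
proof safe
  fix k assume k: "k \<le> n"
  have "(\<Sum>m=1..M. if R m then fmon m f else 0) $ k = (\<Sum>m\<in>{1..M}. if m dvd k \<and> R m then f (k div m) else 0)"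
    unfolding fps_sum_nth by (intro sum.cong) (auto simp: fmon_def)
  also have "\<dots> = (\<Sum>m | m \<in> {1..M} \<and> m dvd k \<and> R m. f (k div m))"
    by (rule sum.inter_filter [symmetric]) simp
  also have "\<dots> = (\<Sum>m | m \<in> {1..k} \<and> m dvd k \<and> R m. f (k div m))"
    using assms k by (intro sum.mono_neutral_right) (auto dest: dvd_imp_le)
  also have "\<dots> = lamb f R $ k" by (simp add: lamb_def)
  finally show "lamb f R $ k = (\<Sum>m=1..M. if R m then fmon m f else 0) $ k" ..
qed

subsection \<open>Taylor expansion of theta products\<close>

text \<open>A family \<open>F s\<close> whose coefficients are polynomials in \<open>s\<close>,
  with \<open>F s = a + b s + c s^2 + O(s^3)\<close>.\<close>

definition jet :: "('a::comm_ring_1 \<Rightarrow> 'a fps) \<Rightarrow> 'a fps \<Rightarrow> 'a fps \<Rightarrow> 'a fps \<Rightarrow> bool" where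
  "jet F a b c \<longleftrightarrow> (\<forall>n. \<exists>p. (\<forall>s. F s $ n = poly p s) \<and> coeff p 0 = a $ n \<and> coeff p 1 = b $ n \<and> coeff p 2 = c $ n)"

lemma jet_linear: "jet (\<lambda>s. f - fps_const s * g) f (-g) 0"
  unfolding jet_def
  by (intro allI, rule_tac x = "[:f $ n, - g $ n:]" in exI) (auto simp: numeral_2_eq_2)

lemma jet_const: "jet (\<lambda>s. f) f 0 0"
  using jet_linear[of f 0] by simp

lemma jet_add:
  assumes "jet F a b c" "jet G a' b' c'"
  shows "jet (\<lambda>s. F s + G s) (a + a') (b + b') (c + c')"
  unfolding jet_def
proof
  fix n
  obtain p where p: "\<forall>s. F s $ n = poly p s" "coeff p 0 = a $ n" "coeff p 1 = b $ n" "coeff p 2 = c $ n"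
    using assms(1) unfolding jet_def by meson
  obtain q where q: "\<forall>s. G s $ n = poly q s" "coeff q 0 = a' $ n" "coeff q 1 = b' $ n" "coeff q 2 = c' $ n"
    using assms(2) unfolding jet_def by meson
  show "\<exists>p. (\<forall>s. (F s + G s) $ n = poly p s) \<and> coeff p 0 = (a + a') $ n \<and> coeff p 1 = (b + b') $ n
      \<and> coeff p 2 = (c + c') $ n"
    by (rule exI[of _ "p + q"]) (use p q in simp)
qed

lemma jet_mult:
  assumes "jet F a b c" "jet G a' b' c'"
  shows "jet (\<lambda>s. F s * G s) (a * a') (a * b' + b * a') (a * c' + b * b' + c * a')"
  unfolding jet_def
proof
  fix n
  obtain p where p: "\<And>n s. F s $ n = poly (p n) s" "\<And>n. coeff (p n) 0 = a $ n"
    "\<And>n. coeff (p n) 1 = b $ n" "\<And>n. coeff (p n) 2 = c $ n"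
    using assms(1) unfolding jet_def by metis
  obtain q where q: "\<And>n s. G s $ n = poly (q n) s" "\<And>n. coeff (q n) 0 = a' $ n"
    "\<And>n. coeff (q n) 1 = b' $ n" "\<And>n. coeff (q n) 2 = c' $ n"
    using assms(2) unfolding jet_def by metis
  have 2: "{..2} = {0,1,2::nat}" and 1: "{..1} = {0,1::nat}" by auto
  let ?r = "\<Sum>i=0..n. p i * q (n - i)"
  show "\<exists>r. (\<forall>s. (F s * G s) $ n = poly r s) \<and> coeff r 0 = (a * a') $ n \<and> coeff r 1 = (a * b' + b * a') $ n
      \<and> coeff r 2 = (a * c' + b * b' + c * a') $ n"
  proof (intro exI[of _ ?r] conjI allI)
    show "(F s * G s) $ n = poly ?r s" for s
      by (simp add: fps_mult_nth p q poly_sum)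
    show "coeff ?r 0 = (a * a') $ n"
      by (simp add: fps_mult_nth p q coeff_sum coeff_mult)
    show "coeff ?r 1 = (a * b' + b * a') $ n"
      unfolding coeff_sum coeff_mult 1 by (simp add: fps_mult_nth p[simplified] q[simplified] sum.distrib)
    show "coeff ?r 2 = (a * c' + b * b' + c * a') $ n"
      unfolding coeff_sum coeff_mult 2 by (simp add: fps_mult_nth p[simplified] q[simplified] sum.distrib numeral_2_eq_2[symmetric] add_ac)
  qed
qed

text \<open>In characteristic 0 a polynomial is determined by its values. Hence powers of s may be
  compared in an identity that was proved for each s separately.\<close>

lemma jet_unique:
  fixes F :: "'a::{idom,ring_char_0} \<Rightarrow> 'a fps"
  assumes "jet F a b c" "jet F a' b' c'"
  shows "a = a'" "b = b'" "c = c'"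
proof -
  have "a $ n = a' $ n \<and> b $ n = b' $ n \<and> c $ n = c' $ n" for n
  proof -
    obtain p where p: "\<forall>s. F s $ n = poly p s" "coeff p 0 = a $ n" "coeff p 1 = b $ n" "coeff p 2 = c $ n"
      using assms(1) unfolding jet_def by meson
    obtain q where q: "\<forall>s. F s $ n = poly q s" "coeff q 0 = a' $ n" "coeff q 1 = b' $ n" "coeff q 2 = c' $ n"
      using assms(2) unfolding jet_def by meson
    have "poly p = poly q" using p(1) q(1) by (simp add: fun_eq_iff)
    hence "p = q" by (simp add: poly_eq_poly_eq_iff)
    thus ?thesis using p q by simp
  qed
  thus "a = a'" "b = b'" "c = c'" by (auto simp: fps_eq_iff)
qed

text \<open>The property is checked one coefficient at a time, so for each \<open>n\<close> an
  infinite product may be replaced by a different finite one.\<close>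

lemma jet_agree:
  assumes "\<And>n. \<exists>G a' b' c'. jet G a' b' c' \<and> (\<forall>s. F s $ n = G s $ n) \<and> a $ n = a' $ n \<and> b $ n = b' $ n \<and> c $ n = c' $ n"
  shows "jet F a b c"
  using assms unfolding jet_def by metis

text \<open>The shape of the jet of \<open>P \<cdot> \<Prod>(1 - s \<kappa>)\<close> with \<open>L = \<Sum>\<kappa>\<close> and \<open>K = \<Sum>(6\<kappa>^2 + \<kappa>)\<close>.\<close>

definition ljet :: "('a::field_char_0 \<Rightarrow> 'a fps) \<Rightarrow> 'a fps \<Rightarrow> 'a fps \<Rightarrow> 'a fps \<Rightarrow> bool" where
  "ljet F P L K \<longleftrightarrow> jet F P (- (P * L)) (P * (fps_const (1/12) * (6 * L^2 + L - K)))"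

lemma fps_const_1_12 [simp]: "fps_const (1/12) * (12 * f) = (f :: 'a::field_char_0 fps)"
  by (simp add: numeral_fps_const mult.assoc [symmetric])

text \<open>The second elementary symmetric function of the kappa is (p1^2 - p2)/2 with p1 = L and 6
  p2 = K - L, hence the factor 1/12. The mixed term L L' completes 6 L^2 + 6 L'^2 to 6 (L + L')^2,
  so both \<open>L\<close> and \<open>K\<close> are additive.\<close>

lemma ljet_mult:
  assumes "ljet F P L K" "ljet G P' L' K'"
  shows "ljet (\<lambda>s. F s * G s) (P * P') (L + L') (K + K')"
proof -
  let ?h = "fps_const (1/12) :: 'a fps"
  have "P * (P' * (?h * (6 * L'^2 + L' - K'))) + (- (P * L)) * (- (P' * L'))
      + (P * (?h * (6 * L^2 + L - K))) * P'
    = P * P' * (?h * (6 * L'^2 + L' - K') + ?h * (12 * (L * L')) + ?h * (6 * L^2 + L - K))"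
    unfolding fps_const_1_12 by (simp add: algebra_simps)
  also have "\<dots> = P * P' * (?h * (6 * (L + L')^2 + (L + L') - (K + K')))"
    by (simp add: algebra_simps power2_eq_square)
  finally have c: "P * (P' * (?h * (6 * L'^2 + L' - K'))) + (- (P * L)) * (- (P' * L'))
      + (P * (?h * (6 * L^2 + L - K))) * P' = \<dots>" .
  have b: "P * (- (P' * L')) + (- (P * L)) * P' = - (P * P' * (L + L'))"
    by (simp add: algebra_simps)
  show ?thesis
    using jet_mult[OF assms[unfolded ljet_def]] unfolding ljet_def b c .
qed

lemma ljet_1: "ljet (\<lambda>s. 1) 1 0 0"
  using jet_const[of 1] by (simp add: ljet_def)

text \<open>A single factor has no s^2 term, and for L = k, K = 6 k^2 + k the third coefficient of
  the jet is indeed 0.\<close>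

lemma ljet_linear:
  assumes "u = (1 - u)^2 * k"
  shows "ljet (\<lambda>s. (1 - u)^2 - fps_const s * u) ((1 - u)^2) k (6 * k^2 + k)"
  using jet_linear[of "(1 - u)^2" u] assms unfolding ljet_def by simp

lemma ljet_prod:
  assumes "finite A" "\<And>i. i \<in> A \<Longrightarrow> ljet (F i) (P i) (L i) (K i)"
  shows "ljet (\<lambda>s. \<Prod>i\<in>A. F i s) (\<Prod>i\<in>A. P i) (\<Sum>i\<in>A. L i) (\<Sum>i\<in>A. K i)"
  using assms by (induction A rule: finite_induct) (simp_all add: ljet_1 ljet_mult)

section \<open>Symmetric theta products and the functions wp and wp''\<close>

definition qpair :: "'a::field_char_0 \<Rightarrow> (nat \<Rightarrow> bool) \<Rightarrow> 'a \<Rightarrow> 'a fps" where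
  "qpair c R s = infprod (\<lambda>m. if R m then (1 - fps_const c * fps_X ^ m)^2
                                    - fps_const s * (fps_const c * fps_X ^ m) else 1)"

lemma padm_qpair: "padm (\<lambda>m. if R m then (1 - fps_const c * fps_X ^ m)^2
                                    - fps_const s * (fps_const c * fps_X ^ m) else 1)"
  unfolding padm_def
proof (intro allI impI)
  fix m :: nat assume m: "1 \<le> m"
  have "agree (m - 1) ((1 - fps_const c * fps_X ^ m)^2) (1^2)"
    using m by (intro agree_power agree_one_minus) auto
  moreover have "agree (m - 1) (fps_const s * (fps_const c * fps_X ^ m)) 0"
    using m by (auto simp: agree_def)
  ultimately have "agree (m - 1) ((1 - fps_const c * fps_X ^ m)^2 - fps_const s * (fps_const c * fps_X ^ m)) (1^2 - 0)"
    by (rule agree_diff)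
  thus "agree (m - 1) (if R m then (1 - fps_const c * fps_X ^ m)^2 - fps_const s * (fps_const c * fps_X ^ m) else 1) 1"
    by simp
qed

text \<open>(1 - u t)(1 - u/t) = (1 - u)^2 - s u depends on t only through s = t + 1/t - 2, and t =
  1 corresponds to s = 0.\<close>

lemma qprod_mult_eq_qpair:
  assumes "t \<noteq> 0"
  shows "qprod (c * t) R * qprod (c / t) R = qpair c R (t + 1 / t - 2)"
proof -
  have "(1 - fps_const (c * t) * fps_X ^ m) * (1 - fps_const (c / t) * fps_X ^ m)
      = (1 - fps_const c * fps_X ^ m)^2 - fps_const (t + 1 / t - 2) * (fps_const c * fps_X ^ m)" for m
  proof -
    have *: "(1 - C * A * x) * (1 - C * B * x) = (1 - C * x)^2 - (A + B - 2) * (C * x) + (A * B - 1) * (C * x)^2"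
      for A B C x :: "'a fps"
      by (simp add: algebra_simps power2_eq_square)
    have "fps_const t * fps_const (1 / t) = 1" using assms by simp
    with *[of "fps_const c" "fps_const t" "fps_X ^ m" "fps_const (1 / t)"]
    show ?thesis by (simp add: numeral_fps_const)
  qed
  thus ?thesis
    unfolding qprod_def infprod_mult[OF padm_qprod padm_qprod] qpair_def
    by (intro infprod_cong) auto
qed

text \<open>Each coefficient sees only finitely many factors, and for these \<open>ljet_prod\<close>
  applies; the sums of \<open>kap1\<close> and \<open>kap3\<close> over the factors are the
  truncated Lambert series.\<close>

lemma ljet_qpair: "ljet (qpair c R) ((qprod c R)^2) (lam1 c R) (lam3 c R)"
  unfolding ljet_def
proof (rule jet_agree)
  fix n :: nat
  define u where "u m = fps_const c * fps_X ^ m" for m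
  define G where "G s = (\<Prod>m=1..n. if R m then (1 - u m)^2 - fps_const s * u m else 1)" for s
  define P where "P = (\<Prod>m=1..n. if R m then (1 - u m)^2 else 1)"
  define L where "L = (\<Sum>m=1..n. if R m then kap1 c m else 0)"
  define K where "K = (\<Sum>m=1..n. if R m then kap3 c m else 0)"
  have G': "ljet (\<lambda>s. if R m then (1 - u m)^2 - fps_const s * u m else 1)
      (if R m then (1 - u m)^2 else 1) (if R m then kap1 c m else 0) (if R m then kap3 c m else 0)"
    if m: "m \<in> {1..n}" for m
  proof -
    have "ljet (\<lambda>s. (1 - u m)^2 - fps_const s * u m) ((1 - u m)^2) (kap1 c m) (kap3 c m)"
      using ljet_linear[of "u m" "kap1 c m"] kap1_mult[of m "u m" c] kap3_eq[of m c] m by (simp add: u_def)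
    thus ?thesis by (simp add: ljet_1)
  qed
  have G: "ljet G P L K"
    unfolding G_def[abs_def] P_def L_def K_def
    by (rule ljet_prod[OF finite_atLeastAtMost G'])
  have GG: "qpair c R s $ n = G s $ n" for s
    unfolding qpair_def G_def u_def by (rule agreeD[OF agree_infprod[OF padm_qpair order.refl] order.refl])
  have P: "agree n ((qprod c R)^2) P"
  proof -
    have "agree n (qprod c R) (\<Prod>m=1..n. if R m then 1 - u m else 1)"
      unfolding qprod_def u_def by (rule agree_infprod) auto
    hence "agree n ((qprod c R)^2) ((\<Prod>m=1..n. if R m then 1 - u m else 1)^2)" by (rule agree_power)
    also have "(\<Prod>m=1..n. if R m then 1 - u m else 1)^2 = P"
      unfolding P_def prod_power_distrib by (intro prod.cong) auto
    finally show ?thesis .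
  qed
  have L: "agree n (lam1 c R) L"
    unfolding lam1_def L_def kap1_def by (rule agree_lamb) auto
  have K: "agree n (lam3 c R) K"
    unfolding lam3_def K_def kap3_def by (rule agree_lamb) auto
  have b: "agree n (0 - (qprod c R)^2 * lam1 c R) (0 - P * L)"
    by (intro agree_diff agree_mult P L agree_refl)
  have c: "agree n ((qprod c R)^2 * (fps_const (1 / 12) * (6 * (lam1 c R)^2 + lam1 c R - lam3 c R)))
     (P * (fps_const (1 / 12) * (6 * L^2 + L - K)))"
    by (intro agree_diff agree_add agree_mult agree_power P L K agree_refl)
  show "\<exists>G a' b' c'. jet G a' b' c' \<and> (\<forall>s. qpair c R s $ n = G s $ n) \<and> ((qprod c R)^2) $ n = a' $ n
     \<and> (- ((qprod c R)^2 * lam1 c R)) $ n = b' $ n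
     \<and> ((qprod c R)^2 * (fps_const (1 / 12) * (6 * (lam1 c R)^2 + lam1 c R - lam3 c R))) $ n = c' $ n"
    using G GG agreeD[OF P order.refl] agreeD[OF b order.refl] agreeD[OF c order.refl] unfolding ljet_def
    by (metis diff_0)
qed

text \<open>The theta function without its Euler product, at x = z q^a with nome q^N: the product of
  (1 - x q^(N n)) (1 - q^(N (n+1)) / x) over n >= 0. Since \<open>qprod\<close> starts at m = 1, the
  factor 1 - z for a = 0 is separate.\<close>

definition qtheta :: "'a::field_char_0 \<Rightarrow> nat \<Rightarrow> nat \<Rightarrow> 'a fps" where
  "qtheta z a N = (if a = 0 then fps_const (1 - z) else 1)
     * qprod z (\<lambda>m. m mod N = a) * qprod (1 / z) (\<lambda>m. m mod N = (N - a) mod N)"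

text \<open>The Weierstrass function up to normalisation: the sum of y / (1 - y)^2 over y = x q^(N
  n), n any integer, x = z q^a. Negative n are folded back by the invariance under y -> 1/y.\<close>

definition wp :: "'a::field_char_0 \<Rightarrow> nat \<Rightarrow> nat \<Rightarrow> 'a fps" where
  "wp z a N = (if a = 0 then fps_const (z / (1 - z)^2) else 0)
     + lam1 z (\<lambda>m. m mod N = a) + lam1 (1 / z) (\<lambda>m. m mod N = (N - a) mod N)"

text \<open>The second derivative of \<open>wp\<close> with respect to x d/dx; the term for a = 0 is
  written as 6 k^2 + k in the manner of \<open>kap3_eq\<close>.\<close>

definition wp2 :: "'a::field_char_0 \<Rightarrow> nat \<Rightarrow> nat \<Rightarrow> 'a fps" where
  "wp2 z a N = (if a = 0 then fps_const (6 * (z / (1 - z)^2)^2 + z / (1 - z)^2) else 0)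
     + lam3 z (\<lambda>m. m mod N = a) + lam3 (1 / z) (\<lambda>m. m mod N = (N - a) mod N)"

definition theta_pair :: "'a::field_char_0 \<Rightarrow> nat \<Rightarrow> nat \<Rightarrow> 'a \<Rightarrow> 'a fps" where
  "theta_pair z a N s = (if a = 0 then fps_const ((1 - z)^2 - s * z) else 1)
     * qpair z (\<lambda>m. m mod N = a) s * qpair (1 / z) (\<lambda>m. m mod N = (N - a) mod N) s"

lemma qtheta_mult_eq_pair:
  assumes "t \<noteq> 0"
  shows "qtheta (z * t) a N * qtheta (z / t) a N = theta_pair z a N (t + 1 / t - 2)"
proof -
  have 1: "qprod (1 / (z * t)) R * qprod (1 / (z / t)) R = qpair (1 / z) R (t + 1 / t - 2)" for R
    using qprod_mult_eq_qpair[OF assms, of "1 / z" R] by (simp add: field_simps)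
  have 2: "(1 - z * t) * (1 - z / t) = (1 - z)^2 - (t + 1 / t - 2) * z"
    using assms by (simp add: field_simps power2_eq_square)
  have "qtheta (z * t) a N * qtheta (z / t) a N
     = (if a = 0 then fps_const ((1 - z * t) * (1 - z / t)) else 1)
      * (qprod (z * t) (\<lambda>m. m mod N = a) * qprod (z / t) (\<lambda>m. m mod N = a))
      * (qprod (1 / (z * t)) (\<lambda>m. m mod N = (N - a) mod N) * qprod (1 / (z / t)) (\<lambda>m. m mod N = (N - a) mod N))"
    by (simp add: qtheta_def mult_ac)
  thus ?thesis unfolding 1 2 qprod_mult_eq_qpair[OF assms] theta_pair_def by simp
qed

text \<open>The constant factor (1 - z)^2 - s z behaves like the others, with k = z / (1 - z)^2; at
  z = 1 the theta function vanishes and there is no such k.\<close>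

lemma ljet_theta_pair:
  assumes "a = 0 \<Longrightarrow> z \<noteq> 1"
  shows "ljet (theta_pair z a N) ((qtheta z a N)^2) (wp z a N) (wp2 z a N)"
proof -
  define k where "k = z / (1 - z)^2"
  have "ljet (\<lambda>s. if a = 0 then fps_const ((1 - z)^2 - s * z) else 1)
     (if a = 0 then fps_const ((1 - z)^2) else 1) (if a = 0 then fps_const k else 0)
     (if a = 0 then fps_const (6 * k^2 + k) else 0)"
  proof (cases "a = 0")
    case True
    have "(1 - z)^2 \<noteq> 0" using assms True by simp
    hence "fps_const z = (1 - fps_const z)^2 * fps_const k"
      by (simp add: k_def flip: fps_const_1_eq_1)
    from ljet_linear[OF this] show ?thesis using True 
      by (simp add: numeral_fps_const flip: fps_const_1_eq_1)
  qed (simp add: ljet_1)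
  from ljet_mult[OF ljet_mult[OF this ljet_qpair[of z "\<lambda>m. m mod N = a"]] ljet_qpair[of "1/z" "\<lambda>m. m mod N = (N - a) mod N"]]
  show ?thesis
    unfolding theta_pair_def[abs_def] qtheta_def wp_def wp2_def k_def
    by (cases "a = 0") (simp_all add: power_mult_distrib mult_ac)
qed

subsection \<open>Theta series and the three-term relation\<close>

text \<open>A sum over an infinite set is 0 by convention, so this is the intended series only if
  the fibres of \<open>e\<close> are finite, which \<open>ffib\<close> records.\<close>

definition gser :: "'i set \<Rightarrow> ('i \<Rightarrow> nat) \<Rightarrow> ('i \<Rightarrow> 'a::comm_ring_1) \<Rightarrow> 'a fps" where
  "gser A e c = Abs_fps (\<lambda>n. \<Sum>i | i \<in> A \<and> e i = n. c i)"

definition ffib :: "'i set \<Rightarrow> ('i \<Rightarrow> nat) \<Rightarrow> bool" where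
  "ffib A e \<longleftrightarrow> (\<forall>n. finite {i. i \<in> A \<and> e i = n})"

lemma gser_nth: "gser A e c $ n = (\<Sum>i | i \<in> A \<and> e i = n. c i)"
  by (simp add: gser_def)

lemma gser_cong:
  "A = B \<Longrightarrow> (\<And>i. i \<in> B \<Longrightarrow> e i = e' i) \<Longrightarrow> (\<And>i. i \<in> B \<Longrightarrow> c i = c' i) \<Longrightarrow> gser A e c = gser B e' c'"
  unfolding gser_def by (intro arg_cong[of _ _ Abs_fps] ext sum.cong) auto

lemma ffib_Times:
  assumes "ffib A e" "ffib B e'"
  shows "ffib (A \<times> B) (\<lambda>(i, j). e i + e' j)"
  unfolding ffib_def
proof
  fix n
  have "{p. p \<in> A \<times> B \<and> (case p of (i, j) \<Rightarrow> e i + e' j) = n}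
      \<subseteq> (\<Union>k\<le>n. {i. i \<in> A \<and> e i = k} \<times> {j. j \<in> B \<and> e' j = n - k})" by auto
  moreover have "finite \<dots>" using assms unfolding ffib_def by auto
  ultimately show "finite {p. p \<in> A \<times> B \<and> (case p of (i, j) \<Rightarrow> e i + e' j) = n}"
    by (rule finite_subset)
qed

lemma gser_mult:
  assumes "ffib A e" "ffib B e'"
  shows "gser A e c * gser B e' c' = gser (A \<times> B) (\<lambda>(i, j). e i + e' j) (\<lambda>(i, j). c i * c' j)"
proof (rule fps_ext)
  fix n
  let ?I = "\<lambda>k. {i. i \<in> A \<and> e i = k}" and ?J = "\<lambda>k. {j. j \<in> B \<and> e' j = k}"
  have "(gser A e c * gser B e' c') $ n = (\<Sum>k=0..n. (\<Sum>i\<in>?I k. c i) * (\<Sum>j\<in>?J (n - k). c' j))"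
    by (simp add: fps_mult_nth gser_nth)
  also have "\<dots> = (\<Sum>k=0..n. \<Sum>p\<in>?I k \<times> ?J (n - k). (case p of (i, j) \<Rightarrow> c i * c' j))"
    by (simp add: sum_product sum.cartesian_product)
  also have "\<dots> = (\<Sum>p\<in>(\<Union>k\<in>{0..n}. ?I k \<times> ?J (n - k)). (case p of (i, j) \<Rightarrow> c i * c' j))"
    using assms by (intro sum.UNION_disjoint [symmetric]) (auto simp: ffib_def)
  also have "(\<Union>k\<in>{0..n}. ?I k \<times> ?J (n - k)) = {p. p \<in> A \<times> B \<and> (case p of (i, j) \<Rightarrow> e i + e' j) = n}"
    by auto
  finally show "(gser A e c * gser B e' c') $ n = gser (A \<times> B) (\<lambda>(i, j). e i + e' j) (\<lambda>(i, j). c i * c' j) $ n"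
    by (simp add: gser_nth)
qed

lemma gser_reindex:
  assumes "bij_betw h A B"
  shows "gser B e c = gser A (\<lambda>i. e (h i)) (\<lambda>i. c (h i))"
proof (rule fps_ext)
  fix n
  have "bij_betw h {i. i \<in> A \<and> e (h i) = n} {j. j \<in> B \<and> e j = n}"
    using assms by (auto simp: bij_betw_def inj_on_def image_iff)
  from sum.reindex_bij_betw[OF this, of c]
  show "gser B e c $ n = gser A (\<lambda>i. e (h i)) (\<lambda>i. c (h i)) $ n"
    by (simp add: gser_nth)
qed

lemma gser_union:
  assumes "ffib (A \<union> B) e" "A \<inter> B = {}"
  shows "gser (A \<union> B) e c = gser A e c + gser B e c"
proof (rule fps_ext)
  fix n
  have *: "{i. i \<in> A \<union> B \<and> e i = n} = {i. i \<in> A \<and> e i = n} \<union> {i. i \<in> B \<and> e i = n}" by auto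
  have "finite {i. i \<in> A \<union> B \<and> e i = n}" using assms(1) unfolding ffib_def by blast
  thus "gser (A \<union> B) e c $ n = (gser A e c + gser B e c) $ n"
    unfolding gser_nth fps_add_nth * using assms(2) by (subst sum.union_disjoint) auto
qed

lemma gser_uminus: "gser A e (\<lambda>i. - c i) = - gser A e c"
  by (rule fps_ext) (simp add: gser_nth sum_negf)

lemma gser_monom_mult:
  assumes "ffib A e"
  shows "fps_const k * fps_X ^ m * gser A e c = gser A (\<lambda>i. m + e i) (\<lambda>i. k * c i)"
proof -
  have f: "ffib {()} (\<lambda>_. m)" by (simp add: ffib_def)
  have "fps_const k * fps_X ^ m = gser {()} (\<lambda>_. m) (\<lambda>_. k)"
  proof (rule fps_ext)
    fix n
    have "{i :: unit. i \<in> {()} \<and> m = n} = (if m = n then {()} else {})" by auto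
    thus "(fps_const k * fps_X ^ m) $ n = gser {()} (\<lambda>_. m) (\<lambda>_. k) $ n"
      by (simp add: gser_nth)
  qed
  moreover have "bij_betw (\<lambda>i. ((), i)) A ({()} \<times> A)" by (auto simp: bij_betw_def inj_on_def)
  ultimately show ?thesis
    by (simp add: gser_mult[OF f assms] gser_reindex)
qed

section \<open>Exponents of theta series and their growth\<close>

lemma int_mult_pred_div_2: "2 * (n * (n - 1) div 2) = n * (n - 1)" for n :: int
proof -
  have "even (n * (n - 1))" by simp
  thus ?thesis by simp
qed

definition tex :: "nat \<Rightarrow> nat \<Rightarrow> int \<Rightarrow> int" where
  "tex a N n = int N * (n * (n - 1) div 2) + int a * n"

text \<open>A linear bound suffices both for finite fibres and for truncating the sum in the triple
  product.\<close>

lemma tex_ge: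
  assumes "1 \<le> N" "a \<le> N"
  shows "tex a N n \<ge> \<bar>n\<bar> - 1"
proof (cases "n \<ge> 0")
  case True
  hence "n * (n - 1) \<ge> 2 * (n - 1)"
    using mult_right_mono[of 2 n "n - 1"] by (cases "n = 0 \<or> n = 1") auto
  hence h: "n * (n - 1) div 2 \<ge> n - 1" "n * (n - 1) div 2 \<ge> 0" 
    using int_mult_pred_div_2[of n] True by (cases "n = 0"; simp)+
  have "n - 1 \<le> 1 * (n * (n - 1) div 2)" using h by simp
  also have "\<dots> \<le> int N * (n * (n - 1) div 2)"
    using h assms by (intro mult_right_mono) auto
  finally show ?thesis using True by (simp add: tex_def add_increasing2)
next
  case False
  \<comment> \<open>For n = -m the triangular number n (n - 1) / 2 is the one for m plus m, and
    \<open>N * m\<close> absorbs the negative term -a m.\<close>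
  define m where "m = - n"
  have m: "m \<ge> 1" using False by (simp add: m_def)
  have n: "n = - m" by (simp add: m_def)
  have e: "n * (n - 1) div 2 = m * (m - 1) div 2 + m"
    using int_mult_pred_div_2[of n] int_mult_pred_div_2[of m] by (simp add: n algebra_simps)
  have "m * (m - 1) \<ge> 2 * (m - 1)"
    using m mult_right_mono[of 2 m "m - 1"] by (cases "m = 1") auto
  hence h: "m * (m - 1) div 2 \<ge> m - 1" using int_mult_pred_div_2[of m] by simp
  have "m - 1 \<le> 1 * (m * (m - 1) div 2)" using h by simp
  also have "\<dots> \<le> int N * (m * (m - 1) div 2)"
    using h assms m by (intro mult_right_mono) auto
  also have "\<dots> \<le> int N * (m * (m - 1) div 2) + (int N - int a) * m"
    using assms m by simp
  finally show ?thesis using m by (simp add: tex_def e) (simp add: n algebra_simps)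
qed

lemma tex_nonneg:
  assumes "1 \<le> N" "a \<le> N"
  shows "tex a N n \<ge> 0"
proof (cases "n = 0")
  case False
  thus ?thesis using tex_ge[OF assms, of n] by linarith
qed (simp add: tex_def)

lemma ffib_tex:
  assumes "1 \<le> N" "a \<le> N"
  shows "ffib UNIV (\<lambda>n. nat (tex a N n))"
  unfolding ffib_def
proof
  fix k
  have "{n. n \<in> UNIV \<and> nat (tex a N n) = k} \<subseteq> {- int k - 1..int k + 1}"
    using tex_ge[OF assms] tex_nonneg[OF assms] by (auto simp: abs_le_iff) (smt (verit))+
  thus "finite {n. n \<in> UNIV \<and> nat (tex a N n) = k}" by (rule finite_subset) simp
qed

text \<open>\<open>theta_ser z a N\<close> is \<open>\<Sum>\<^sub>n (-1)^n Q^(n(n-1)/2) x^n\<close> at \<open>x = z q^a\<close>, \<open>Q = q^N\<close>;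
  \<open>theta_ev\<close> and \<open>theta_od\<close> are \<open>\<Sum>\<^sub>n Q^(n^2-n) x^(2n)\<close> and \<open>\<Sum>\<^sub>n Q^(n^2) x^(2n+1)\<close>.\<close>

definition theta_ser :: "'a::field_char_0 \<Rightarrow> nat \<Rightarrow> nat \<Rightarrow> 'a fps" where
  "theta_ser z a N = gser UNIV (\<lambda>n. nat (tex a N n)) (\<lambda>n. (- z) powi n)"

definition theta_ev :: "'a::field_char_0 \<Rightarrow> nat \<Rightarrow> nat \<Rightarrow> 'a fps" where
  "theta_ev z a N = gser UNIV (\<lambda>n. nat (int N * (n * n - n) + int a * (2 * n))) (\<lambda>n. z powi (2 * n))"

definition theta_od :: "'a::field_char_0 \<Rightarrow> nat \<Rightarrow> nat \<Rightarrow> 'a fps" where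
  "theta_od z a N = gser UNIV (\<lambda>n. nat (int N * (n * n) + int a * (2 * n + 1))) (\<lambda>n. z powi (2 * n + 1))"

lemma ev_exponent_ge:
  assumes "1 \<le> N" "a \<le> N"
  shows "int N * (n * n - n) + int a * (2 * n) \<ge> 2 * (\<bar>n\<bar> - 1)"
proof -
  have "2 * (\<bar>n\<bar> - 1) \<le> 2 * tex a N n" using tex_ge[OF assms, of n] by simp
  also have "2 * tex a N n = int N * (2 * (n * (n - 1) div 2)) + 2 * (int a * n)"
    unfolding tex_def distrib_left by (simp only: mult.left_commute)
  also have "\<dots> = int N * (n * n - n) + int a * (2 * n)"
    unfolding int_mult_pred_div_2 by (simp add: right_diff_distrib)
  finally show ?thesis .
qed

lemma ev_exponent_nonneg:
  assumes "1 \<le> N" "a \<le> N"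
  shows "int N * (n * n - n) + int a * (2 * n) \<ge> 0"
  using ev_exponent_ge[OF assms, of n] by (cases "n = 0") auto

lemma od_exponent_ge:
  assumes "1 \<le> N" "a \<le> N"
  shows "int N * (n * n) + int a * (2 * n + 1) \<ge> \<bar>n\<bar> - 1"
proof (cases "n \<ge> 0")
  case True
  have "n \<le> n * n" using True by (cases "n = 0") auto
  also have "1 * (n * n) \<le> int N * (n * n)" using assms by (intro mult_right_mono) auto
  finally have "n \<le> int N * (n * n)" by simp
  moreover have "int a * (2 * n + 1) \<ge> 0" using True by simp
  ultimately show ?thesis using True by linarith
next
  case False
  define m where "m = - n"
  have m: "m \<ge> 1" "n = - m" using False by (auto simp: m_def)
  \<comment> \<open>The worst case a = N still leaves N (m - 1)^2.\<close>
  have "int a * (2 * m - 1) \<le> int N * (2 * m - 1)" using assms m by (intro mult_right_mono) auto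
  hence "int N * (n * n) + int a * (2 * n + 1) \<ge> int N * (m * m) - int N * (2 * m - 1)"
    by (simp add: m algebra_simps)
  also have "int N * (m * m) - int N * (2 * m - 1) = int N * ((m - 1) * (m - 1))" by (simp add: algebra_simps)
  finally have 1: "int N * (n * n) + int a * (2 * n + 1) \<ge> int N * ((m - 1) * (m - 1))" .
  have "m - 1 \<le> (m - 1) * (m - 1)" using m by (cases "m = 1") auto
  also have "1 * ((m - 1) * (m - 1)) \<le> int N * ((m - 1) * (m - 1))" using assms by (intro mult_right_mono) auto
  finally show ?thesis using 1 m by simp
qed

lemma od_exponent_nonneg:
  assumes "1 \<le> N" "a \<le> N"
  shows "int N * (n * n) + int a * (2 * n + 1) \<ge> 0"
  using od_exponent_ge[OF assms, of n] by (cases "n = 0") auto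

lemma ffib_abs_bound:
  assumes "\<And>n. f n \<ge> \<bar>n\<bar> - 1"
  shows "ffib UNIV (\<lambda>n::int. nat (f n))"
  unfolding ffib_def
proof
  fix k
  have "n \<in> {- int k - 1..int k + 1}" if "nat (f n) = k" for n
    using assms[of n] that unfolding atLeastAtMost_iff by linarith
  hence "{n. n \<in> UNIV \<and> nat (f n) = k} \<subseteq> {- int k - 1..int k + 1}" by blast
  thus "finite {n. n \<in> UNIV \<and> nat (f n) = k}" by (rule finite_subset) simp
qed

lemma ffib_ev: "1 \<le> N \<Longrightarrow> a \<le> N \<Longrightarrow> ffib UNIV (\<lambda>n. nat (int N * (n * n - n) + int a * (2 * n)))"
proof (rule ffib_abs_bound)
  fix n
  assume "1 \<le> N" "a \<le> N"
  thus "\<bar>n\<bar> - 1 \<le> int N * (n * n - n) + int a * (2 * n)"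
    using ev_exponent_ge[of N a n] by (cases "n = 0") auto
qed

lemma ffib_od: "1 \<le> N \<Longrightarrow> a \<le> N \<Longrightarrow> ffib UNIV (\<lambda>n. nat (int N * (n * n) + int a * (2 * n + 1)))"
  by (rule ffib_abs_bound, rule od_exponent_ge)

text \<open>As functions of \<open>x\<close>, all products \<open>\<theta>(xy)\<theta>(x/y)\<close> lie in the two-dimensional space
  spanned by \<open>theta_ev\<close> and \<open>theta_od\<close>: collect terms by the parity of \<open>m + n\<close>.\<close>

lemma bij_betw_even_sum: "bij_betw (\<lambda>(b, c). (b + c, b - c)) UNIV {(m :: int, n). even (m + n)}"
proof (rule bij_betwI[of _ _ _ "\<lambda>(m, n). ((m + n) div 2, (m - n) div 2)"], goal_cases)
  case (4 p)
  thus ?case by (cases p) (auto, presburger+)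
qed auto

lemma bij_betw_odd_sum: "bij_betw (\<lambda>(b, c). (b + c, b - c + 1)) UNIV {(m :: int, n). odd (m + n)}"
proof (rule bij_betwI[of _ _ _ "\<lambda>(m, n). ((m + n) div 2, (m - n + 1) div 2)"], goal_cases)
  case (3 p)
  obtain b c where p: "p = (b, c)" by (cases p)
  have "(b + c + (b - c + 1)) div 2 = b" "(b + c - (b - c + 1) + 1) div 2 = c" by presburger+
  thus ?case by (simp add: p)
next
  case (4 p)
  obtain m n where p: "p = (m, n)" by (cases p)
  have "odd (m + n)" using 4 by (simp add: p)
  hence "(m + n) div 2 + (m - n + 1) div 2 = m" "(m + n) div 2 - (m - n + 1) div 2 + 1 = n" by presburger+
  thus ?case by (simp add: p)
qed auto

lemma powi_sum_diff:
  fixes u v :: "'a::field"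
  assumes "u \<noteq> 0" "v \<noteq> 0"
  shows "u powi (k + l) * v powi (k - l) = (u * v) powi k * (u / v) powi l"
  using assms by (simp add: power_int_add power_int_diff power_int_mult_distrib power_int_divide_distrib)

text \<open>With m = k + l and n = k - l or k - l + 1 the product separates into a series in k and
  one in l; the prefactor w q^b supplies the odd power of w in \<open>theta_od\<close>. The odd
  class carries the sign -1, so a 2 by 2 determinant appears, on which the three-term relation
  rests.\<close>

lemma theta_ser_mult:
  fixes z w :: "'a::field_char_0"
  assumes N: "1 \<le> N" and ab: "b \<le> a" "a + b \<le> N" and nz: "z \<noteq> 0" "w \<noteq> 0"
  shows "fps_const w * fps_X ^ b * (theta_ser (z * w) (a + b) N * theta_ser (z / w) (a - b) N)
    = theta_ev z a N * theta_od w b N - theta_od z a N * theta_ev w b N"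
proof -
  let ?e1 = "\<lambda>m. tex (a + b) N m" and ?e2 = "\<lambda>n. tex (a - b) N n"
  let ?e = "\<lambda>(m, n). b + (nat (?e1 m) + nat (?e2 n))"
  let ?c = "\<lambda>(m, n). w * ((- (z * w)) powi m * (- (z / w)) powi n)"
  have N': "a \<le> N" "b \<le> N" "a - b \<le> N" using ab by auto
  have f1: "ffib UNIV (\<lambda>n. nat (?e1 n))" and f2: "ffib UNIV (\<lambda>n. nat (?e2 n))"
    using ffib_tex N N' ab by auto
  have f: "ffib UNIV (\<lambda>p. case p of (m, n) \<Rightarrow> nat (?e1 m) + nat (?e2 n))"
    using ffib_Times[OF f1 f2] by simp
  have fe: "ffib UNIV ?e"
    using ffib_Times[OF f1 f2] unfolding ffib_def
  proof safe
    fix k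
    assume *: "\<forall>n. finite {i. i \<in> UNIV \<times> UNIV \<and> (case i of (i, j) \<Rightarrow> nat (?e1 i) + nat (?e2 j)) = n}"
    have "{i. i \<in> UNIV \<and> ?e i = k} \<subseteq> {i. i \<in> UNIV \<times> UNIV \<and> (case i of (i, j) \<Rightarrow> nat (?e1 i) + nat (?e2 j)) = k - b}"
      by auto
    thus "finite {i. i \<in> UNIV \<and> ?e i = k}" using * by (meson finite_subset)
  qed
  have "fps_const w * fps_X ^ b * (theta_ser (z * w) (a + b) N * theta_ser (z / w) (a - b) N)
      = gser UNIV ?e ?c"
    unfolding theta_ser_def gser_mult[OF f1 f2] UNIV_Times_UNIV gser_monom_mult[OF f]
    by (intro gser_cong) auto
  also have "\<dots> = gser ({(m, n). even (m + n)} \<union> {(m, n). odd (m + n)}) ?e ?c"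
    by (intro gser_cong) auto
  also have "\<dots> = gser {(m, n). even (m + n)} ?e ?c + gser {(m, n). odd (m + n)} ?e ?c"
    by (rule gser_union) (use fe in \<open>auto intro: back_subst[of "\<lambda>A. ffib A ?e"]\<close>)
  also have "gser {(m, n). even (m + n)} ?e ?c = theta_ev z a N * theta_od w b N"
  proof -
    have "gser {(m, n). even (m + n)} ?e ?c = gser UNIV (\<lambda>p. ?e (case p of (b, c) \<Rightarrow> (b + c, b - c)))
        (\<lambda>p. ?c (case p of (b, c) \<Rightarrow> (b + c, b - c)))"
      by (rule gser_reindex[OF bij_betw_even_sum])
    also have "\<dots> = theta_ev z a N * theta_od w b N"
      unfolding theta_ev_def theta_od_def gser_mult[OF ffib_ev[OF N N'(1)] ffib_od[OF N N'(2)]] UNIV_Times_UNIV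
    proof (intro gser_cong refl, goal_cases)
      case (1 p)
      obtain k l where p: "p = (k, l)" by (cases p)
      have "int b + (?e1 (k + l) + ?e2 (k - l))
          = (int N * (k * k - k) + int a * (2 * k)) + (int N * (l * l) + int b * (2 * l + 1))"
      proof -
        \<comment> \<open>Doubling removes the integer division by 2 in \<open>tex\<close>.\<close>
        have "2 * (int b + (?e1 (k + l) + ?e2 (k - l))) = 2 * int b + int N * (2 * ((k + l) * (k + l - 1) div 2))
            + int N * (2 * ((k - l) * (k - l - 1) div 2)) + 2 * ((int a + int b) * (k + l) + (int a - int b) * (k - l))"
          using ab by (simp add: tex_def of_nat_diff algebra_simps)
        also have "\<dots> = 2 * ((int N * (k * k - k) + int a * (2 * k)) + (int N * (l * l) + int b * (2 * l + 1)))"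
          unfolding int_mult_pred_div_2 by (simp add: algebra_simps)
        finally show ?thesis by simp
      qed
      hence "nat (int b + (?e1 (k + l) + ?e2 (k - l)))
          = nat ((int N * (k * k - k) + int a * (2 * k)) + (int N * (l * l) + int b * (2 * l + 1)))" by simp
      thus ?case
        using tex_nonneg[OF N ab(2)] tex_nonneg[OF N N'(3)] ev_exponent_nonneg[OF N N'(1)] od_exponent_nonneg[OF N N'(2)]
        by (simp add: p nat_add_distrib)
    next
      case (2 p)
      obtain k l where p: "p = (k, l)" by (cases p)
      have "(- (z * w)) powi (k + l) * (- (z / w)) powi (k - l)
          = ((- (z * w)) * (- (z / w))) powi k * ((- (z * w)) / (- (z / w))) powi l"
        using nz by (intro powi_sum_diff) auto
      also have "(- (z * w)) * (- (z / w)) = z powi 2" using nz by (simp add: power2_eq_square)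
      also have "(- (z * w)) / (- (z / w)) = w powi 2" using nz by (simp add: power2_eq_square)
      finally have "(- (z * w)) powi (k + l) * (- (z / w)) powi (k - l) = z powi (2 * k) * w powi (2 * l)"
        unfolding power_int_mult .
      moreover have "w powi (2 * l + 1) = w powi (2 * l) * w"
        using nz by (intro power_int_add_1) auto
      ultimately show ?case unfolding p prod.case by (simp only: mult_ac)
    qed
    finally show ?thesis .
  qed
  also have "gser {(m, n). odd (m + n)} ?e ?c = - (theta_od z a N * theta_ev w b N)"
  proof -
    have "gser {(m, n). odd (m + n)} ?e ?c = gser UNIV (\<lambda>p. ?e (case p of (b, c) \<Rightarrow> (b + c, b - c + 1)))
        (\<lambda>p. ?c (case p of (b, c) \<Rightarrow> (b + c, b - c + 1)))"
      by (rule gser_reindex[OF bij_betw_odd_sum])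
    also have "\<dots> = - (theta_od z a N * theta_ev w b N)"
      unfolding theta_ev_def theta_od_def gser_mult[OF ffib_od[OF N N'(1)] ffib_ev[OF N N'(2)]] UNIV_Times_UNIV
        gser_uminus [symmetric]
    proof (intro gser_cong refl, goal_cases)
      case (1 p)
      obtain k l where p: "p = (k, l)" by (cases p)
      have "int b + (?e1 (k + l) + ?e2 (k - l + 1))
          = (int N * (k * k) + int a * (2 * k + 1)) + (int N * (l * l - l) + int b * (2 * l))"
      proof -
        have "2 * (int b + (?e1 (k + l) + ?e2 (k - l + 1))) = 2 * int b + int N * (2 * ((k + l) * (k + l - 1) div 2))
            + int N * (2 * ((k - l + 1) * (k - l + 1 - 1) div 2)) + 2 * ((int a + int b) * (k + l) + (int a - int b) * (k - l + 1))"
          using ab by (simp add: tex_def of_nat_diff algebra_simps)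
        also have "\<dots> = 2 * ((int N * (k * k) + int a * (2 * k + 1)) + (int N * (l * l - l) + int b * (2 * l)))"
          unfolding int_mult_pred_div_2 by (simp add: algebra_simps)
        finally show ?thesis by simp
      qed
      hence "nat (int b + (?e1 (k + l) + ?e2 (k - l + 1)))
          = nat ((int N * (k * k) + int a * (2 * k + 1)) + (int N * (l * l - l) + int b * (2 * l)))" by simp
      thus ?case
        using tex_nonneg[OF N ab(2)] tex_nonneg[OF N N'(3)] od_exponent_nonneg[OF N N'(1)] ev_exponent_nonneg[OF N N'(2)]
        by (simp add: p nat_add_distrib)
    next
      case (2 p)
      obtain k l where p: "p = (k, l)" by (cases p)
      have "(- (z * w)) powi (k + l) * (- (z / w)) powi (k - l + 1)
          = - (z / w) * (((- (z * w)) * (- (z / w))) powi k * ((- (z * w)) / (- (z / w))) powi l)"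
      proof -
        have "(- (z / w)) powi (k - l + 1) = (- (z / w)) powi (k - l) * (- (z / w))"
          using nz by (intro power_int_add_1) auto
        moreover have "(- (z * w)) powi (k + l) * (- (z / w)) powi (k - l)
          = ((- (z * w)) * (- (z / w))) powi k * ((- (z * w)) / (- (z / w))) powi l"
          using nz by (intro powi_sum_diff) auto
        ultimately show ?thesis by (metis (no_types, lifting) mult.assoc mult.commute)
      qed
      also have "(- (z * w)) * (- (z / w)) = z powi 2" using nz by (simp add: power2_eq_square)
      also have "(- (z * w)) / (- (z / w)) = w powi 2" using nz by (simp add: power2_eq_square)
      finally have "(- (z * w)) powi (k + l) * (- (z / w)) powi (k - l + 1) = - (z / w) * (z powi (2 * k) * w powi (2 * l))"
        unfolding power_int_mult .
      hence "w * ((- (z * w)) powi (k + l) * (- (z / w)) powi (k - l + 1)) = - (w * (z / w) * (z powi (2 * k) * w powi (2 * l)))"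
        by simp
      moreover have "z powi (2 * k + 1) = z powi (2 * k) * z" "w * (z / w) = z"
        using nz by (auto intro!: power_int_add_1)
      ultimately show ?case unfolding p prod.case by (simp only: mult_ac)
    qed
    finally show ?thesis .
  qed
  finally show ?thesis by simp
qed

subsection \<open>The Jacobi triple product\<close>

text \<open>\<open>jtp_coeff Q n k\<close> is the Gaussian binomial coefficient \<open>2n\<close> over \<open>n + k\<close>.\<close>

fun jtp_coeff :: "'a::comm_ring_1 \<Rightarrow> nat \<Rightarrow> int \<Rightarrow> 'a" where
  "jtp_coeff Q 0 k = (if k = 0 then 1 else 0)"
| "jtp_coeff Q (Suc n) k = (1 + Q ^ (2 * n + 1)) * jtp_coeff Q n k
     + Q ^ nat (int n + 1 - k) * jtp_coeff Q n (k - 1)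
     + Q ^ nat (int n + 1 + k) * jtp_coeff Q n (k + 1)"

lemma jtp_coeff_eq_0: "int n < \<bar>k\<bar> \<Longrightarrow> jtp_coeff Q n k = 0"
  by (induction n arbitrary: k) auto

definition qfact :: "'a::comm_ring_1 \<Rightarrow> nat \<Rightarrow> 'a" where
  "qfact Q n = (\<Prod>i=1..n. 1 - Q ^ i)"

lemma qfact_Suc: "qfact Q (Suc n) = qfact Q n * (1 - Q ^ Suc n)"
  by (simp add: qfact_def mult.commute)

lemma qfact_pred: "n \<ge> 1 \<Longrightarrow> qfact Q n = qfact Q (n - 1) * (1 - Q ^ n)"
  by (cases n) (auto simp: qfact_Suc)

lemma qfact_pred2:
  assumes "n \<ge> 2"
  shows "qfact Q n = qfact Q (n - 2) * (1 - Q ^ (n - 1)) * (1 - Q ^ n)"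
proof -
  obtain j where "n = Suc (Suc j)" using assms by (metis add_2_eq_Suc le_Suc_ex)
  thus ?thesis by (simp only: qfact_Suc diff_Suc_Suc diff_zero numeral_2_eq_2 diff_Suc_1)
qed

text \<open>Multiplication by both q-factorials avoids division. In the induction the neighbours k,
  k - 1, k + 1 all become multiples of \<open>qfact Q (2 * n)\<close>, and an identity in Q^m, Q^l
  and Q^(2n+1) remains.\<close>

lemma jtp_coeff_closed:
  fixes Q :: "'a::comm_ring_1"
  assumes "\<bar>k\<bar> \<le> int n"
  shows "jtp_coeff Q n k * qfact Q (nat (int n - k)) * qfact Q (nat (int n + k)) = qfact Q (2 * n)"
  using assms
proof (induction n arbitrary: k)
  case 0
  thus ?case by (simp add: qfact_def)
next
  case (Suc n)
  define m l where "m = nat (int n + 1 - k)" and "l = nat (int n + 1 + k)"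
  have ml: "m + l = 2 * n + 2" "int m = int n + 1 - k" "int l = int n + 1 + k"
    using Suc.prems by (auto simp: m_def l_def)
  define F where "F = qfact Q (2 * n)"
  have t1: "jtp_coeff Q n k * qfact Q m * qfact Q l = (1 - Q ^ m) * (1 - Q ^ l) * F"
  proof (cases "m = 0 \<or> l = 0")
    case True
    thus ?thesis using ml by (auto simp: jtp_coeff_eq_0)
  next
    case False
    hence "\<bar>k\<bar> \<le> int n" "nat (int n - k) = m - 1" "nat (int n + k) = l - 1" using ml by auto
    hence IH: "jtp_coeff Q n k * qfact Q (m - 1) * qfact Q (l - 1) = F"
      using Suc.IH[of k] by (simp add: F_def)
    have "jtp_coeff Q n k * qfact Q m * qfact Q l
        = (1 - Q ^ m) * (1 - Q ^ l) * (jtp_coeff Q n k * qfact Q (m - 1) * qfact Q (l - 1))"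
      using False by (subst (1 2) qfact_pred) (auto simp: mult_ac)
    thus ?thesis unfolding IH .
  qed
  have t2: "jtp_coeff Q n (k - 1) * qfact Q m * qfact Q l = (1 - Q ^ (l - 1)) * (1 - Q ^ l) * F"
  proof (cases "l < 2")
    case True
    hence "l = 0 \<or> l = 1" by auto
    thus ?thesis using ml by (auto simp: jtp_coeff_eq_0)
  next
    case False
    hence "\<bar>k - 1\<bar> \<le> int n" "nat (int n - (k - 1)) = m" "nat (int n + (k - 1)) = l - 2" using ml by auto
    hence IH: "jtp_coeff Q n (k - 1) * qfact Q m * qfact Q (l - 2) = F"
      using Suc.IH[of "k - 1"] by (simp add: F_def)
    have "jtp_coeff Q n (k - 1) * qfact Q m * qfact Q l
        = (1 - Q ^ (l - 1)) * (1 - Q ^ l) * (jtp_coeff Q n (k - 1) * qfact Q m * qfact Q (l - 2))"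
      using False by (subst qfact_pred2[of l]) (simp_all only: mult_ac not_less)
    thus ?thesis unfolding IH .
  qed
  have t3: "jtp_coeff Q n (k + 1) * qfact Q m * qfact Q l = (1 - Q ^ (m - 1)) * (1 - Q ^ m) * F"
  proof (cases "m < 2")
    case True
    hence "m = 0 \<or> m = 1" by auto
    thus ?thesis using ml by (auto simp: jtp_coeff_eq_0)
  next
    case False
    hence "\<bar>k + 1\<bar> \<le> int n" "nat (int n - (k + 1)) = m - 2" "nat (int n + (k + 1)) = l" using ml by auto
    hence IH: "jtp_coeff Q n (k + 1) * qfact Q (m - 2) * qfact Q l = F"
      using Suc.IH[of "k + 1"] by (simp add: F_def)
    have "jtp_coeff Q n (k + 1) * qfact Q m * qfact Q l
        = (1 - Q ^ (m - 1)) * (1 - Q ^ m) * (jtp_coeff Q n (k + 1) * qfact Q (m - 2) * qfact Q l)"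
      using False by (subst qfact_pred2[of m]) (simp_all only: mult_ac not_less)
    thus ?thesis unfolding IH .
  qed
  have "jtp_coeff Q (Suc n) k * qfact Q m * qfact Q l
     = (1 + Q ^ (2 * n + 1)) * (jtp_coeff Q n k * qfact Q m * qfact Q l)
       + Q ^ m * (jtp_coeff Q n (k - 1) * qfact Q m * qfact Q l)
       + Q ^ l * (jtp_coeff Q n (k + 1) * qfact Q m * qfact Q l)"
    by (simp add: algebra_simps m_def l_def)
  also have "\<dots> = ((1 + Q ^ (2 * n + 1)) * ((1 - Q ^ m) * (1 - Q ^ l))
     + Q ^ m * ((1 - Q ^ (l - 1)) * (1 - Q ^ l)) + Q ^ l * ((1 - Q ^ (m - 1)) * (1 - Q ^ m))) * F"
    unfolding t1 t2 t3 by (simp only: distrib_right mult.assoc)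
  also have "(1 + Q ^ (2 * n + 1)) * ((1 - Q ^ m) * (1 - Q ^ l))
     + Q ^ m * ((1 - Q ^ (l - 1)) * (1 - Q ^ l)) + Q ^ l * ((1 - Q ^ (m - 1)) * (1 - Q ^ m))
     = (1 - Q ^ (2 * n + 1)) * (1 - Q ^ (2 * n + 2))"
  proof -
    \<comment> \<open>The boundary cases are separate because the exponents m - 1 and l - 1 are
      truncated at 0.\<close>
    consider "m = 0" | "l = 0" | "m \<ge> 1" "l \<ge> 1" by linarith
    thus ?thesis
    proof cases
      case 1
      hence "l = 2 * n + 2" using ml by simp
      thus ?thesis using 1 by simp
    next
      case 2
      hence "m = 2 * n + 2" using ml by simp
      thus ?thesis using 2 by simp
    next
      case 3
      define x y R where "x = Q ^ m" and "y = Q ^ l" and "R = Q ^ (2 * n + 1)"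
      have xR: "x * Q ^ (l - 1) = R" and yR: "y * Q ^ (m - 1) = R" 
      proof -
        have "m + (l - 1) = 2 * n + 1" "l + (m - 1) = 2 * n + 1" using 3 ml(1) by auto
        thus "x * Q ^ (l - 1) = R" "y * Q ^ (m - 1) = R"
          unfolding x_def y_def R_def power_add [symmetric] by simp_all
      qed
      have xy: "Q ^ (2 * n + 2) = x * y"
        unfolding x_def y_def power_add [symmetric] ml(1) ..
      have "(1 + R) * ((1 - x) * (1 - y)) + x * ((1 - Q ^ (l - 1)) * (1 - y)) + y * ((1 - Q ^ (m - 1)) * (1 - x))
        = (1 + R) * ((1 - x) * (1 - y)) + (x - x * Q ^ (l - 1)) * (1 - y) + (y - y * Q ^ (m - 1)) * (1 - x)"
      proof -
        have "u * ((1 - v) * w) = (u - u * v) * w" for u v w :: 'a by (simp add: algebra_simps)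
        thus ?thesis by (simp only: )
      qed
      also have "\<dots> = (1 - R) * (1 - x * y)" unfolding xR yR by (simp add: algebra_simps)
      finally show ?thesis unfolding xy unfolding x_def y_def R_def .
    qed
  qed
  also have "(1 - Q ^ (2 * n + 1)) * (1 - Q ^ (2 * n + 2)) * F = qfact Q (2 * Suc n)"
  proof -
    have "2 * Suc n = Suc (Suc (2 * n))" "2 * n + 1 = Suc (2 * n)" "2 * n + 2 = Suc (Suc (2 * n))" by simp_all
    thus ?thesis unfolding F_def by (simp only: qfact_Suc mult_ac)
  qed
  finally have "jtp_coeff Q (Suc n) k * qfact Q m * qfact Q l = qfact Q (2 * Suc n)" .
  moreover have "m = nat (int (Suc n) - k)" "l = nat (int (Suc n) + k)"
    by (simp_all add: m_def l_def algebra_simps)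
  ultimately show ?case by (simp only:)
qed

definition tmon :: "'a::field_char_0 \<Rightarrow> nat \<Rightarrow> nat \<Rightarrow> int \<Rightarrow> 'a fps" where
  "tmon z a N k = fps_const ((- z) powi k) * fps_X ^ nat (tex a N k)"

lemma tex_succ: "tex a N (k + 1) = tex a N k + int N * k + int a"
proof -
  have "2 * tex a N (k + 1) = int N * (2 * ((k + 1) * (k + 1 - 1) div 2)) + 2 * (int a * (k + 1))"
    unfolding tex_def distrib_left by (simp only: mult.left_commute)
  also have "\<dots> = int N * (2 * (k * (k - 1) div 2)) + 2 * (int a * k) + 2 * (int N * k + int a)"
    unfolding int_mult_pred_div_2 by (simp add: algebra_simps)
  also have "\<dots> = 2 * (tex a N k + int N * k + int a)"
    unfolding tex_def distrib_left by (simp only: mult.left_commute)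
  finally show ?thesis by simp
qed

lemma tmon_step_up:
  assumes N: "1 \<le> N" "a \<le> N" and z: "z \<noteq> 0" and k: "k \<le> int n + 1"
  shows "fps_const (- z) * fps_X ^ (a + N * n) * tmon z a N (k - 1)
           = (fps_X ^ N) ^ nat (int n + 1 - k) * tmon z a N k"
proof -
  have "int (a + N * n) + tex a N (k - 1) = int N * (int n + 1 - k) + tex a N k"
    using tex_succ[of a N "k - 1"] by (simp add: algebra_simps)
  also have "int N * (int n + 1 - k) = int (N * nat (int n + 1 - k))" using k by simp
  finally have "nat (int (a + N * n) + tex a N (k - 1)) = nat (int (N * nat (int n + 1 - k)) + tex a N k)"
    by simp
  hence e: "a + N * n + nat (tex a N (k - 1)) = N * nat (int n + 1 - k) + nat (tex a N k)"
    using tex_nonneg[OF N] by (simp add: nat_add_distrib del: of_nat_add of_nat_mult)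
  have c: "(- z) powi k = - z * (- z) powi (k - 1)"
    using power_int_add_1[of "- z" "k - 1"] z by simp
  have "fps_const (- z) * fps_X ^ (a + N * n) * tmon z a N (k - 1)
      = fps_const (- z * (- z) powi (k - 1)) * fps_X ^ (a + N * n + nat (tex a N (k - 1)))"
    unfolding tmon_def power_add fps_const_mult[symmetric] by (simp only: mult_ac)
  also have "\<dots> = (fps_X ^ N) ^ nat (int n + 1 - k) * tmon z a N k"
    unfolding c[symmetric] e tmon_def power_add power_mult by (simp only: mult_ac)
  finally show ?thesis .
qed

lemma tmon_step_down:
  assumes N: "1 \<le> N" "a \<le> N" and z: "z \<noteq> 0" and k: "- int n - 1 \<le> k"
  shows "fps_const (- (1 / z)) * fps_X ^ (N - a + N * n) * tmon z a N (k + 1)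
           = (fps_X ^ N) ^ nat (int n + 1 + k) * tmon z a N k"
proof -
  have "int (N - a + N * n) + tex a N (k + 1) = int N * (int n + 1 + k) + tex a N k"
    using tex_succ[of a N k] N by (simp add: algebra_simps of_nat_diff)
  also have "int N * (int n + 1 + k) = int (N * nat (int n + 1 + k))" using k by simp
  finally have "nat (int (N - a + N * n) + tex a N (k + 1)) = nat (int (N * nat (int n + 1 + k)) + tex a N k)"
    by simp
  hence e: "N - a + N * n + nat (tex a N (k + 1)) = N * nat (int n + 1 + k) + nat (tex a N k)"
    using tex_nonneg[OF N] by (simp add: nat_add_distrib del: of_nat_add of_nat_mult)
  have c: "(- z) powi k = - (1 / z) * (- z) powi (k + 1)"
    using power_int_add_1[of "- z" k] z by simp
  have "fps_const (- (1 / z)) * fps_X ^ (N - a + N * n) * tmon z a N (k + 1)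
      = fps_const (- (1 / z) * (- z) powi (k + 1)) * fps_X ^ (N - a + N * n + nat (tex a N (k + 1)))"
    unfolding tmon_def power_add fps_const_mult[symmetric] by (simp only: mult_ac)
  also have "\<dots> = (fps_X ^ N) ^ nat (int n + 1 + k) * tmon z a N k"
    unfolding c[symmetric] e tmon_def power_add power_mult by (simp only: mult_ac)
  finally show ?thesis .
qed

definition jtp_prod :: "'a::field_char_0 \<Rightarrow> nat \<Rightarrow> nat \<Rightarrow> nat \<Rightarrow> 'a fps" where
  "jtp_prod z a N n = (\<Prod>i<n. (1 - fps_const z * fps_X ^ (a + N * i)) * (1 - fps_const (1 / z) * fps_X ^ (N - a + N * i)))"

lemma sum_int_shift:
  fixes f g :: "int \<Rightarrow> 'a::comm_monoid_add"
  assumes "\<And>k. \<bar>k\<bar> > int n \<Longrightarrow> g k = 0" "\<bar>d\<bar> \<le> 1"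
  shows "(\<Sum>k=-int n..int n. g k) = (\<Sum>k=-int (Suc n)..int (Suc n). g (k + d))"
proof -
  have "(\<Sum>k=-int n..int n. g k) = (\<Sum>k=-int (Suc n)+d..int (Suc n)+d. g k)"
    using assms by (intro sum.mono_neutral_left) (auto simp: abs_le_iff)
  also have "\<dots> = (\<Sum>k=-int (Suc n)..int (Suc n). g (k + d))"
    by (rule sum.reindex_bij_witness[of _ "\<lambda>k. k + d" "\<lambda>k. k - d"]) auto
  finally show ?thesis .
qed

text \<open>The new pair of factors expands to 1 + Q^(2n+1) + A + B, where A moves the index of a
  monomial up by 1 and B moves it down by 1; this is the recursion of
  \<open>jtp_coeff\<close>.\<close>

lemma jtp_finite:
  assumes N: "1 \<le> N" "a \<le> N" and z: "z \<noteq> 0"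
  shows "jtp_prod z a N n = (\<Sum>k=-int n..int n. jtp_coeff (fps_X ^ N) n k * tmon z a N k)"
proof (induction n)
  case 0
  show ?case by (simp add: jtp_prod_def tmon_def tex_def)
next
  case (Suc n)
  let ?Q = "fps_X ^ N :: 'a fps"
  let ?c = "jtp_coeff ?Q n" and ?T = "tmon z a N"
  let ?A = "fps_const (- z) * fps_X ^ (a + N * n)" and ?B = "fps_const (- (1 / z)) * fps_X ^ (N - a + N * n)"
  let ?S = "\<lambda>f. \<Sum>k=-int n..int n. f k" and ?S' = "\<lambda>f. \<Sum>k=-int (Suc n)..int (Suc n). f k"
  have AB: "?A * ?B = ?Q ^ (2 * n + 1)"
  proof -
    have "?A * ?B = fps_const (- z * - (1 / z)) * fps_X ^ (a + N * n + (N - a + N * n))"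
      unfolding power_add fps_const_mult[symmetric] by (simp only: mult_ac)
    also have "a + N * n + (N - a + N * n) = N * (2 * n + 1)" using N by (simp add: algebra_simps)
    also have "- z * - (1 / z) = 1" using z by simp
    finally show ?thesis unfolding power_mult fps_const_1_eq_1 mult_1_left .
  qed
  have "jtp_prod z a N (Suc n) = jtp_prod z a N n * ((1 + ?A) * (1 + ?B))"
    by (simp add: jtp_prod_def flip: fps_const_neg)
  also have "(1 + ?A) * (1 + ?B) = 1 + ?Q ^ (2 * n + 1) + ?A + ?B"
  proof -
    have "(1 + x) * (1 + y) = 1 + x * y + x + y" for x y :: "'a fps"
      by (simp add: algebra_simps)
    from this[of ?A ?B] show ?thesis unfolding AB .
  qed
  also have "jtp_prod z a N n * \<dots> = (1 + ?Q ^ (2 * n + 1)) * ?S (\<lambda>k. ?c k * ?T k)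
      + ?S (\<lambda>k. ?c k * (?A * ?T k)) + ?S (\<lambda>k. ?c k * (?B * ?T k))"
  proof -
    have d: "S * (1 + R + A + B) = (1 + R) * S + A * S + B * S" for S R A B :: "'a fps"
      by (simp add: algebra_simps)
    have m: "D * ?S (\<lambda>k. ?c k * ?T k) = ?S (\<lambda>k. ?c k * (D * ?T k))" for D
      unfolding sum_distrib_left by (intro sum.cong refl) (simp only: mult_ac)
    show ?thesis unfolding Suc.IH d m[of ?A] m[of ?B] ..
  qed
  also have "?S (\<lambda>k. ?c k * ?T k) = ?S' (\<lambda>k. ?c k * ?T k)"
    using sum_int_shift[of n "\<lambda>k. ?c k * ?T k" 0] by (simp add: jtp_coeff_eq_0)
  also have "?S (\<lambda>k. ?c k * (?A * ?T k)) = ?S' (\<lambda>k. ?c (k - 1) * (?A * ?T (k - 1)))"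
    using sum_int_shift[of n "\<lambda>k. ?c k * (?A * ?T k)" "-1"] by (simp add: jtp_coeff_eq_0)
  also have "\<dots> = ?S' (\<lambda>k. ?Q ^ nat (int n + 1 - k) * ?c (k - 1) * ?T k)"
    by (intro sum.cong refl) (subst tmon_step_up[OF N z], auto simp: mult_ac)
  also have "?S (\<lambda>k. ?c k * (?B * ?T k)) = ?S' (\<lambda>k. ?c (k + 1) * (?B * ?T (k + 1)))"
    using sum_int_shift[of n "\<lambda>k. ?c k * (?B * ?T k)" 1] by (simp add: jtp_coeff_eq_0)
  also have "\<dots> = ?S' (\<lambda>k. ?Q ^ nat (int n + 1 + k) * ?c (k + 1) * ?T k)"
    by (intro sum.cong refl) (subst tmon_step_down[OF N z], auto simp: mult_ac)
  also have "(1 + ?Q ^ (2 * n + 1)) * ?S' (\<lambda>k. ?c k * ?T k)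
       + ?S' (\<lambda>k. ?Q ^ nat (int n + 1 - k) * ?c (k - 1) * ?T k)
       + ?S' (\<lambda>k. ?Q ^ nat (int n + 1 + k) * ?c (k + 1) * ?T k)
     = ?S' (\<lambda>k. jtp_coeff ?Q (Suc n) k * ?T k)"
    unfolding sum_distrib_left sum.distrib [symmetric]
    by (intro sum.cong refl) (simp only: jtp_coeff.simps distrib_right mult.assoc)
  finally show ?case .
qed

text \<open>The representative r lies in 1..N, so that the class of 0 starts with the exponent
  N.\<close>

lemma prod_residue:
  fixes g :: "nat \<Rightarrow> 'a::comm_monoid_mult"
  assumes "1 \<le> N" "0 < r" "r \<le> N"
  shows "(\<Prod>m=1..N*k. if m mod N = r mod N then g m else 1) = (\<Prod>i<k. g (r + N * i))"
proof -
  have "(\<Prod>m=1..N*k. if m mod N = r mod N then g m else 1) = prod g {m \<in> {1..N*k}. m mod N = r mod N}"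
    by (rule prod.inter_filter [symmetric]) simp
  also have "{m \<in> {1..N*k}. m mod N = r mod N} = (\<lambda>i. r + N * i) ` {..<k}"
  proof (intro equalityI subsetI)
    fix m assume "m \<in> (\<lambda>i. r + N * i) ` {..<k}"
    then obtain i where i: "i < k" "m = r + N * i" by auto
    have "r + N * i \<le> N * (i + 1)" using assms by simp
    also have "\<dots> \<le> N * k" using i by (intro mult_left_mono) auto
    finally show "m \<in> {m \<in> {1..N*k}. m mod N = r mod N}" using i assms by auto
  next
    fix m assume m: "m \<in> {m \<in> {1..N*k}. m mod N = r mod N}"
    define i where "i = (m - r) div N"
    have "m \<ge> r"
    proof (cases "r = N")
      case True
      hence "N dvd m" using m by auto
      thus ?thesis using m True by (auto intro: dvd_imp_le)
    next
      case False
      hence "m mod N = r" using m assms by simp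
      thus ?thesis by (metis mod_less_eq_dividend)
    qed
    hence "N dvd (m - r)" using m mod_eq_dvd_iff_nat[OF \<open>m \<ge> r\<close>, of N] by simp
    hence mi: "m = r + N * i" using \<open>m \<ge> r\<close> by (simp add: i_def)
    have "m \<le> N * k" using m by simp
    hence "N * i < N * k" using mi assms(2) by linarith
    hence "i < k" by simp
    thus "m \<in> (\<lambda>i. r + N * i) ` {..<k}" using mi by auto
  qed
  also have "prod g \<dots> = (\<Prod>i<k. g (r + N * i))"
    using assms by (subst prod.reindex) (auto simp: inj_on_def)
  finally show ?thesis .
qed

lemma agree_qtheta:
  assumes N: "1 \<le> N" "a < N"
  shows "agree n (qtheta z a N) (jtp_prod z a N (Suc n))"
proof -
  have "n \<le> N * Suc n" "n \<le> N * n" using N(1) by (simp_all add: trans_le_add2)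
  have res: "(\<Prod>m=1..N*k. if m mod N = r mod N then 1 - fps_const c * fps_X ^ m else 1)
      = (\<Prod>i<k. 1 - fps_const c * fps_X ^ (r + N * i))" if "0 < r" "r \<le> N" for r k and c :: 'a
    by (rule prod_residue[OF N(1) that])
  have 2: "agree n (qprod (1 / z) (\<lambda>m. m mod N = (N - a) mod N))
           (\<Prod>i<Suc n. 1 - fps_const (1 / z) * fps_X ^ (N - a + N * i))"
  proof -
    have "0 < N - a" "N - a \<le> N" using N by auto
    note r = res[OF this]
    show ?thesis
      unfolding qprod_def r[symmetric] by (rule agree_infprod[OF padm_qprod \<open>n \<le> N * Suc n\<close>])
  qed
  have 1: "agree n ((if a = 0 then fps_const (1 - z) else 1) * qprod z (\<lambda>m. m mod N = a))
           (\<Prod>i<Suc n. 1 - fps_const z * fps_X ^ (a + N * i))"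
  proof (cases "a = 0")
    case False
    hence "0 < a" "a \<le> N" using N by auto
    note r = res[OF this]
    have "agree n (qprod z (\<lambda>m. m mod N = a mod N)) (\<Prod>i<Suc n. 1 - fps_const z * fps_X ^ (a + N * i))"
      unfolding qprod_def r[symmetric] by (rule agree_infprod[OF padm_qprod \<open>n \<le> N * Suc n\<close>])
    thus ?thesis using False N by simp
  next
    \<comment> \<open>For a = 0 the factor i = 0 of \<open>jtp_prod\<close> is the constant 1 - z;
      the others, shifted by one, form the class with r = N.\<close>
    case True
    have "0 < N" "N \<le> N" using N by auto
    note r = res[OF this]
    have "agree n (qprod z (\<lambda>m. m mod N = N mod N)) (\<Prod>i<n. 1 - fps_const z * fps_X ^ (N + N * i))"
      unfolding qprod_def r[symmetric] by (rule agree_infprod[OF padm_qprod \<open>n \<le> N * n\<close>])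
    hence "agree n (qprod z (\<lambda>m. m mod N = 0)) (\<Prod>i<n. 1 - fps_const z * fps_X ^ (N + N * i))"
      by simp
    hence "agree n (fps_const (1 - z) * qprod z (\<lambda>m. m mod N = 0))
      (fps_const (1 - z) * (\<Prod>i<n. 1 - fps_const z * fps_X ^ (N + N * i)))"
      by (intro agree_mult agree_refl)
    also have "fps_const (1 - z) * (\<Prod>i<n. 1 - fps_const z * fps_X ^ (N + N * i))
       = (\<Prod>i<Suc n. 1 - fps_const z * fps_X ^ (a + N * i))"
      by (simp add: prod.lessThan_Suc_shift True del: prod.lessThan_Suc flip: fps_const_1_eq_1)
    finally show ?thesis using True by simp
  qed
  show ?thesis
    using agree_mult[OF 1 2] unfolding qtheta_def jtp_prod_def prod.distrib .
qed

lemma agree_cancel_unit: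
  fixes f g h :: "'a::field fps"
  assumes "agree n (h * f) (h * g)" "h $ 0 \<noteq> 0"
  shows "agree n f g"
  using agree_mult[OF agree_refl[of n "inverse h"] assms(1)] assms(2)
  by (simp add: mult.assoc[symmetric] inverse_mult_eq_1)

text \<open>Limit of \<open>jtp_finite\<close>: the Gaussian binomial is a quotient of one
  q-factorial by two others, all tending to E, so E times it tends to 1.\<close>

theorem jacobi_triple_product:
  assumes N: "1 \<le> N" "a < N" and z: "z \<noteq> (0::'a::field_char_0)"
  shows "theta_ser z a N = qprod 1 (\<lambda>m. N dvd m) * qtheta z a N"
proof (rule agree_eqI)
  fix L
  let ?E = "qprod 1 (\<lambda>m. N dvd m) :: 'a fps" and ?Q = "fps_X ^ N :: 'a fps"
  \<comment> \<open>With n = 2 L + 2 all three q-factorials have length at least L whenever |k| <= L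
    + 1, and the monomials with |k| > L + 1 vanish modulo q^(L+1).\<close>
  define n where "n = Suc (2 * L + 1)"
  have aN: "a \<le> N" using N by simp
  have qf: "agree L (qfact ?Q j) ?E" if "L \<le> j" for j
  proof -
    have p: "padm (\<lambda>i. if True then 1 - fps_const 1 * fps_X ^ (N * i) else 1 :: 'a fps)"
      unfolding padm_def if_True
    proof (intro allI impI agree_one_minus)
      fix m :: nat assume "1 \<le> m"
      moreover have "1 * m \<le> N * m" using N(1) by (intro mult_right_mono) auto
      ultimately show "m - 1 < N * m" by linarith
    qed
    have "agree L (infprod (\<lambda>i. if True then 1 - fps_const 1 * fps_X ^ (N * i) else 1 :: 'a fps))
        (\<Prod>i=1..j. if True then 1 - fps_const 1 * fps_X ^ (N * i) else 1)"
      by (rule agree_infprod[OF p that])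
    thus ?thesis unfolding qprod_stretch[OF N(1)] qfact_def by (simp add: power_mult agree_sym)
  qed
  have c1: "agree L (?E * jtp_coeff ?Q n k) 1" if "\<bar>k\<bar> \<le> int L + 1" for k
  proof (rule agree_cancel_unit)
    have "agree L (?E * (jtp_coeff ?Q n k * ?E)) (qfact ?Q (nat (int n + k)) * (jtp_coeff ?Q n k * qfact ?Q (nat (int n - k))))"
      using that by (intro agree_mult agree_refl agree_sym[OF qf]) (auto simp: n_def)
    also have "\<dots> = qfact ?Q (2 * n)"
      using jtp_coeff_closed[of k n ?Q] that by (simp add: n_def mult_ac del: jtp_coeff.simps)
    also have "agree L \<dots> ?E" by (rule qf) (simp add: n_def)
    finally show "agree L (?E * (?E * jtp_coeff ?Q n k)) (?E * 1)" by (simp add: mult_ac)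
  qed simp
  have T0: "agree L (tmon z a N k) 0" if "\<bar>k\<bar> > int L + 1" for k
    using tex_ge[OF N(1) aN, of k] that by (auto simp: agree_def tmon_def)
  have "agree L (qtheta z a N) (jtp_prod z a N n)"
    unfolding n_def by (rule agree_mono[OF agree_qtheta[OF N]]) simp
  hence "agree L (?E * qtheta z a N) (?E * jtp_prod z a N n)" by (intro agree_mult agree_refl)
  also have "?E * jtp_prod z a N n = (\<Sum>k=-int n..int n. ?E * jtp_coeff ?Q n k * tmon z a N k)"
    unfolding jtp_finite[OF N(1) aN z] by (simp add: sum_distrib_left mult.assoc)
  also have "agree L \<dots> (\<Sum>k=-int n..int n. tmon z a N k)"
    unfolding agree_def fps_sum_nth
  proof (intro allI impI sum.cong refl)
    fix i k assume i: "i \<le> L"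
    have "agree L (?E * jtp_coeff ?Q n k * tmon z a N k) (tmon z a N k)"
    proof (cases "\<bar>k\<bar> \<le> int L + 1")
      case True
      from agree_mult[OF c1[OF True] agree_refl[of L "tmon z a N k"]] show ?thesis by simp
    next
      case False
      hence "agree L (tmon z a N k) 0" by (intro T0) auto
      from agree_mult[OF agree_refl[of L "?E * jtp_coeff ?Q n k"] this] this show ?thesis
        by (auto intro: agree_trans agree_sym)
    qed
    thus "(?E * jtp_coeff ?Q n k * tmon z a N k) $ i = tmon z a N k $ i" using i by (simp add: agree_def)
  qed
  also have "agree L \<dots> (theta_ser z a N)"
    unfolding agree_def
  proof (intro allI impI)
    fix i assume i: "i \<le> L"
    have "(\<Sum>k=-int n..int n. tmon z a N k) $ i = (\<Sum>k\<in>{-int n..int n}. if nat (tex a N k) = i then (- z) powi k else 0)"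
      by (auto simp: fps_sum_nth tmon_def intro!: sum.cong)
    also have "\<dots> = (\<Sum>k | k \<in> {-int n..int n} \<and> nat (tex a N k) = i. (- z) powi k)"
      by (rule sum.inter_filter [symmetric]) simp
    also have "{k. k \<in> {-int n..int n} \<and> nat (tex a N k) = i} = {k. k \<in> UNIV \<and> nat (tex a N k) = i}"
    proof -
      have "k \<in> {-int n..int n}" if "nat (tex a N k) = i" for k
        using tex_ge[OF N(1) aN, of k] that i unfolding atLeastAtMost_iff n_def by linarith
      thus ?thesis by blast
    qed
    finally show "(\<Sum>k=-int n..int n. tmon z a N k) $ i = theta_ser z a N $ i"
      by (simp add: theta_ser_def gser_nth)
  qed
  finally show "agree L (theta_ser z a N) (?E * qtheta z a N)" by (rule agree_sym)
qed

text \<open>Substitution n -> -n. It brings the index N back to 0, which covers the case a + b = N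
  of the theta quotients.\<close>

lemma theta_ser_reflect:
  assumes "a \<le> N"
  shows "theta_ser z (N - a) N = theta_ser (1 / z) a N"
proof -
  have "bij_betw uminus UNIV (UNIV :: int set)" by (auto simp: bij_betw_def)
  hence "theta_ser (1 / z) a N = gser UNIV (\<lambda>n. nat (tex a N (- n))) (\<lambda>n. (- (1 / z)) powi (- n))"
    unfolding theta_ser_def by (rule gser_reindex)
  also have "\<dots> = theta_ser z (N - a) N"
    unfolding theta_ser_def
  proof (intro gser_cong refl)
    fix n :: int
    have "2 * tex a N (- n) = int N * (2 * ((- n) * (- n - 1) div 2)) + 2 * (int a * (- n))"
      unfolding tex_def distrib_left by (simp only: mult.left_commute)
    also have "\<dots> = int N * (2 * (n * (n - 1) div 2)) + 2 * (int (N - a) * n)"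
      unfolding int_mult_pred_div_2 using assms by (simp add: algebra_simps of_nat_diff)
    also have "\<dots> = 2 * tex (N - a) N n"
      unfolding tex_def distrib_left by (simp only: mult.left_commute)
    finally show "nat (tex a N (- n)) = nat (tex (N - a) N n)" by simp
    show "(- (1 / z)) powi (- n) = (- z) powi n"
      by (simp add: power_int_minus power_int_minus_left power_int_divide_distrib)
  qed
  finally show ?thesis ..
qed

section \<open>The three-term relation and its Taylor expansion\<close>

text \<open>Solving t^2 - (2 + s) t + 1 = 0 lets s run through the whole field, which is where
  complex coefficients enter.\<close>

lemma ex_joukowski: "\<exists>t::complex. t \<noteq> 0 \<and> t + 1 / t - 2 = s"
proof -
  define t where "t = (2 + s + csqrt ((2 + s)^2 - 4)) / 2"
  have "2 * t = 2 + s + csqrt ((2 + s)^2 - 4)" by (simp only: t_def times_divide_eq_right) simp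
  hence "(2 * t - (2 + s))^2 = (2 + s)^2 - 4" by simp
  hence "4 * (t * (t - (2 + s)) + 1) = 0" by (simp add: power2_eq_square algebra_simps)
  hence *: "t * (t - (2 + s)) = -1" by (simp add: add_eq_0_iff2)
  hence "t \<noteq> 0" by auto
  moreover have "t + 1 / t - 2 = s" using * \<open>t \<noteq> 0\<close> by (simp add: field_simps)
  ultimately show ?thesis by blast
qed

text \<open>(\<open>theta_ev\<close>, \<open>theta_od\<close>) is a vector in a plane, and each
  theta product is a determinant of two such vectors. For the vectors at z, w, 1 and t the claim is
  the Pluecker relation between their six determinants.\<close>

lemma three_term:
  fixes z w :: complex
  assumes N: "1 \<le> N" "a < N" and ab: "b \<le> a" "a + b \<le> N" and nz: "z \<noteq> 0" "w \<noteq> 0"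
  defines "e \<equiv> qprod 1 (\<lambda>m. N dvd m)"
  shows "fps_const w * fps_X ^ b * (theta_ser (z * w) (a + b) N * theta_ser (z / w) (a - b) N) * theta_pair 1 0 N s
         = e^2 * (qtheta z a N)^2 * theta_pair w b N s - e^2 * (qtheta w b N)^2 * theta_pair z a N s"
proof -
  obtain t where t: "t \<noteq> 0" "s = t + 1 / t - 2" using ex_joukowski[of s] by auto
  have b: "b < N" "b \<le> N" "a \<le> N" using N ab by auto
  have e: "e \<noteq> 0" by (simp add: e_def)
  define D where "D u c v d = theta_ev u c N * theta_od v d N - theta_od u c N * theta_ev v d N" for u v :: complex and c d
  have pl: "D z a w b * D 1 0 t 0 - D z a 1 0 * D w b t 0 + D z a t 0 * D w b 1 0 = 0"
    unfolding D_def by (simp add: algebra_simps)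
  have D1: "D z a w b = fps_const w * fps_X ^ b * (theta_ser (z * w) (a + b) N * theta_ser (z / w) (a - b) N)"
    unfolding D_def by (rule theta_ser_mult[symmetric]) (use N ab nz in auto)
  define E where "E = fps_const w * fps_X ^ b * (theta_ser (z * w) (a + b) N * theta_ser (z / w) (a - b) N)"
  note D1 = D1[folded E_def]
  have Dt: "D u c t 0 = fps_const t * (e^2 * theta_pair u c N s)" if u: "u \<noteq> 0" "c < N" for u c
  proof -
    have "D u c t 0 = fps_const t * (theta_ser (u * t) c N * theta_ser (u / t) c N)"
      unfolding D_def using theta_ser_mult[of N 0 c u t] N(1) u t by simp
    also have "theta_ser (u * t) c N * theta_ser (u / t) c N = e^2 * (qtheta (u * t) c N * qtheta (u / t) c N)"
      using N u t by (simp add: jacobi_triple_product e_def power2_eq_square mult_ac)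
    finally show ?thesis using t by (simp add: qtheta_mult_eq_pair)
  qed
  have D0: "D u c 1 0 = e^2 * (qtheta u c N)^2" if u: "u \<noteq> 0" "c < N" for u c
  proof -
    have "D u c 1 0 = theta_ser u c N * theta_ser u c N"
      unfolding D_def using theta_ser_mult[of N 0 c u 1] N(1) u by simp
    thus ?thesis using N u by (simp add: jacobi_triple_product e_def power2_eq_square mult_ac)
  qed
  have "fps_const t * e^2 * (E * theta_pair 1 0 N s
      - (e^2 * (qtheta z a N)^2 * theta_pair w b N s - e^2 * (qtheta w b N)^2 * theta_pair z a N s))
      = D z a w b * D 1 0 t 0 - D z a 1 0 * D w b t 0 + D z a t 0 * D w b 1 0"
    using N b nz by (simp add: D1 D0 Dt algebra_simps)
  also have "\<dots> = 0" by (rule pl)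
  finally have "E * theta_pair 1 0 N s
      = e^2 * (qtheta z a N)^2 * theta_pair w b N s - e^2 * (qtheta w b N)^2 * theta_pair z a N s"
    using e t by simp
  thus ?thesis unfolding E_def .
qed

text \<open>At z = 1 the constant factor is just -s, so the remaining product has to be expanded
  only to first order.\<close>

lemma jet_pair_one:
  assumes "1 \<le> N"
  defines "e \<equiv> qprod 1 (\<lambda>m. N dvd m)"
  shows "jet (theta_pair 1 0 N) 0 (- (e^4)) (2 * e^4 * lam1 1 (\<lambda>m. N dvd m))"
proof -
  define R where "R = (\<lambda>m. N dvd m)"
  have R: "(\<lambda>m. m mod N = 0) = R" "(\<lambda>m. m mod N = (N - 0) mod N) = R" by (auto simp: R_def)
  have e: "e = qprod 1 R" by (simp add: e_def R_def)
  have q: "ljet (\<lambda>s. qpair 1 R s * qpair 1 R s) (e^2 * e^2) (lam1 1 R + lam1 1 R) (lam3 1 R + lam3 1 R)"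
    unfolding e by (rule ljet_mult[OF ljet_qpair ljet_qpair])
  have l: "jet (\<lambda>s. fps_const ((1 - 1)^2 - s * 1)) 0 (-1) 0"
    using jet_linear[of 0 1] by simp
  have p: "theta_pair 1 0 N = (\<lambda>s. fps_const ((1 - 1)^2 - s * 1) * (qpair 1 R s * qpair 1 R s))"
    unfolding theta_pair_def[abs_def] R by (simp add: mult.assoc R flip: R_def)
  show ?thesis
    unfolding p using jet_mult[OF l q[unfolded ljet_def]]
    by (simp add: R_def[symmetric] power4_eq_xxxx power2_eq_square algebra_simps)
qed

text \<open>In \<open>three_term\<close> the coefficient of s^0 is trivial and that of s is the
  classical sigma quotient for a difference of wp-values. At s^2 the squares enter as 6 (wp_z^2 -
  wp_w^2), so the difference of the wp''-values contains the difference of the wp-values as a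
  factor.\<close>

theorem wp_relations:
  fixes z w :: complex
  assumes N: "1 \<le> N" "a < N" and ab: "b \<le> a" "a + b \<le> N" and nz: "z \<noteq> 0" "w \<noteq> 0"
    and z1: "a = 0 \<Longrightarrow> z \<noteq> 1" and w1: "b = 0 \<Longrightarrow> w \<noteq> 1"
  defines "e \<equiv> qprod 1 (\<lambda>m. N dvd m)"
  shows "(wp w b N - wp z a N) * (qtheta z a N)^2 * (qtheta w b N)^2
           = fps_const w * fps_X ^ b * e^2 * (theta_ser (z * w) (a + b) N * theta_ser (z / w) (a - b) N)"
        (is ?th1)
    and "wp2 z a N - wp2 w b N
           = (wp z a N - wp w b N) * (6 * (wp z a N + wp w b N) + 1 - 24 * lam1 1 (\<lambda>m. N dvd m))" (is ?th2)
proof -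
  define E where "E = fps_const w * fps_X ^ b * (theta_ser (z * w) (a + b) N * theta_ser (z / w) (a - b) N)"
  define P Q where "P = qtheta z a N" and "Q = qtheta w b N"
  define K where "K = lam1 (1::complex) (\<lambda>m. N dvd m)"
  let ?x = "wp z a N" and ?y = "wp w b N" and ?x2 = "wp2 z a N" and ?y2 = "wp2 w b N"
  let ?h = "fps_const (1/12) :: complex fps"
  have e0: "e \<noteq> 0" by (simp add: e_def)
  have P0: "P \<noteq> 0" using z1 by (simp add: P_def qtheta_def)
  have Q0: "Q \<noteq> 0" using w1 by (simp add: Q_def qtheta_def)
  have j1: "jet (\<lambda>s. E * theta_pair 1 0 N s) (E * 0) (E * (- (e^4)) + 0 * 0)
      (E * (2 * e^4 * K) + 0 * (- (e^4)) + 0 * 0)"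
    unfolding K_def e_def by (rule jet_mult[OF jet_const jet_pair_one[OF N(1)]])
  have jx: "jet (\<lambda>s. (- (e^2 * Q^2)) * theta_pair z a N s) (- (e^2 * Q^2) * P^2)
      (- (e^2 * Q^2) * (- (P^2 * ?x)) + 0 * P^2)
      (- (e^2 * Q^2) * (P^2 * (?h * (6 * ?x^2 + ?x - ?x2))) + 0 * (- (P^2 * ?x)) + 0 * P^2)"
    using jet_mult[OF jet_const ljet_theta_pair[of a z N, unfolded ljet_def], of "- (e^2 * Q^2)"] z1 unfolding P_def by simp
  have jy: "jet (\<lambda>s. e^2 * P^2 * theta_pair w b N s) (e^2 * P^2 * Q^2)
      (e^2 * P^2 * (- (Q^2 * ?y)) + 0 * Q^2)
      (e^2 * P^2 * (Q^2 * (?h * (6 * ?y^2 + ?y - ?y2))) + 0 * (- (Q^2 * ?y)) + 0 * Q^2)"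
    using jet_mult[OF jet_const ljet_theta_pair[of b w N, unfolded ljet_def], of "e^2 * P^2"] w1 unfolding Q_def by simp
  have "E * theta_pair 1 0 N s = e^2 * P^2 * theta_pair w b N s + (- (e^2 * Q^2)) * theta_pair z a N s" for s
    using three_term[OF N ab nz, of s] unfolding E_def P_def Q_def e_def by (simp add: mult.assoc)
  hence "(\<lambda>s. E * theta_pair 1 0 N s) = (\<lambda>s. e^2 * P^2 * theta_pair w b N s + (- (e^2 * Q^2)) * theta_pair z a N s)" 
    by (rule ext)
  note j2 = jet_add[OF jy jx, folded this]
  note u = jet_unique[OF j1 j2]
  have "e^2 * (e^2 * E - P^2 * Q^2 * (?y - ?x)) = 0"
    using u(2) by (simp add: algebra_simps power4_eq_xxxx power2_eq_square)
  hence 1: "e^2 * E = P^2 * Q^2 * (?y - ?x)" using e0 by simp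
  thus ?th1 unfolding E_def P_def Q_def by (simp only: mult_ac)
  \<comment> \<open>The factor 12 clears the 1/12 in \<open>ljet\<close>.\<close>
  have "12 * (E * (2 * e^4 * K)) = 12 * ((e^2 * P^2 * (Q^2 * (?h * (6 * ?y^2 + ?y - ?y2))))
       + (- (e^2 * Q^2) * (P^2 * (?h * (6 * ?x^2 + ?x - ?x2)))))"
    using u(3) by simp
  also have "\<dots> = e^2 * P^2 * Q^2 * ((?h * (12 * (6 * ?y^2 + ?y - ?y2))) - (?h * (12 * (6 * ?x^2 + ?x - ?x2))))"
  proof -
    have "12 * (c * P * (Q * (h * p)) + (- (c * Q)) * (P * (h * q))) = c * P * Q * (h * (12 * p) - h * (12 * q))"
      for c P Q h p q :: "complex fps" by (simp add: algebra_simps)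
    thus ?thesis .
  qed
  also have "\<dots> = e^2 * P^2 * Q^2 * ((6 * ?y^2 + ?y - ?y2) - (6 * ?x^2 + ?x - ?x2))"
    unfolding fps_const_1_12 ..
  also have "12 * (E * (2 * e^4 * K)) = e^2 * (e^2 * E) * (24 * K)"
    by (simp add: power4_eq_xxxx power2_eq_square)
  finally have "e^2 * P^2 * Q^2 * ((?y - ?x) * (24 * K)) = e^2 * P^2 * Q^2 * ((6 * ?y^2 + ?y - ?y2) - (6 * ?x^2 + ?x - ?x2))"
    unfolding 1 by (simp only: mult_ac)
  hence "(?y - ?x) * (24 * K) = (6 * ?y^2 + ?y - ?y2) - (6 * ?x^2 + ?x - ?x2)"
    using e0 P0 Q0 by simp
  thus ?th2 unfolding K_def[symmetric] by (simp add: algebra_simps power2_eq_square)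
qed

subsection \<open>Theta quotients at torsion points\<close>

text \<open>Laurent series form a field, so eta quotients can be formed. \<open>ee d\<close> is
  eta(d z) without its power q^(d/24).\<close>

definition qe :: "complex \<Rightarrow> nat \<Rightarrow> complex fls" where
  "qe c d = fps_to_fls (qprod c (\<lambda>m. d dvd m))"

abbreviation ee :: "nat \<Rightarrow> complex fls" where
  "ee \<equiv> qe 1"

definition wl :: "complex \<Rightarrow> nat \<Rightarrow> complex fls" where
  "wl c d = fps_to_fls (lam1 c (\<lambda>m. d dvd m))"

abbreviation wl1 :: "nat \<Rightarrow> complex fls" where
  "wl1 \<equiv> wl 1"

definition Th :: "complex \<Rightarrow> nat \<Rightarrow> nat \<Rightarrow> complex fls" where
  "Th z a N = fps_to_fls (qtheta z a N)"

definition Wp :: "complex \<Rightarrow> nat \<Rightarrow> nat \<Rightarrow> complex fls" where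
  "Wp z a N = fps_to_fls (wp z a N)"

lemma qe_nonzero [simp]: "qe c d \<noteq> 0"
  by (simp add: qe_def)

lemma double_dvd: "2 dvd m \<and> d dvd m div 2 \<longleftrightarrow> 2 * d dvd (m::nat)"
  by (auto elim!: dvdE)

lemma triple_dvd: "3 dvd m \<and> d dvd m div 3 \<longleftrightarrow> 3 * d dvd (m::nat)"
  by (auto elim!: dvdE)

lemma qe_double: "qe c d * qe (- c) d = qe (c^2) (2 * d)"
  unfolding qe_def fls_times_fps_to_fls[symmetric] qprod_double double_dvd ..

lemma wl_double: "wl c d + wl (- c) d = 4 * wl (c^2) (2 * d)"
  unfolding wl_def fps_to_fls_plus[symmetric] lam1_double double_dvd
  by (simp add: fls_times_fps_to_fls)

definition om :: complex where "om = Complex (- 1 / 2) (sqrt 3 / 2)"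

lemma om_eq: "om^2 + om + 1 = 0"
  by (simp add: om_def power2_eq_square complex_eq_iff)

lemma om_sq: "om^2 = - 1 - om"
  using om_eq by (simp add: algebra_simps eq_neg_iff_add_eq_0)

lemma om_mult [simp]: "om * om = - 1 - om"
  using om_sq by (simp add: power2_eq_square)

lemma om_nonzero [simp]: "om \<noteq> 0"
  using om_eq by auto

lemma om_cube: "om^3 = 1"
  by (simp add: power3_eq_cube algebra_simps)

lemma om_mult_om_sq: "om * om^2 = 1"
  by (simp add: power2_eq_square algebra_simps)

lemma om_sq_sq: "(om^2)^2 = om"
  by (simp add: om_sq) (simp add: power2_eq_square algebra_simps)

lemma inverse_om: "1 / om = om^2" 
  by (metis om_mult_om_sq nonzero_mult_div_cancel_left om_nonzero)

lemma inverse_om_sq: "1 / om^2 = om"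
  by (metis om_mult_om_sq nonzero_mult_div_cancel_right om_nonzero power_not_zero)

lemma om_neq [simp]: "om \<noteq> 1" "om^2 \<noteq> 1" "om \<noteq> -1" "om^2 \<noteq> -1"
  by (auto simp: om_def power2_eq_square complex_eq_iff)

lemma qe_triple: "ee d * (qe om d * qe (om^2) d) = ee (3 * d)"
  using qprod_triple[OF om_eq, of 1 "\<lambda>m. d dvd m"]
  unfolding qe_def fls_times_fps_to_fls[symmetric] triple_dvd by (simp add: mult.assoc)

lemma wl_triple: "wl1 d + (wl om d + wl (om^2) d) = 9 * wl1 (3 * d)"
  using arg_cong[OF lam1_triple[OF om_eq, of 1 "\<lambda>m. d dvd m"], of fps_to_fls]
  unfolding wl_def triple_dvd by (simp add: fls_times_fps_to_fls add.assoc)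

lemma qe_minus_one: "qe (- 1) d = ee (2 * d) / ee d"
  using qe_double[of 1 d] by (simp add: field_simps)

lemma wl_minus_one: "wl (- 1) d = 4 * wl1 (2 * d) - wl1 d"
  using wl_double[of 1 d] by (simp add: algebra_simps)

lemma qe_om: "qe om d * qe (om^2) d = ee (3 * d) / ee d"
  using qe_triple[of d] by (simp add: field_simps)

lemma wl_om: "wl om d + wl (om^2) d = 9 * wl1 (3 * d) - wl1 d"
  using wl_triple[of d] by (simp add: algebra_simps)

text \<open>Squaring interchanges om and om^2, so the pair at -om is the pair at om for 2 d divided
  by the pair at om for d.\<close>

lemma qe_minus_om: "qe (- om) d * qe (- (om^2)) d = ee (6 * d) * ee d / (ee (2 * d) * ee (3 * d))"
proof -
  have "(qe om d * qe (om^2) d) * (qe (- om) d * qe (- (om^2)) d) = qe om (2 * d) * qe (om^2) (2 * d)"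
    using qe_double[of om d] qe_double[of "om^2" d, unfolded om_sq_sq] by (simp add: mult_ac)
  thus ?thesis unfolding qe_om by (simp add: field_simps)
qed

lemma wl_minus_om: "wl (- om) d + wl (- (om^2)) d
    = 36 * wl1 (6 * d) - 4 * wl1 (2 * d) - 9 * wl1 (3 * d) + wl1 d"
proof -
  have "(wl om d + wl (om^2) d) + (wl (- om) d + wl (- (om^2)) d) = 4 * (wl om (2 * d) + wl (om^2) (2 * d))"
    using wl_double[of om d] wl_double[of "om^2" d, unfolded om_sq_sq] by (simp add: algebra_simps)
  thus ?thesis unfolding wl_om by (simp add: algebra_simps)
qed

lemma Th_0: "Th z 0 N = fls_const (1 - z) * (qe z N * qe (1 / z) N)"
proof -
  have "(\<lambda>m. m mod N = 0) = (\<lambda>m. N dvd m)" "(\<lambda>m. m mod N = (N - 0) mod N) = (\<lambda>m. N dvd m)" by auto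
  thus ?thesis by (simp add: Th_def qtheta_def qe_def fls_times_fps_to_fls mult.assoc)
qed

lemma Wp_0: "Wp z 0 N = fls_const (z / (1 - z)^2) + (wl z N + wl (1 / z) N)"
proof -
  have "(\<lambda>m. m mod N = 0) = (\<lambda>m. N dvd m)" "(\<lambda>m. m mod N = (N - 0) mod N) = (\<lambda>m. N dvd m)" by auto
  thus ?thesis by (simp add: Wp_def wp_def wl_def fls_times_fps_to_fls add.assoc)
qed

lemma mod_double_eq: "0 < n \<Longrightarrow> m mod (2 * n) = n \<longleftrightarrow> n dvd m \<and> \<not> 2 * n dvd (m::nat)"
proof
  assume n: "0 < n" and *: "m mod (2 * n) = n"
  have "m = 2 * n * (m div (2 * n)) + n" using * by (metis mult_div_mod_eq)
  thus "n dvd m \<and> \<not> 2 * n dvd m" using n * 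
    by (metis dvd_add_times_triv_left_iff dvd_refl dvd_triv_left dvd_mult2 dvd_add mod_0_imp_dvd dvd_imp_mod_0 mult.assoc mult.commute less_numeral_extra(3))
next
  assume n: "0 < n" and *: "n dvd m \<and> \<not> 2 * n dvd m"
  then obtain k where k: "m = n * k" by auto
  hence "odd k" using * by (auto elim!: evenE)
  then obtain j where "k = 2 * j + 1" by (auto elim!: oddE)
  hence "m = n + (2 * n) * j" using k by (simp add: algebra_simps)
  thus "m mod (2 * n) = n" using n by simp
qed

lemma qprod_half:
  assumes "0 < n" shows "fps_to_fls (qprod c (\<lambda>m. m mod (2 * n) = n)) = qe c n / qe c (2 * n)"
proof -
  have "qprod c (\<lambda>m. n dvd m) = qprod c (\<lambda>m. m mod (2 * n) = n) * qprod c (\<lambda>m. 2 * n dvd m)"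
    using assms by (intro qprod_union) (auto simp: mod_double_eq intro: dvd_mult_right)
  thus ?thesis by (simp add: qe_def fls_times_fps_to_fls field_simps)
qed

lemma lam1_half:
  assumes "0 < n" shows "fps_to_fls (lam1 c (\<lambda>m. m mod (2 * n) = n)) = wl c n - wl c (2 * n)"
proof -
  have "lam1 c (\<lambda>m. n dvd m) = lam1 c (\<lambda>m. m mod (2 * n) = n) + lam1 c (\<lambda>m. 2 * n dvd m)"
    using assms by (intro lam1_union) (auto simp: mod_double_eq intro: dvd_mult_right)
  thus ?thesis by (simp add: wl_def)
qed

lemma Th_half: "0 < n \<Longrightarrow> Th z n (2 * n) = qe z n * qe (1 / z) n / (qe z (2 * n) * qe (1 / z) (2 * n))"
  by (simp add: Th_def qtheta_def fls_times_fps_to_fls qprod_half)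

lemma Wp_half: "0 < n \<Longrightarrow> Wp z n (2 * n) = wl z n + wl (1 / z) n - (wl z (2 * n) + wl (1 / z) (2 * n))"
  by (simp add: Wp_def wp_def lam1_half)

lemma Th_reflect: "0 < a \<Longrightarrow> a < N \<Longrightarrow> Th z (N - a) N = Th (1 / z) a N"
  by (simp add: Th_def qtheta_def fls_times_fps_to_fls mult_ac)

lemma Th_m1_0: "Th (- 1) 0 N = fls_const 2 * (ee (2 * N) / ee N)^2"
  by (simp add: Th_0 qe_minus_one power2_eq_square)

lemma Th_om_0: "Th om 0 N = fls_const (1 - om) * (ee (3 * N) / ee N)"
  unfolding Th_0 inverse_om qe_om ..

lemma Th_om2_0: "Th (om^2) 0 N = fls_const (1 - om^2) * (ee (3 * N) / ee N)"
  unfolding Th_0 inverse_om_sq qe_om[symmetric] by (simp only: mult_ac)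

lemma Th_mom_0: "Th (- om) 0 N = fls_const (1 + om) * (ee (6 * N) * ee N / (ee (2 * N) * ee (3 * N)))"
proof -
  have "1 / (- om) = - (om^2)" using inverse_om by simp
  thus ?thesis unfolding Th_0 qe_minus_om[symmetric] by simp
qed

lemma Th_mom2_0: "Th (- (om^2)) 0 N = fls_const (1 + om^2) * (ee (6 * N) * ee N / (ee (2 * N) * ee (3 * N)))"
proof -
  have "1 / (- (om^2)) = - om" using inverse_om_sq by simp
  thus ?thesis unfolding Th_0 qe_minus_om[symmetric] by (simp add: mult_ac)
qed

lemma Th_1_half: "0 < n \<Longrightarrow> Th 1 n (2 * n) = (ee n / ee (2 * n))^2"
  by (simp add: Th_half power2_eq_square)

lemma Th_m1_half: "0 < n \<Longrightarrow> Th (- 1) n (2 * n) = (ee (2 * n)^2 / (ee n * ee (4 * n)))^2"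
  by (simp add: Th_half qe_minus_one power2_eq_square)

lemma Th_om_half: "0 < n \<Longrightarrow> Th om n (2 * n) = ee (3 * n) * ee (2 * n) / (ee n * ee (6 * n))"
  by (simp add: Th_half inverse_om qe_om)

lemma Th_mom_half: "0 < n \<Longrightarrow> Th (- om) n (2 * n)
    = ee (6 * n)^2 * ee n * ee (4 * n) / (ee (2 * n)^2 * ee (3 * n) * ee (12 * n))"
proof -
  assume n: "0 < n"
  have "1 / (- om) = - (om^2)" using inverse_om by simp
  hence "Th (- om) n (2 * n) = qe (- om) n * qe (- (om^2)) n / (qe (- om) (2 * n) * qe (- (om^2)) (2 * n))"
    using Th_half[OF n, of "- om"] by simp
  thus ?thesis unfolding qe_minus_om by (simp add: field_simps power2_eq_square)
qed

lemma Th_mom2_half: "0 < n \<Longrightarrow> Th (- (om^2)) n (2 * n) = Th (- om) n (2 * n)"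
proof -
  assume n: "0 < n"
  have "1 / (- om) = - (om^2)" "1 / (- (om^2)) = - om" using inverse_om inverse_om_sq by simp_all
  thus ?thesis unfolding Th_half[OF n] by (simp only: mult_ac)
qed

lemma Wp_m1_0: "Wp (- 1) 0 N = fls_const (- 1 / 4) + 8 * wl1 (2 * N) - 2 * wl1 N"
  by (simp add: Wp_0 wl_minus_one algebra_simps)

lemma Wp_om_0: "Wp om 0 N = fls_const (- 1 / 3) + 9 * wl1 (3 * N) - wl1 N"
proof -
  have "om / (1 - om)^2 = - 1 / 3"
  proof -
    have "(1 - om)^2 = - 3 * om" by (simp add: power2_eq_square algebra_simps)
    thus ?thesis by simp
  qed
  thus ?thesis unfolding Wp_0 inverse_om wl_om by simp
qed

lemma Wp_mom2_0: "Wp (- (om^2)) 0 N = - 1 + 36 * wl1 (6 * N) - 4 * wl1 (2 * N) - 9 * wl1 (3 * N) + wl1 N"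
proof -
  have 1: "1 / (- (om^2)) = - om" using inverse_om_sq by simp
  have "- (om^2) / (1 - (- (om^2)))^2 = - 1"
  proof -
    have "(1 - (- (om^2)))^2 = om^2" unfolding om_sq by (simp add: power2_eq_square algebra_simps)
    thus ?thesis by simp
  qed
  thus ?thesis unfolding Wp_0 1 using wl_minus_om[of N] by (simp add: algebra_simps)
qed

lemma Wp_1_half: "0 < n \<Longrightarrow> Wp 1 n (2 * n) = 2 * wl1 n - 2 * wl1 (2 * n)"
  by (subst Wp_half) simp_all

lemma Wp_om_half: "0 < n \<Longrightarrow> Wp om n (2 * n)
    = 9 * wl1 (3 * n) - wl1 n - 9 * wl1 (6 * n) + wl1 (2 * n)"
  by (simp add: Wp_half inverse_om wl_om)

text \<open>The classes a and -a fill the multiples of d that are not multiples of N, so the two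
  products combine to a quotient of Euler products. In the applications N = 3 d.\<close>

lemma Th_1_third:
  assumes "\<And>m. m mod N = a \<or> m mod N = b \<longleftrightarrow> d dvd m \<and> \<not> N dvd m" "a + b = N" "0 < a" "0 < b" "d dvd N" "a \<noteq> b"
  shows "Th 1 a N = ee d / ee N" and "Wp 1 a N = wl1 d - wl1 N"
proof -
  have b: "(N - a) mod N = b" using assms by auto
  have R: "d dvd m \<longleftrightarrow> (m mod N = a \<or> m mod N = b) \<or> N dvd m" for m
    using assms(1)[of m] assms(5) by (auto intro: dvd_trans)
  have "qprod 1 (\<lambda>m. d dvd m) = qprod 1 (\<lambda>m. m mod N = a) * qprod 1 (\<lambda>m. m mod N = b) * qprod (1::complex) (\<lambda>m. N dvd m)"
  proof -
    have "qprod (1::complex) (\<lambda>m. d dvd m) = qprod 1 (\<lambda>m. m mod N = a \<or> m mod N = b) * qprod 1 (\<lambda>m. N dvd m)"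
      by (rule qprod_union) (use assms(1) R in blast)+
    also have "qprod (1::complex) (\<lambda>m. m mod N = a \<or> m mod N = b) = qprod 1 (\<lambda>m. m mod N = a) * qprod 1 (\<lambda>m. m mod N = b)"
      by (rule qprod_union) (use \<open>a \<noteq> b\<close> in auto)
    finally show ?thesis .
  qed
  thus "Th 1 a N = ee d / ee N" using assms(3)
    by (simp add: Th_def qtheta_def b qe_def fls_times_fps_to_fls field_simps)
  have "lam1 1 (\<lambda>m. d dvd m) = lam1 1 (\<lambda>m. m mod N = a) + lam1 1 (\<lambda>m. m mod N = b) + lam1 (1::complex) (\<lambda>m. N dvd m)"
  proof -
    have "lam1 (1::complex) (\<lambda>m. d dvd m) = lam1 1 (\<lambda>m. m mod N = a \<or> m mod N = b) + lam1 1 (\<lambda>m. N dvd m)"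
      by (rule lam1_union) (use assms(1) R in blast)+
    also have "lam1 (1::complex) (\<lambda>m. m mod N = a \<or> m mod N = b) = lam1 1 (\<lambda>m. m mod N = a) + lam1 1 (\<lambda>m. m mod N = b)"
      by (rule lam1_union) (use \<open>a \<noteq> b\<close> in auto)
    finally show ?thesis .
  qed
  thus "Wp 1 a N = wl1 d - wl1 N" using assms(3)
    by (simp add: Wp_def wp_def b wl_def)
qed

lemma Th_1_1_3: "Th 1 1 3 = ee 1 / ee 3" "Wp 1 1 3 = wl1 1 - wl1 3"
  by (rule Th_1_third[where b = 2]; presburger)+

lemma Th_1_2_6: "Th 1 2 6 = ee 2 / ee 6" "Wp 1 2 6 = wl1 2 - wl1 6"
  by (rule Th_1_third[where b = 4]; presburger)+

lemma Th_1_4_12: "Th 1 4 12 = ee 4 / ee 12"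
  by (rule Th_1_third[where b = 8]; presburger)+

text \<open>Combining the points c and -c squares x and passes from nome q^N to q^(2N), as in
  \<open>qprod_double\<close> and \<open>lam1_double\<close>.\<close>

lemma Th_double:
  assumes "0 < a" "a < N"
  shows "Th c a N * Th (- c) a N = Th (c^2) (2 * a) (2 * N)"
    and "Wp c a N + Wp (- c) a N = 4 * Wp (c^2) (2 * a) (2 * N)"
proof -
  have e: "2 dvd m \<and> m div 2 mod N = r \<longleftrightarrow> m mod (2 * N) = 2 * r" for m r :: nat
  proof safe
    assume "2 dvd m" thus "m mod (2 * N) = 2 * (m div 2 mod N)" by (auto elim!: evenE simp: mult_mod_right)
  next
    assume *: "m mod (2 * N) = 2 * r" 
    have "even (m mod (2 * N))" using * by simp
    thus "2 dvd m" by (metis dvd_mod_iff dvd_triv_left)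
    thus "m div 2 mod N = r" using * by (auto elim!: evenE simp: mult_mod_right[symmetric])
  qed
  have m: "(N - a) mod N = N - a" "(2 * N - 2 * a) mod (2 * N) = 2 * (N - a)" using assms by auto
  have c: "1 / (- c) = - (1 / c)" "1 / c^2 = (1 / c)^2" by (auto simp: power_one_over)
  have "qtheta c a N * qtheta (- c) a N = (qprod c (\<lambda>m. m mod N = a) * qprod (- c) (\<lambda>m. m mod N = a))
     * (qprod (1 / c) (\<lambda>m. m mod N = N - a) * qprod (- (1 / c)) (\<lambda>m. m mod N = N - a))"
    using assms by (simp add: qtheta_def m mult_ac)
  also have "\<dots> = qtheta (c^2) (2 * a) (2 * N)"
    unfolding qprod_double e using assms by (simp add: qtheta_def m power_one_over)
  finally show "Th c a N * Th (- c) a N = Th (c^2) (2 * a) (2 * N)"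
    by (simp add: Th_def fls_times_fps_to_fls[symmetric])
  have "wp c a N + wp (- c) a N = (lam1 c (\<lambda>m. m mod N = a) + lam1 (- c) (\<lambda>m. m mod N = a))
     + (lam1 (1 / c) (\<lambda>m. m mod N = N - a) + lam1 (- (1 / c)) (\<lambda>m. m mod N = N - a))"
    using assms by (simp add: wp_def m add_ac)
  also have "\<dots> = 4 * wp (c^2) (2 * a) (2 * N)"
    unfolding lam1_double e using assms by (simp add: wp_def m power_one_over algebra_simps)
  finally show "Wp c a N + Wp (- c) a N = 4 * Wp (c^2) (2 * a) (2 * N)"
    unfolding Wp_def fps_to_fls_plus[symmetric] by (simp add: fls_times_fps_to_fls)
qed

lemma Th_nonzero [simp]: "0 < a \<Longrightarrow> Th z a N \<noteq> 0"
  by (simp add: Th_def qtheta_def)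

lemma Th_m1_1_3: "Th (- 1) 1 3 = ee 2 * ee 3 / (ee 1 * ee 6)"
  using Th_double(1)[of 1 3 1] Th_1_1_3(1) Th_1_2_6(1) by (simp add: field_simps del: One_nat_def)

lemma Th_m1_2_6: "Th (- 1) 2 6 = ee 4 * ee 6 / (ee 2 * ee 12)"
  using Th_double(1)[of 2 6 1] Th_1_2_6(1) Th_1_4_12(1) by (simp add: field_simps)

lemma Wp_m1_2_6: "Wp (- 1) 2 6 = 4 * wl1 4 - 4 * wl1 12 - wl1 2 + wl1 6"
proof -
  have "Wp 1 4 12 = wl1 4 - wl1 12"
    by (rule Th_1_third[where b = 8]; presburger)
  hence "Wp 1 2 6 + Wp (- 1) 2 6 = 4 * (wl1 4 - wl1 12)" using Th_double(2)[of 2 6 1] by simp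
  thus ?thesis unfolding Th_1_2_6(2) by (simp add: algebra_simps)
qed

text \<open>In the applications N = 6 d, and a, -a are the classes of d times a number prime to 6;
  the other multiples of d are the even ones and the odd multiples of 3 d.\<close>

lemma Th_1_sixth:
  assumes "\<And>m. d dvd m \<longleftrightarrow> (m mod N = a \<or> m mod N = b) \<or> (2 * d dvd m \<or> m mod (2 * (3 * d)) = 3 * d)"
    and "\<And>m. \<not> ((m mod N = a \<or> m mod N = b) \<and> (2 * d dvd m \<or> m mod (2 * (3 * d)) = 3 * d))"
    and "\<And>m. \<not> (2 * d dvd m \<and> m mod (2 * (3 * d)) = 3 * d)"
    and "a + b = N" "0 < a" "0 < b" "a \<noteq> b" "0 < d"
  shows "Th 1 a N = ee d * ee (6 * d) / (ee (2 * d) * ee (3 * d))"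
    and "Wp 1 a N = wl1 d - wl1 (2 * d) - wl1 (3 * d) + wl1 (6 * d)"
proof -
  let ?R = "\<lambda>m::nat. m mod N = a \<or> m mod N = b" and ?T = "\<lambda>m::nat. 2 * d dvd m \<or> m mod (2 * (3 * d)) = 3 * d"
  have b: "(N - a) mod N = b" using assms by auto
  have d3: "0 < 3 * d" using assms by simp
  have "qprod (1::complex) (\<lambda>m. d dvd m) = qprod 1 ?R * qprod 1 ?T"
    by (rule qprod_union) (use assms(1,2) in blast)+
  also have "qprod (1::complex) ?R = qprod 1 (\<lambda>m. m mod N = a) * qprod 1 (\<lambda>m. m mod N = b)"
    by (rule qprod_union) (use assms(7) in auto)
  also have "qprod (1::complex) ?T = qprod 1 (\<lambda>m. 2 * d dvd m) * qprod 1 (\<lambda>m. m mod (2 * (3 * d)) = 3 * d)"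
    by (rule qprod_union) (use assms(3) in blast)+
  finally have "ee d = fps_to_fls (qprod 1 (\<lambda>m. m mod N = a) * qprod 1 (\<lambda>m. m mod N = b))
      * (ee (2 * d) * fps_to_fls (qprod 1 (\<lambda>m. m mod (2 * (3 * d)) = 3 * d)))"
    by (simp only: qe_def fls_times_fps_to_fls)
  also have "fps_to_fls (qprod 1 (\<lambda>m. m mod (2 * (3 * d)) = 3 * d)) = ee (3 * d) / ee (6 * d)"
    using qprod_half[OF d3, of 1] by simp
  finally show "Th 1 a N = ee d * ee (6 * d) / (ee (2 * d) * ee (3 * d))"
    using assms(5) by (simp add: Th_def qtheta_def b field_simps)
  have "lam1 (1::complex) (\<lambda>m. d dvd m) = lam1 1 ?R + lam1 1 ?T"
    by (rule lam1_union) (use assms(1,2) in blast)+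
  also have "lam1 (1::complex) ?R = lam1 1 (\<lambda>m. m mod N = a) + lam1 1 (\<lambda>m. m mod N = b)"
    by (rule lam1_union) (use assms(7) in auto)
  also have "lam1 (1::complex) ?T = lam1 1 (\<lambda>m. 2 * d dvd m) + lam1 1 (\<lambda>m. m mod (2 * (3 * d)) = 3 * d)"
    by (rule lam1_union) (use assms(3) in blast)+
  finally have "wl1 d = fps_to_fls (lam1 1 (\<lambda>m. m mod N = a) + lam1 1 (\<lambda>m. m mod N = b))
      + (wl1 (2 * d) + fps_to_fls (lam1 1 (\<lambda>m. m mod (2 * (3 * d)) = 3 * d)))"
    by (simp only: wl_def fps_to_fls_plus)
  also have "fps_to_fls (lam1 1 (\<lambda>m. m mod (2 * (3 * d)) = 3 * d)) = wl1 (3 * d) - wl1 (6 * d)"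
    using lam1_half[OF d3, of 1] by simp
  finally show "Wp 1 a N = wl1 d - wl1 (2 * d) - wl1 (3 * d) + wl1 (6 * d)"
    using assms(5) by (simp add: Wp_def wp_def b algebra_simps)
qed

lemma Th_1_1_6: "Th 1 1 6 = ee 1 * ee 6 / (ee 2 * ee 3)" "Wp 1 1 6 = wl1 1 - wl1 2 - wl1 3 + wl1 6"
proof -
  have c: "1 dvd m \<longleftrightarrow> (m mod 6 = 1 \<or> m mod 6 = 5) \<or> (2 * 1 dvd m \<or> m mod (2 * (3 * 1)) = 3 * 1)"
    "\<not> ((m mod 6 = 1 \<or> m mod 6 = 5) \<and> (2 * 1 dvd m \<or> m mod (2 * (3 * 1)) = 3 * 1))"
    "\<not> (2 * 1 dvd m \<and> m mod (2 * (3 * 1)) = 3 * 1)" for m :: nat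
    by presburger+
  show "Th 1 1 6 = ee 1 * ee 6 / (ee 2 * ee 3)" "Wp 1 1 6 = wl1 1 - wl1 2 - wl1 3 + wl1 6"
    using Th_1_sixth[of 1 6 1 5, OF c] by simp_all
qed

lemma Th_1_2_12: "Th 1 2 12 = ee 2 * ee 12 / (ee 4 * ee 6)"
proof -
  have c: "2 dvd m \<longleftrightarrow> (m mod 12 = 2 \<or> m mod 12 = 10) \<or> (2 * 2 dvd m \<or> m mod (2 * (3 * 2)) = 3 * 2)"
    "\<not> ((m mod 12 = 2 \<or> m mod 12 = 10) \<and> (2 * 2 dvd m \<or> m mod (2 * (3 * 2)) = 3 * 2))"
    "\<not> (2 * 2 dvd m \<and> m mod (2 * (3 * 2)) = 3 * 2)" for m :: nat
    by presburger+
  show ?thesis using Th_1_sixth(1)[of 2 12 2 10, OF c] by simp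
qed

lemma Th_m1_1_6: "Th (- 1) 1 6 = ee 2 ^ 2 * ee 3 * ee 12 / (ee 1 * ee 4 * ee 6 ^ 2)"
  using Th_double(1)[of 1 6 1] Th_1_1_6(1) Th_1_2_12
  by (simp add: field_simps power2_eq_square del: One_nat_def)

subsection \<open>Theta constants of level 12\<close>

definition phi1 :: "complex fls" where "phi1 = ee 2 ^ 5 / (ee 1 ^ 2 * ee 4 ^ 2)"
definition phi3 :: "complex fls" where "phi3 = ee 6 ^ 5 / (ee 3 ^ 2 * ee 12 ^ 2)"
text \<open>These weight 1 eta quotients are, up to constants, the linear forms X - Y, X + Y, 3 Y -
  X, X + 3 Y in X = phi1^2 and Y = phi3^2. Only g1 carries a power of q, because X - Y vanishes at q
  = 0.\<close>

definition g1 :: "complex fls" where "g1 = fls_X * ee 2 ^ 3 * ee 12 ^ 2 * ee 6 / (ee 1 * ee 3 * ee 4 ^ 2)"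
definition g2 :: "complex fls" where "g2 = ee 2 ^ 3 * ee 3 ^ 2 * ee 6 / (ee 1 ^ 2 * ee 4 * ee 12)"
definition g3 :: "complex fls" where "g3 = ee 1 ^ 2 * ee 2 * ee 6 ^ 3 / (ee 3 ^ 2 * ee 4 * ee 12)"
definition g4 :: "complex fls" where "g4 = ee 2 * ee 4 ^ 2 * ee 6 ^ 3 / (ee 1 * ee 3 * ee 12 ^ 2)"

lemmas eta_defs = phi1_def phi3_def g1_def g2_def g3_def g4_def

lemma level12_nonzero [simp]: "phi1 \<noteq> 0" "phi3 \<noteq> 0" "g1 \<noteq> 0" "g2 \<noteq> 0" "g3 \<noteq> 0" "g4 \<noteq> 0"
  by (simp_all add: eta_defs)

lemma Th_nonzero': "(a = 0 \<Longrightarrow> z \<noteq> 1) \<Longrightarrow> Th z a N \<noteq> 0"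
  by (simp add: Th_def qtheta_def)

section \<open>Differences of wp-values as eta quotients\<close>

text \<open>Constants c, k are kept apart from the eta quotients u, t. The first theta series is
  left as \<open>ee N * T\<close>, since its index a + b may equal N, where the triple product does
  not apply directly.\<close>

lemma Wp_diff_aux:
  assumes N: "1 \<le> N" "a < N" and ab: "b \<le> a" "a + b \<le> N" and nz: "z \<noteq> 0" "w \<noteq> 0"
    and z1: "a = 0 \<Longrightarrow> z \<noteq> 1" and w1: "b = 0 \<Longrightarrow> w \<noteq> 1"
    and ts: "fps_to_fls (theta_ser (z * w) (a + b) N) = ee N * T"
    and c: "Th z a N * Th w b N = fls_const c * u" and k: "T * Th (z / w) (a - b) N = fls_const k * t"
  shows "Wp w b N - Wp z a N = fls_const (w * k / c^2) * fls_X ^ b * ee N ^ 4 * t / u^2"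
proof -
  have b: "b < N" using N ab by simp
  have T0: "Th z a N \<noteq> 0" "Th w b N \<noteq> 0" using z1 w1 by (auto intro!: Th_nonzero')
  hence cu: "c \<noteq> 0" "u \<noteq> 0" using c by auto
  have "theta_ser (z / w) (a - b) N = qprod 1 (\<lambda>m. N dvd m) * qtheta (z / w) (a - b) N"
    using N nz by (intro jacobi_triple_product) auto
  hence ts2: "fps_to_fls (theta_ser (z / w) (a - b) N) = ee N * Th (z / w) (a - b) N"
    by (simp add: qe_def Th_def fls_times_fps_to_fls)
  have "(Wp w b N - Wp z a N) * (Th z a N)^2 * (Th w b N)^2
     = fls_const w * fls_X ^ b * ee N ^ 2 * ((ee N * T) * (ee N * Th (z / w) (a - b) N))"
    using arg_cong[OF wp_relations(1)[OF N ab nz z1 w1], of fps_to_fls]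
    unfolding ts[symmetric] ts2[symmetric]
    by (simp add: Wp_def Th_def qe_def fls_times_fps_to_fls fps_to_fls_power)
  also have "\<dots> = fls_const w * fls_X ^ b * ee N ^ 4 * (T * Th (z / w) (a - b) N)"
    by (simp add: power2_eq_square power4_eq_xxxx mult_ac)
  also have "\<dots> = fls_const (w * k) * fls_X ^ b * ee N ^ 4 * t"
    unfolding k by (simp add: fls_const_mult_const[symmetric] mult_ac del: fls_const_mult_const)
  also have "(Wp w b N - Wp z a N) * (Th z a N)^2 * (Th w b N)^2
     = (Wp w b N - Wp z a N) * (Th z a N * Th w b N)^2" by (simp add: power_mult_distrib mult_ac)
  also have "\<dots> = (Wp w b N - Wp z a N) * (fls_const c)^2 * u^2"
    unfolding c by (simp add: power_mult_distrib mult_ac)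
  finally have "Wp w b N - Wp z a N = fls_const (w * k) * fls_X ^ b * ee N ^ 4 * t / ((fls_const c)^2 * u^2)"
    using cu by (simp add: field_simps)
  moreover have "fls_const (w * k / c^2) = fls_const (w * k) / (fls_const c)^2"
    by (simp add: fls_const_divide_const flip: fls_const_power)
  ultimately show ?thesis by simp
qed

lemma Wp_diff:
  assumes N: "1 \<le> N" and ab: "b \<le> a" "a + b < N" and nz: "z \<noteq> 0" "w \<noteq> 0"
    and z1: "a = 0 \<Longrightarrow> z \<noteq> 1" and w1: "b = 0 \<Longrightarrow> w \<noteq> 1"
    and c: "Th z a N * Th w b N = fls_const c * u"
    and k: "Th (z * w) (a + b) N * Th (z / w) (a - b) N = fls_const k * t"
  shows "Wp w b N - Wp z a N = fls_const (w * k / c^2) * fls_X ^ b * ee N ^ 4 * t / u^2"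
proof (rule Wp_diff_aux[OF N _ ab(1) _ nz z1 w1 _ c k])
  have "theta_ser (z * w) (a + b) N = qprod 1 (\<lambda>m. N dvd m) * qtheta (z * w) (a + b) N"
    using N ab nz by (intro jacobi_triple_product) auto
  thus "fps_to_fls (theta_ser (z * w) (a + b) N) = ee N * Th (z * w) (a + b) N"
    by (simp add: qe_def Th_def fls_times_fps_to_fls)
qed (use ab in auto)

lemma Wp_diff_top:
  assumes N: "1 \<le> N" and ab: "b \<le> a" "a + b = N" "0 < b" and nz: "z \<noteq> 0" "w \<noteq> 0"
    and c: "Th z a N * Th w b N = fls_const c * u"
    and k: "Th (1 / (z * w)) 0 N * Th (z / w) (a - b) N = fls_const k * t"
  shows "Wp w b N - Wp z a N = fls_const (w * k / c^2) * fls_X ^ b * ee N ^ 4 * t / u^2"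
proof (rule Wp_diff_aux[OF N _ ab(1) _ nz _ _ _ c k])
  have "theta_ser (z * w) (a + b) N = theta_ser (1 / (z * w)) 0 N"
    using theta_ser_reflect[of 0 N "z * w"] ab by simp
  also have "\<dots> = qprod 1 (\<lambda>m. N dvd m) * qtheta (1 / (z * w)) 0 N"
    using N nz by (intro jacobi_triple_product) auto
  finally show "fps_to_fls (theta_ser (z * w) (a + b) N) = ee N * Th (1 / (z * w)) 0 N"
    by (simp add: qe_def Th_def fls_times_fps_to_fls)
qed (use ab in auto)

lemma fc_mult: "fls_const a * x * (fls_const b * y) = fls_const (a * b) * (x * y)"
  for a b :: complex
  by (simp add: fls_const_mult_const[symmetric] mult_ac del: fls_const_mult_const)

lemma om_consts:
  "om / om^2 = om^2" "(1 + om)^2 = om" "(1 + om^2)^2 = om^2" "(1 - om)^2 = - 3 * om" "(1 - om^2)^2 = - 3 * om^2"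
  "(1 - om) * (1 - om^2) = 3" "om^2 / om = om" "om * om^2 = 1" "1 / om^2 = om" "1 / om = om^2"
proof -
  show "1 / om^2 = om" "1 / om = om^2" by (fact inverse_om_sq, fact inverse_om)
  show "om * om^2 = 1" by (fact om_mult_om_sq)
  show "om^2 / om = om" by (simp add: power2_eq_square del: om_mult)
  show "om / om^2 = om^2" using inverse_om by (simp add: power2_eq_square del: om_mult)
  show "(1 + om)^2 = om" "(1 - om)^2 = - 3 * om" by (simp_all add: power2_eq_square algebra_simps)
  show "(1 + om^2)^2 = om^2" "(1 - om^2)^2 = - 3 * om^2" "(1 - om) * (1 - om^2) = 3"
    unfolding om_sq by (simp_all add: power2_eq_square algebra_simps)
qed

lemma minus_om_neq [simp]: "- om \<noteq> 1" "- (om^2) \<noteq> 1"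
  using om_neq by (metis minus_minus)+

lemma fls_const_numeral_divide: "fls_const (numeral a / numeral b) = (numeral a / numeral b :: complex fls)"
  "fls_const (- (1 / numeral b)) = (- 1 / numeral b :: complex fls)" "fls_const (1 / numeral b) = (1 / numeral b :: complex fls)"
  by (simp_all flip: fls_const_divide_const)

lemma torsion_2:
  "Th 1 1 2 = (ee 1 / ee 2)^2" "Th (- 1) 1 2 = (ee 2 ^ 2 / (ee 1 * ee 4))^2"
  "Th (- 1) 0 2 = fls_const 2 * (ee 4 / ee 2)^2" "Th (om^2) 0 2 = fls_const (1 - om^2) * (ee 6 / ee 2)"
  "Th om 0 2 = fls_const (1 - om) * (ee 6 / ee 2)"
  "Th (- (om^2)) 0 2 = fls_const (1 + om^2) * (ee 12 * ee 2 / (ee 4 * ee 6))"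
  "Th om 1 2 = ee 3 * ee 2 / (ee 1 * ee 6)"
  "Th (- om) 1 2 = ee 6 ^ 2 * ee 1 * ee 4 / (ee 2 ^ 2 * ee 3 * ee 12)"
  "Th (- (om^2)) 1 2 = ee 6 ^ 2 * ee 1 * ee 4 / (ee 2 ^ 2 * ee 3 * ee 12)"
  using Th_1_half[of 1] Th_m1_half[of 1] Th_m1_0[of 2] Th_om2_0[of 2] Th_om_0[of 2] Th_mom2_0[of 2]
    Th_om_half[of 1] Th_mom_half[of 1] Th_mom2_half[of 1] by simp_all

text \<open>Differences of \<open>\<wp>\<close>-values at torsion points of the curves with parameter \<open>q^2\<close>, \<open>q^6\<close>,
  \<open>q\<close> and \<open>q^3\<close>.\<close>

lemma weight2_a: "Wp (- 1) 0 2 - Wp 1 1 2 = - (1/4) * phi1 ^ 4"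
proof -
  have "Wp (- 1) 0 2 - Wp 1 1 2 = fls_const ((- 1) * 1 / 2^2) * fls_X ^ 0 * ee 2 ^ 4
      * ((ee 2 ^ 2 / (ee 1 * ee 4))^2 * (ee 2 ^ 2 / (ee 1 * ee 4))^2) / ((ee 1 / ee 2)^2 * (ee 4 / ee 2)^2)^2"
    by (rule Wp_diff) (simp_all add: torsion_2 mult_ac del: One_nat_def)
  thus ?thesis by (rule trans) (simp add: phi1_def fls_const_numeral_divide divide_simps; algebra?)
qed

lemma weight2_b: "Wp (- 1) 0 2 - Wp (- (om^2)) 0 2 = 3 / 4 * (g2 * g3)"
proof -
  have "Wp (- 1) 0 2 - Wp (- (om^2)) 0 2 = fls_const ((- 1) * (1 - om^2)^2 / ((1 + om^2) * 2)^2) * fls_X ^ 0 * ee 2 ^ 4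
      * ((ee 6 / ee 2) * (ee 6 / ee 2)) / ((ee 12 * ee 2 / (ee 4 * ee 6)) * (ee 4 / ee 2)^2)^2"
  proof (rule Wp_diff)
    show "Th (- (om^2)) 0 2 * Th (- 1) 0 2
        = fls_const ((1 + om^2) * 2) * ((ee 12 * ee 2 / (ee 4 * ee 6)) * (ee 4 / ee 2)^2)"
      unfolding torsion_2 fc_mult ..
    show "Th (- (om^2) * - 1) (0 + 0) 2 * Th (- (om^2) / - 1) (0 - 0) 2
        = fls_const ((1 - om^2)^2) * ((ee 6 / ee 2) * (ee 6 / ee 2))"
      by (simp add: torsion_2(4) fc_mult power2_eq_square[of "1 - om^2"])
  qed auto
  also have "(- 1) * (1 - om^2)^2 / ((1 + om^2) * 2)^2 = 3 / 4"
    unfolding power_mult_distrib om_consts by simp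
  finally show ?thesis by (rule trans) (simp add: g2_def g3_def fls_const_numeral_divide divide_simps; algebra?)
qed

lemma weight2_c: "Wp (- (om^2)) 0 2 - Wp 1 1 2 = - (g4 ^ 2)"
proof -
  have "Wp (- (om^2)) 0 2 - Wp 1 1 2 = fls_const (- (om^2) * 1 / (1 + om^2)^2) * fls_X ^ 0 * ee 2 ^ 4
      * ((ee 6 ^ 2 * ee 1 * ee 4 / (ee 2 ^ 2 * ee 3 * ee 12)) * (ee 6 ^ 2 * ee 1 * ee 4 / (ee 2 ^ 2 * ee 3 * ee 12)))
      / ((ee 1 / ee 2)^2 * (ee 12 * ee 2 / (ee 4 * ee 6)))^2"
  proof (rule Wp_diff)
    show "Th 1 1 2 * Th (- (om^2)) 0 2 = fls_const (1 + om^2) * ((ee 1 / ee 2)^2 * (ee 12 * ee 2 / (ee 4 * ee 6)))"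
      unfolding torsion_2 by (simp only: mult_ac)
    have "1 / (- (om^2)) = - om" using om_consts by simp
    thus "Th (1 * - (om^2)) (1 + 0) 2 * Th (1 / - (om^2)) (1 - 0) 2
        = fls_const 1 * ((ee 6 ^ 2 * ee 1 * ee 4 / (ee 2 ^ 2 * ee 3 * ee 12)) * (ee 6 ^ 2 * ee 1 * ee 4 / (ee 2 ^ 2 * ee 3 * ee 12)))"
      by (simp add: torsion_2 del: One_nat_def)
  qed auto
  also have "- (om^2) * 1 / (1 + om^2)^2 = - 1"
    unfolding om_consts by simp
  finally show ?thesis by (rule trans) (simp add: g4_def divide_simps; algebra?)
qed

lemma weight2_d: "Wp (- (om^2)) 0 2 - Wp om 1 2 = - (g3 * g4)"
proof -
  have "Wp (- (om^2)) 0 2 - Wp om 1 2 = fls_const (- (om^2) * 1 / (1 + om^2)^2) * fls_X ^ 0 * ee 2 ^ 4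
      * ((ee 2 ^ 2 / (ee 1 * ee 4))^2 * (ee 6 ^ 2 * ee 1 * ee 4 / (ee 2 ^ 2 * ee 3 * ee 12)))
      / (ee 3 * ee 2 / (ee 1 * ee 6) * (ee 12 * ee 2 / (ee 4 * ee 6)))^2"
  proof (rule Wp_diff)
    show "Th om 1 2 * Th (- (om^2)) 0 2 = fls_const (1 + om^2) * (ee 3 * ee 2 / (ee 1 * ee 6) * (ee 12 * ee 2 / (ee 4 * ee 6)))"
      unfolding torsion_2 by (simp only: mult_ac)
    have "om / (- (om^2)) = - (om^2)" "om * - (om^2) = - 1" using om_consts by simp_all
    thus "Th (om * - (om^2)) (1 + 0) 2 * Th (om / - (om^2)) (1 - 0) 2
        = fls_const 1 * ((ee 2 ^ 2 / (ee 1 * ee 4))^2 * (ee 6 ^ 2 * ee 1 * ee 4 / (ee 2 ^ 2 * ee 3 * ee 12)))"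
      by (simp add: torsion_2 del: One_nat_def)
  qed auto
  also have "- (om^2) * 1 / (1 + om^2)^2 = - 1"
    unfolding om_consts by simp
  finally show ?thesis by (rule trans) (simp add: g3_def g4_def divide_simps; algebra?)
qed

lemma weight2_e: "Wp (- 1) 0 2 - Wp om 1 2 = - (1 / 4) * g3 ^ 2"
proof -
  have "Wp (- 1) 0 2 - Wp om 1 2 = fls_const (- 1 * 1 / 2^2) * fls_X ^ 0 * ee 2 ^ 4
      * ((ee 6 ^ 2 * ee 1 * ee 4 / (ee 2 ^ 2 * ee 3 * ee 12)) * (ee 6 ^ 2 * ee 1 * ee 4 / (ee 2 ^ 2 * ee 3 * ee 12)))
      / (ee 3 * ee 2 / (ee 1 * ee 6) * (ee 4 / ee 2)^2)^2"
  proof (rule Wp_diff)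
    show "Th om 1 2 * Th (- 1) 0 2 = fls_const 2 * (ee 3 * ee 2 / (ee 1 * ee 6) * (ee 4 / ee 2)^2)"
      unfolding torsion_2 by (simp only: mult_ac)
    show "Th (om * - 1) (1 + 0) 2 * Th (om / - 1) (1 - 0) 2
        = fls_const 1 * ((ee 6 ^ 2 * ee 1 * ee 4 / (ee 2 ^ 2 * ee 3 * ee 12)) * (ee 6 ^ 2 * ee 1 * ee 4 / (ee 2 ^ 2 * ee 3 * ee 12)))"
      by (simp add: torsion_2 del: One_nat_def)
  qed auto
  thus ?thesis by (rule trans) (simp add: g3_def fls_const_numeral_divide divide_simps; algebra?)
qed

lemma weight2_f: "Wp 1 1 2 - Wp om 1 2 = 3 * (g1 * g4)"
proof -
  have "Wp 1 1 2 - Wp om 1 2 = fls_const (1 * 3 / 1^2) * fls_X ^ 1 * ee 2 ^ 4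
      * ((ee 6 / ee 2) * (ee 6 / ee 2)) / (ee 3 * ee 2 / (ee 1 * ee 6) * (ee 1 / ee 2)^2)^2"
  proof (rule Wp_diff_top)
    show "Th om 1 2 * Th 1 1 2 = fls_const 1 * (ee 3 * ee 2 / (ee 1 * ee 6) * (ee 1 / ee 2)^2)"
      unfolding torsion_2 by simp
    \<comment> \<open>Here a + b = N: reflection replaces om q^2 by 1/om = om^2, and (1 - om)(1 -
      om^2) = 3 is the constant.\<close>
    have "Th (1 / (om * 1)) 0 2 * Th (om / 1) (1 - 1) 2 = Th om 0 2 * Th (om^2) 0 2"
      using om_consts(10) by (simp add: mult_ac)
    also have "\<dots> = fls_const 3 * ((ee 6 / ee 2) * (ee 6 / ee 2))"
      unfolding torsion_2 fc_mult om_consts ..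
    finally show "Th (1 / (om * 1)) 0 2 * Th (om / 1) (1 - 1) 2 = fls_const 3 * ((ee 6 / ee 2) * (ee 6 / ee 2))" .
  qed auto
  thus ?thesis by (rule trans) (simp add: g1_def g4_def divide_simps; algebra?)
qed

lemma weight2_g: "Wp (- 1) 0 6 - Wp 1 3 6 = - (1/4) * phi3 ^ 4"
proof -
  have T: "Th 1 3 6 = (ee 3 / ee 6)^2" "Th (- 1) 3 6 = (ee 6 ^ 2 / (ee 3 * ee 12))^2"
    "Th (- 1) 0 6 = fls_const 2 * (ee 12 / ee 6)^2"
    using Th_1_half[of 3] Th_m1_half[of 3] Th_m1_0[of 6] by simp_all
  have "Wp (- 1) 0 6 - Wp 1 3 6 = fls_const ((- 1) * 1 / 2^2) * fls_X ^ 0 * ee 6 ^ 4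
      * ((ee 6 ^ 2 / (ee 3 * ee 12))^2 * (ee 6 ^ 2 / (ee 3 * ee 12))^2) / ((ee 3 / ee 6)^2 * (ee 12 / ee 6)^2)^2"
    by (rule Wp_diff) (simp_all add: T mult_ac)
  thus ?thesis by (rule trans) (simp add: phi3_def fls_const_numeral_divide divide_simps; algebra?)
qed

lemma weight2_h: "Wp (- 1) 2 6 - Wp 1 3 6 = - (g1 ^ 2)"
proof -
  have T: "Th 1 3 6 = (ee 3 / ee 6)^2" "Th (- 1) 5 6 = Th (- 1) 1 6"
    using Th_1_half[of 3] Th_reflect[of 1 6 "-1"] by simp_all
  note T5 = trans[OF T(2) Th_m1_1_6]
  have "Wp (- 1) 2 6 - Wp 1 3 6 = fls_const ((- 1) * 1 / 1^2) * fls_X ^ 2 * ee 6 ^ 4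
      * ((ee 2 ^ 2 * ee 3 * ee 12 / (ee 1 * ee 4 * ee 6 ^ 2)) * (ee 2 ^ 2 * ee 3 * ee 12 / (ee 1 * ee 4 * ee 6 ^ 2)))
      / ((ee 3 / ee 6)^2 * (ee 4 * ee 6 / (ee 2 * ee 12)))^2"
  proof (rule Wp_diff)
    show "Th (1 * - 1) (3 + 2) 6 * Th (1 / - 1) (3 - 2) 6 = fls_const 1
      * ((ee 2 ^ 2 * ee 3 * ee 12 / (ee 1 * ee 4 * ee 6 ^ 2)) * (ee 2 ^ 2 * ee 3 * ee 12 / (ee 1 * ee 4 * ee 6 ^ 2)))"
      by (simp add: T5 Th_m1_1_6[unfolded One_nat_def])
  qed (simp_all add: T Th_m1_2_6)
  thus ?thesis by (rule trans) (simp add: g1_def divide_simps; algebra?)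
qed

text \<open>The nomes q and q^3 bring in the denominator X Y. Together with three relations for nome
  q^2 they determine the weight 2 factors of the Eisenstein series.\<close>

lemma weight2_i: "Wp (- 1) 0 1 - Wp om 0 1 = 1 / 12 * (g3 ^ 4 / (phi1 ^ 2 * phi3 ^ 2))"
proof -
  have T: "Th (- 1) 0 1 = fls_const 2 * (ee 2 / ee 1)^2" "Th om 0 1 = fls_const (1 - om) * (ee 3 / ee 1)"
    "Th (- om) 0 1 = fls_const (1 + om) * (ee 6 * ee 1 / (ee 2 * ee 3))"
    using Th_m1_0[of 1] Th_om_0[of 1] Th_mom_0[of 1] by simp_all
  have "Wp (- 1) 0 1 - Wp om 0 1 = fls_const ((- 1) * (1 + om)^2 / ((1 - om) * 2)^2) * fls_X ^ 0 * ee 1 ^ 4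
      * ((ee 6 * ee 1 / (ee 2 * ee 3)) * (ee 6 * ee 1 / (ee 2 * ee 3))) / ((ee 3 / ee 1) * (ee 2 / ee 1)^2)^2"
  proof (rule Wp_diff)
    show "Th om 0 1 * Th (- 1) 0 1 = fls_const ((1 - om) * 2) * ((ee 3 / ee 1) * (ee 2 / ee 1)^2)"
      unfolding T fc_mult ..
    show "Th (om * - 1) (0 + 0) 1 * Th (om / - 1) (0 - 0) 1
       = fls_const ((1 + om)^2) * ((ee 6 * ee 1 / (ee 2 * ee 3)) * (ee 6 * ee 1 / (ee 2 * ee 3)))"
      by (simp add: T(3) fc_mult power2_eq_square[of "1 + om"] del: One_nat_def)
  qed auto
  also have "(- 1) * (1 + om)^2 / ((1 - om) * 2)^2 = 1 / 12"
    unfolding power_mult_distrib om_consts by simp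
  finally show ?thesis by (rule trans) (simp add: g3_def phi1_def phi3_def fls_const_numeral_divide divide_simps; algebra?)
qed

lemma weight2_j: "Wp (- 1) 0 3 - Wp 1 1 3 = - (1 / 4) * (g2 ^ 4 / (phi1 ^ 2 * phi3 ^ 2))"
proof -
  have T: "Th (- 1) 0 3 = fls_const 2 * (ee 6 / ee 3)^2"
    using Th_m1_0[of 3] by simp_all
  have "Wp (- 1) 0 3 - Wp 1 1 3 = fls_const ((- 1) * 1 / 2^2) * fls_X ^ 0 * ee 3 ^ 4
      * ((ee 2 * ee 3 / (ee 1 * ee 6)) * (ee 2 * ee 3 / (ee 1 * ee 6))) / (ee 1 / ee 3 * (ee 6 / ee 3)^2)^2"
    by (rule Wp_diff) (simp_all add: T Th_1_1_3 Th_m1_1_3 mult_ac del: One_nat_def)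
  thus ?thesis by (rule trans) (simp add: g2_def phi1_def phi3_def fls_const_numeral_divide divide_simps; algebra?)
qed

text \<open>Used to fix the signs of square roots.\<close>

definition unit1 :: "complex fls \<Rightarrow> bool" where
  "unit1 F \<longleftrightarrow> (\<exists>f. F = fps_to_fls f \<and> f $ 0 = 1)"

lemma unit1_ee [simp]: "unit1 (ee d)"
  unfolding unit1_def qe_def by (rule exI[of _ "qprod 1 (\<lambda>m. d dvd m)"]) simp

lemma unit1_mult: "unit1 F \<Longrightarrow> unit1 G \<Longrightarrow> unit1 (F * G)"
  unfolding unit1_def by (metis fls_times_fps_to_fls fps_mult_nth_0 mult_1)

lemma unit1_power: "unit1 F \<Longrightarrow> unit1 (F ^ n)"
proof (induction n)
  case 0
  show ?case unfolding unit1_def by (rule exI[of _ 1]) simp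
qed (simp add: unit1_mult)

lemma unit1_divide: "unit1 F \<Longrightarrow> unit1 G \<Longrightarrow> unit1 (F / G)"
proof -
  assume F: "unit1 F" and G: "unit1 G"
  from G obtain g where g: "G = fps_to_fls g" "g $ 0 = 1" by (auto simp: unit1_def)
  hence "subdegree g = 0" by (simp add: subdegree_eq_0_iff)
  hence "inverse G = fps_to_fls (inverse g)" using g by (simp add: fls_inverse_fps_to_fls)
  hence "unit1 (inverse G)" using g(2) by (auto simp: unit1_def)
  thus ?thesis using unit1_mult[OF F] by (simp add: divide_inverse)
qed

lemma unit1_level12: "unit1 phi1" "unit1 phi3" "unit1 g2" "unit1 g3"
  unfolding phi1_def phi3_def g2_def g3_def
  by (intro unit1_divide unit1_mult unit1_power unit1_ee)+

lemma unit1_comb_nonzero: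
  assumes "unit1 F" "unit1 G" "unit1 H" "a + b + c \<noteq> 0"
  shows "fls_const a * F + fls_const b * G + fls_const c * H \<noteq> 0"
proof
  assume *: "fls_const a * F + fls_const b * G + fls_const c * H = 0"
  from assms obtain f g h where "F = fps_to_fls f" "G = fps_to_fls g" "H = fps_to_fls h"
    and 0: "f $ 0 = 1" "g $ 0 = 1" "h $ 0 = 1" by (auto simp: unit1_def)
  hence "fps_to_fls (fps_const a * f + fps_const b * g + fps_const c * h) = 0"
    unfolding fps_to_fls_plus fls_times_fps_to_fls fps_const_to_fls using * by simp
  hence "fps_const a * f + fps_const b * g + fps_const c * h = 0" by (rule iffD1[OF fps_to_fls_eq_0_iff])
  hence "(fps_const a * f + fps_const b * g + fps_const c * h) $ 0 = 0 $ 0" by (rule arg_cong)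
  thus False using assms(4) by (simp add: 0)
qed

text \<open>wp-differences along the sides of a triangle of torsion points add up, and every side is
  a known product. The resulting quadratic equations become linear after cancelling a factor or
  extracting a square root.\<close>

theorem level12_relations:
  "phi1 ^ 2 - phi3 ^ 2 = 4 * g1" "phi1 ^ 2 + phi3 ^ 2 = 2 * g2"
  "3 * phi3 ^ 2 - phi1 ^ 2 = 2 * g3" "phi1 ^ 2 + 3 * phi3 ^ 2 = 4 * g4"
proof -
  have g4: "4 * g4 = 3 * g2 + g3"
  proof -
    \<comment> \<open>Triangle -1, -om^2, om q; every side contains g3.\<close>
    have "3 / 4 * (g2 * g3) + - (g3 * g4) = - (1 / 4) * g3 ^ 2"
      unfolding weight2_b[symmetric] weight2_d[symmetric] weight2_e[symmetric] by simp
    hence "g3 * (4 * g4 - (3 * g2 + g3)) = 0" by (simp add: field_simps power2_eq_square)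
    thus ?thesis by simp
  qed
  \<comment> \<open>Triangle -1, -om^2, q. It yields (2 X)^2 = (3 g2 - g3)^2, and the constant
    coefficient 2 + 3 - 1 excludes 2 X = g3 - 3 g2.\<close>
  have "- (1/4) * phi1 ^ 4 = 3 / 4 * (g2 * g3) + - (g4 ^ 2)"
    unfolding weight2_a[symmetric] weight2_b[symmetric] weight2_c[symmetric] by simp
  hence "4 * g4 ^ 2 = phi1 ^ 4 + 3 * (g2 * g3)" by (simp add: field_simps)
  hence "4 * phi1 ^ 4 = (4 * g4) ^ 2 - 12 * (g2 * g3)" by algebra
  hence "(2 * phi1 ^ 2 - 3 * g2 + g3) * (2 * phi1 ^ 2 + 3 * g2 - g3) = 0"
    unfolding g4 by (simp add: algebra_simps power2_eq_square power4_eq_xxxx)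
  moreover have "2 * phi1 ^ 2 + 3 * g2 - g3 \<noteq> 0"
    using unit1_comb_nonzero[OF unit1_power[OF unit1_level12(1), of 2] unit1_level12(3,4), of 2 3 "-1"] by simp
  ultimately have "2 * phi1 ^ 2 - 3 * g2 + g3 = 0" by simp
  hence X: "2 * phi1 ^ 2 = 3 * g2 - g3" by algebra
  \<comment> \<open>Triangle -1, q, om q. One side becomes 3 (g2 - g3) (3 g2 + g3), so the factor 3
    g2 + g3 = 4 g4 cancels.\<close>
  have "- (1/4) * phi1 ^ 4 + 3 * (g1 * g4) = - (1 / 4) * g3 ^ 2"
    unfolding weight2_a[symmetric] weight2_e[symmetric] weight2_f[symmetric] by simp
  hence "phi1 ^ 4 = g3 ^ 2 + 12 * (g1 * g4)" by (simp add: field_simps)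
  hence "12 * g1 * (4 * g4) = (2 * phi1 ^ 2)^2 - 4 * g3 ^ 2" by algebra
  hence "12 * g1 * (3 * g2 + g3) = (3 * g2 - g3)^2 - 4 * g3 ^ 2" unfolding g4 X .
  hence "3 * ((3 * g2 + g3) * (4 * g1 - (g2 - g3))) = 0" by algebra
  hence "(3 * g2 + g3) * (4 * g1 - (g2 - g3)) = 0" by simp
  hence g1: "4 * g1 = g2 - g3" using g4 by (metis eq_iff_diff_eq_0 level12_nonzero(6) mult_eq_0_iff zero_neq_numeral)
  \<comment> \<open>The link between the nomes q^6 and q^2: both sides have the same Lambert
    expansion. It leads to (2 Y)^2 = (g2 + g3)^2.\<close>
  have "Wp (- 1) 0 6 - Wp (- 1) 2 6 = - (1/3) * (Wp (- 1) 0 2 - Wp (- (om^2)) 0 2)"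
  proof -
    have W: "Wp (- 1) 0 6 = - 1 / 4 + 8 * wl1 12 - 2 * wl1 6" "Wp (- 1) 0 2 = - 1 / 4 + 8 * wl1 4 - 2 * wl1 2"
      "Wp (- (om^2)) 0 2 = - 1 + 36 * wl1 12 - 4 * wl1 4 - 9 * wl1 6 + wl1 2"
      using Wp_m1_0[of 6] Wp_m1_0[of 2] Wp_mom2_0[of 2] by (simp_all add: fls_const_numeral_divide)
    show ?thesis unfolding W Wp_m1_2_6 by (simp add: field_simps)
  qed
  hence "- (1/4) * phi3 ^ 4 - - (g1 ^ 2) = - (1/3) * (3 / 4 * (g2 * g3))"
    unfolding weight2_g[symmetric] weight2_h[symmetric] weight2_b[symmetric] by simp
  hence "phi3 ^ 4 = 4 * g1 ^ 2 + g2 * g3" by (simp add: field_simps)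
  hence "4 * phi3 ^ 4 = (4 * g1)^2 + 4 * (g2 * g3)" by algebra
  hence "(2 * phi3 ^ 2 - g2 - g3) * (2 * phi3 ^ 2 + g2 + g3) = 0"
    unfolding g1 by (simp add: algebra_simps power2_eq_square power4_eq_xxxx)
  moreover have "2 * phi3 ^ 2 + g2 + g3 \<noteq> 0"
    using unit1_comb_nonzero[OF unit1_power[OF unit1_level12(2), of 2] unit1_level12(3,4), of 2 1 1] by simp
  ultimately have "2 * phi3 ^ 2 - g2 - g3 = 0" by simp
  hence Y: "2 * phi3 ^ 2 = g2 + g3" by algebra
  have 2: "2 * x = 2 * y \<Longrightarrow> x = y" for x y :: "complex fls" by simp
  have "2 * (phi1 ^ 2 - phi3 ^ 2) = 2 * (4 * g1)" "2 * (phi1 ^ 2 + phi3 ^ 2) = 2 * (2 * g2)"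
    "2 * (3 * phi3 ^ 2 - phi1 ^ 2) = 2 * (2 * g3)" "2 * (phi1 ^ 2 + 3 * phi3 ^ 2) = 2 * (4 * g4)"
    using X Y g1 g4 by algebra+
  thus "phi1 ^ 2 - phi3 ^ 2 = 4 * g1" "phi1 ^ 2 + phi3 ^ 2 = 2 * g2"
    "3 * phi3 ^ 2 - phi1 ^ 2 = 2 * g3" "phi1 ^ 2 + 3 * phi3 ^ 2 = 4 * g4"
    by (blast intro: 2)+
qed

subsection \<open>Eisenstein series of weight 4\<close>

definition eis :: "(nat \<Rightarrow> int) \<Rightarrow> (nat \<Rightarrow> int) \<Rightarrow> int \<Rightarrow> complex fps" where
  "eis chi psi c0 = Abs_fps (\<lambda>n. of_rat (E4coeff chi psi c0 n))"

text \<open>Summation over the codivisor m = n/d brings the coefficient into the shape of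
  \<open>lamb\<close>.\<close>

lemma eis_nth_pos:
  assumes "n > 0"
  shows "eis chi psi c0 $ n
    = (\<Sum>m | m \<in> {1..n} \<and> m dvd n. of_int (chi m) * (of_int (psi (n div m)) * of_nat (n div m) ^ 3))"
proof -
  have "eis chi psi c0 $ n = (\<Sum>d\<in>{d. d dvd n}. of_int (psi d) * of_int (chi (n div d)) * of_nat d ^ 3)"
  proof -
    have "E4coeff chi psi c0 n = of_int (\<Sum>d\<in>{d. d dvd n}. psi d * chi (n div d) * int d ^ 3)"
      unfolding E4coeff_def by (rule if_not_P) (use assms in simp)
    thus ?thesis by (simp only: eis_def fps_nth_Abs_fps of_rat_of_int_eq) simp
  qed
  also have "\<dots> = (\<Sum>m | m \<in> {1..n} \<and> m dvd n. of_int (chi m) * (of_int (psi (n div m)) * of_nat (n div m) ^ 3))"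
  proof (rule sum.reindex_bij_witness[of _ "\<lambda>m. n div m" "\<lambda>d. n div d"], goal_cases)
    case (1 d)
    thus ?case using assms by auto
  next
    case (2 d)
    hence "n div d dvd n" by auto
    moreover have "n div d > 0" using 2 assms by (auto simp: div_greater_zero_iff dest: dvd_imp_le)
    ultimately show ?case by (auto simp: Suc_le_eq)
  next
    case (3 m)
    thus ?case using assms by auto
  next
    case (4 m)
    thus ?case by auto
  next
    case (5 d)
    thus ?case using assms by (auto simp: mult_ac)
  qed
  finally show ?thesis .
qed

section \<open>Eisenstein series as differences of wp''-values\<close>

text \<open>A pair (m, d) contributes to q^(m d) in \<open>wp2\<close> the product of d^3 and a
  function of m mod N and d. At suitable torsion points the difference of two such functions is
  chi(m) psi(d) up to a constant.\<close>

lemma wp2_diff_eis: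
  fixes z w :: complex
  assumes coeff: "\<And>m d. (if m mod N = b then w ^ d else 0) + (if m mod N = (N - b) mod N then (1 / w) ^ d else 0)
         - ((if m mod N = a then z ^ d else 0) + (if m mod N = (N - a) mod N then (1 / z) ^ d else 0))
         = c * (of_int (chi m) * of_int (psi d))"
    and const: "wp2 w b N $ 0 - wp2 z a N $ 0 = c * of_int c0"
  shows "wp2 w b N - wp2 z a N = fps_const c * eis chi psi c0"
proof (rule fps_ext)
  fix n
  show "(wp2 w b N - wp2 z a N) $ n = (fps_const c * eis chi psi c0) $ n"
  proof (cases "n = 0")
    case True
    thus ?thesis using const by (simp add: eis_def E4coeff_def)
  next
    case False
    let ?M = "{m. m \<in> {1..n} \<and> m dvd n}"
    have fin: "finite ?M" by simp
    have lam: "lam3 x (\<lambda>m. m mod N = r) $ n = (\<Sum>m\<in>?M. of_nat (n div m) ^ 3 * (if m mod N = r then x ^ (n div m) else 0))"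
      for x :: complex and r
    proof -
      have "lam3 x (\<lambda>m. m mod N = r) $ n = (\<Sum>m | m \<in> ?M \<and> m mod N = r. of_nat (n div m) ^ 3 * x ^ (n div m))"
        by (simp add: lam3_def lamb_def conj_assoc)
      also have "\<dots> = (\<Sum>m\<in>?M. if m mod N = r then of_nat (n div m) ^ 3 * x ^ (n div m) else 0)"
        by (rule sum.inter_filter[OF fin])
      finally show ?thesis by (simp add: if_distrib cong: if_cong)
    qed
    have wp: "wp2 x r N $ n = (\<Sum>m\<in>?M. of_nat (n div m) ^ 3 * ((if m mod N = r then x ^ (n div m) else 0)
        + (if m mod N = (N - r) mod N then (1 / x) ^ (n div m) else 0)))" for x :: complex and r
      using False unfolding wp2_def fps_add_nth lam distrib_left sum.distrib by simp
    have "(wp2 w b N - wp2 z a N) $ n = (\<Sum>m\<in>?M. of_nat (n div m) ^ 3 * (c * (of_int (chi m) * of_int (psi (n div m)))))"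
      unfolding fps_sub_nth wp sum_subtractf[symmetric] right_diff_distrib[symmetric] coeff ..
    also have "\<dots> = c * eis chi psi c0 $ n"
      using False by (simp add: eis_nth_pos sum_distrib_left mult_ac)
    finally show ?thesis by simp
  qed
qed

text \<open>Expansion of a character in roots of unity; om - om^2 is the Gauss sum of
  \<open>chim3\<close>, as 2 i is that of \<open>chim4\<close> in the companion formula.\<close>

lemma om_power_diff: "om ^ d - (om^2) ^ d = (om - om^2) * of_int (chim3 d)"
proof -
  have "d = 3 * (d div 3) + d mod 3" by simp
  then obtain k r where d: "d = 3 * k + r" "r < 3" by (metis mod_less_divisor zero_less_numeral)
  have "om ^ d = om ^ r" "(om^2) ^ d = (om^2) ^ r"
  proof -
    have "(om^2) ^ 3 = 1" using om_cube by (metis mult.commute power_mult power_one)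
    thus "om ^ d = om ^ r" "(om^2) ^ d = (om^2) ^ r"
      unfolding d power_add power_mult by (simp_all only: om_cube power_one mult_1_left)
  qed
  moreover have "r = 0 \<or> r = 1 \<or> r = 2" using d(2) by linarith
  moreover have "om ^ 4 = om" using om_sq_sq by (simp flip: power_mult)
  ultimately show ?thesis by (auto simp: d chim3_def)
qed

lemma i_power_diff: "\<i> ^ d - (- \<i>) ^ d = 2 * \<i> * of_int (chim4 d)"
proof -
  have "d = 4 * (d div 4) + d mod 4" by simp
  then obtain k r where d: "d = 4 * k + r" "r < 4" by (metis mod_less_divisor zero_less_numeral)
  have "\<i> ^ d = \<i> ^ r" "(- \<i>) ^ d = (- \<i>) ^ r"
    unfolding d by (simp_all add: power_add power_mult power4_eq_xxxx)
  moreover have "r = 0 \<or> r = 1 \<or> r = 2 \<or> r = 3" using d(2) by linarith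
  ultimately show ?thesis by (auto simp: d chim4_def power2_eq_square power3_eq_cube)
qed

lemma chi12_eq: "chi12 d = chim4 d * chim3 d"
proof -
  have "d mod 4 = (d mod 12) mod 4" "d mod 3 = (d mod 12) mod 3" by (simp_all add: mod_mod_cancel)
  then obtain e where e: "d mod 12 = e" "d mod 4 = e mod 4" "d mod 3 = e mod 3" "e < 12"
    by (metis mod_less_divisor zero_less_numeral)
  from e(4) have "e = 0 \<or> e = 1 \<or> e = 2 \<or> e = 3 \<or> e = 4 \<or> e = 5 \<or> e = 6 \<or> e = 7 \<or> e = 8 \<or> e = 9 \<or> e = 10 \<or> e = 11"
    by arith
  thus ?thesis unfolding chi12_def chim4_def chim3_def e by (elim disjE) simp_all
qed

text \<open>The number 2 sqrt 3, which is the Gauss sum of \<open>chi12\<close>.\<close>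

abbreviation "kappa \<equiv> 2 * \<i> * (om^2 - om)"

text \<open>x / (1 - x)^2 = 1 / (x + 1/x - 2), and for these twelfth roots of unity x + 1/x is -r or
  r with r^2 = 3; rationalising gives the values.\<close>

lemma torsion_12_const:
  "(- \<i> * om^2) / (1 - (- \<i> * om^2))^2 = \<i> * (om^2 - om) - 2"
  "(- \<i> * om) / (1 - (- \<i> * om))^2 = - (\<i> * (om^2 - om)) - 2"
proof -
  have inv: "1 / (- \<i> * om^2) = \<i> * om" "1 / (- \<i> * om) = \<i> * om^2"
    using om_mult_om_sq by (simp_all add: field_simps)
  define r where "r = \<i> * (om^2 - om)"
  have "(om^2 - om)^2 = - 3" using om_eq by algebra
  hence r2: "r^2 = 3" by (simp add: r_def power_mult_distrib)
  have q: "x / (1 - x)^2 = 1 / (x + 1 / x - 2)" if "x \<noteq> 0" for x :: complex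
    using that by (simp add: field_simps power2_eq_square)
  have "(r - 2) * (r + 2) = -1" using r2 by (simp add: algebra_simps power2_eq_square)
  hence "r - 2 \<noteq> 0" "r + 2 \<noteq> 0" by auto
  hence k: "1 / (r - 2) = - r - 2" "1 / (- r - 2) = r - 2"
  proof -
    have "(- r - 2) * (r - 2) = 1" "(r - 2) * (- r - 2) = 1" 
      using \<open>(r - 2) * (r + 2) = -1\<close> by algebra+
    thus "1 / (r - 2) = - r - 2" "1 / (- r - 2) = r - 2" by (metis divide_self_if mult_eq_0_iff nonzero_mult_div_cancel_right zero_neq_one)+
  qed
  have s: "- \<i> * om^2 + \<i> * om = - r" "- \<i> * om + \<i> * om^2 = r" by (simp_all add: r_def algebra_simps)
  have kz: "(- \<i> * om^2) / (1 - (- \<i> * om^2))^2 = r - 2" 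
  proof -
    have "(- \<i> * om^2) / (1 - (- \<i> * om^2))^2 = 1 / (- \<i> * om^2 + 1 / (- \<i> * om^2) - 2)" by (rule q) simp
    thus ?thesis unfolding inv s k .
  qed
  have kw: "(- \<i> * om) / (1 - (- \<i> * om))^2 = - r - 2" 
  proof -
    have "(- \<i> * om) / (1 - (- \<i> * om))^2 = 1 / (- \<i> * om + 1 / (- \<i> * om) - 2)" by (rule q) simp
    thus ?thesis unfolding inv s k .
  qed
  show "(- \<i> * om^2) / (1 - (- \<i> * om^2))^2 = \<i> * (om^2 - om) - 2"
    "(- \<i> * om) / (1 - (- \<i> * om))^2 = - (\<i> * (om^2 - om)) - 2"
    using kz kw unfolding r_def .
qed

text \<open>With N = 1 all m contribute equally, which gives the trivial chi. The four primitive
  twelfth roots of unity combine to (i^d - (-i)^d)(om^d - om^(2d)), a multiple of chi12(d).\<close>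

lemma eis_h1: "wp2 (- \<i> * om^2) 0 1 - wp2 (- \<i> * om) 0 1 = fps_const (- kappa) * eis chi1 chi12 23"
proof (rule wp2_diff_eis)
  have inv: "1 / (- \<i> * om^2) = \<i> * om" "1 / (- \<i> * om) = \<i> * om^2"
    using om_mult_om_sq by (simp_all add: field_simps)
  show "(if m mod 1 = 0 then (- \<i> * om^2) ^ d else 0) + (if m mod 1 = (1 - 0) mod 1 then (1 / (- \<i> * om^2)) ^ d else 0)
         - ((if m mod 1 = 0 then (- \<i> * om) ^ d else 0) + (if m mod 1 = (1 - 0) mod 1 then (1 / (- \<i> * om)) ^ d else 0))
         = - kappa * (of_int (chi1 m) * of_int (chi12 d))" for m d :: nat
  proof -
    have "(- \<i> * om^2) ^ d + (\<i> * om) ^ d - ((- \<i> * om) ^ d + (\<i> * om^2) ^ d)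
        = (\<i> ^ d - (- \<i>) ^ d) * (om ^ d - (om^2) ^ d)"
      unfolding power_mult_distrib by (simp add: algebra_simps)
    also have "\<dots> = - kappa * of_int (chi12 d)"
      unfolding om_power_diff i_power_diff chi12_eq by (simp add: algebra_simps)
    finally show ?thesis unfolding inv by (simp add: chi1_def)
  qed
  define r where "r = \<i> * (om^2 - om)"
  note k12 = torsion_12_const[folded r_def]
  \<comment> \<open>The values of 6 k^2 + k at k = r - 2 and k = -r - 2 differ by -46 r: the origin
    of the constant term 23.\<close>
  have "6 * (r - 2)^2 + (r - 2) - (6 * (- r - 2)^2 + (- r - 2)) = - (2 * r) * 23"
    by (simp add: power2_eq_square algebra_simps)
  also have "2 * r = kappa" by (simp add: r_def)
  finally show "wp2 (- \<i> * om^2) 0 1 $ 0 - wp2 (- \<i> * om) 0 1 $ 0 = - kappa * of_int 23"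
    unfolding wp2_def k12 by simp
qed

text \<open>The classes 1, 11 against 5, 7 modulo 12 produce \<open>chi12 m\<close>, and z = w = 1
  produces the trivial psi.\<close>

lemma eis_h2: "wp2 1 1 12 - wp2 1 5 12 = fps_const 1 * eis chi12 chi1 0"
  by (rule wp2_diff_eis) (auto simp: chi12_def chi1_def wp2_def)

text \<open>Exchanging om and om^2 between the classes 1 and 3 modulo 4 separates the two
  characters; \<open>eis_h4\<close> does the same with i, -i and the classes modulo 3.\<close>

lemma eis_h3: "wp2 (om^2) 1 4 - wp2 om 1 4 = fps_const (om^2 - om) * eis chim4 chim3 0"
proof (rule wp2_diff_eis)
  fix m d :: nat
  have "m mod 4 = 1 \<or> m mod 4 = 3 \<or> (m mod 4 \<noteq> 1 \<and> m mod 4 \<noteq> 3)" by blast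
  thus "(if m mod 4 = 1 then (om^2) ^ d else 0) + (if m mod 4 = (4 - 1) mod 4 then (1 / (om^2)) ^ d else 0)
         - ((if m mod 4 = 1 then om ^ d else 0) + (if m mod 4 = (4 - 1) mod 4 then (1 / om) ^ d else 0))
         = (om^2 - om) * (of_int (chim4 m) * of_int (chim3 d))"
    using om_power_diff[of d] unfolding inverse_om inverse_om_sq
    by (auto simp: chim4_def algebra_simps)
qed (simp add: wp2_def)

lemma eis_h4: "wp2 (- \<i>) 1 3 - wp2 \<i> 1 3 = fps_const (- 2 * \<i>) * eis chim3 chim4 0"
proof (rule wp2_diff_eis)
  fix m d :: nat
  have inv: "1 / (- \<i>) = \<i>" "1 / \<i> = - \<i>" by (simp_all add: field_simps)
  have "m mod 3 = 0 \<or> m mod 3 = 1 \<or> m mod 3 = 2" by presburger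
  thus "(if m mod 3 = 1 then (- \<i>) ^ d else 0) + (if m mod 3 = (3 - 1) mod 3 then (1 / (- \<i>)) ^ d else 0)
         - ((if m mod 3 = 1 then \<i> ^ d else 0) + (if m mod 3 = (3 - 1) mod 3 then (1 / \<i>) ^ d else 0))
         = - 2 * \<i> * (of_int (chim3 m) * of_int (chim4 d))"
    using i_power_diff[of d] unfolding inv by (auto simp: chim3_def algebra_simps)
qed (simp add: wp2_def)

lemma eis_factor:
  fixes z w :: complex
  assumes E: "wp2 w b N - wp2 z a N = fps_const c * eis chi psi c0"
    and N: "1 \<le> N" "a < N" and ab: "b \<le> a" "a + b \<le> N" and nz: "z \<noteq> 0" "w \<noteq> 0"
    and z1: "a = 0 \<Longrightarrow> z \<noteq> 1" and w1: "b = 0 \<Longrightarrow> w \<noteq> 1"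
    and c: "Wp w b N - Wp z a N = fls_const c * M" "c \<noteq> 0"
  shows "fps_to_fls (eis chi psi c0) = M * (6 * (Wp z a N + Wp w b N) + 1 - 24 * wl1 N)"
proof -
  have "wp2 w b N - wp2 z a N = (wp w b N - wp z a N) * (6 * (wp z a N + wp w b N) + 1 - 24 * lam1 1 (\<lambda>m. N dvd m))"
    using wp_relations(2)[OF N ab nz z1 w1] by (simp add: algebra_simps)
  from arg_cong[OF this, of fps_to_fls]
  have "fls_const c * fps_to_fls (eis chi psi c0)
      = (Wp w b N - Wp z a N) * (6 * (Wp z a N + Wp w b N) + 1 - 24 * wl1 N)"
    unfolding E Wp_def wl_def by (simp add: fls_times_fps_to_fls)
  also have "\<dots> = fls_const c * (M * (6 * (Wp z a N + Wp w b N) + 1 - 24 * wl1 N))"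
    unfolding c by (simp add: mult.assoc)
  finally show ?thesis using c(2) by simp
qed

section \<open>Weight 2 series as rational functions of X and Y\<close>

lemma weight2_lambert:
  "- 1 + 32 * wl1 4 - 8 * wl1 1 = - (phi1 ^ 4)"
  "- 1 + 32 * wl1 4 - 12 * wl1 2 - 36 * wl1 3 + 4 * wl1 1 + 36 * wl1 6 = - (g3 ^ 2)"
  "3 + 48 * wl1 4 - 12 * wl1 2 - 144 * wl1 12 + 36 * wl1 6 = 3 * (g2 * g3)"
  "1 + 96 * wl1 2 - 12 * wl1 1 - 108 * wl1 3 = g3 ^ 4 / (phi1 ^ 2 * phi3 ^ 2)"
  "- 1 + 32 * wl1 6 - 4 * wl1 3 - 4 * wl1 1 = - (g2 ^ 4 / (phi1 ^ 2 * phi3 ^ 2))"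
proof -
  have W: "Wp (- 1) 0 2 = - 1 / 4 + 8 * wl1 4 - 2 * wl1 2" "Wp 1 1 2 = 2 * wl1 1 - 2 * wl1 2"
    "Wp om 1 2 = 9 * wl1 3 - wl1 1 - 9 * wl1 6 + wl1 2"
    "Wp (- (om^2)) 0 2 = - 1 + 36 * wl1 12 - 4 * wl1 4 - 9 * wl1 6 + wl1 2"
    "Wp (- 1) 0 1 = - 1 / 4 + 8 * wl1 2 - 2 * wl1 1" "Wp om 0 1 = - 1 / 3 + 9 * wl1 3 - wl1 1"
    "Wp (- 1) 0 3 = - 1 / 4 + 8 * wl1 6 - 2 * wl1 3"
    using Wp_m1_0[of 1] Wp_m1_0[of 2] Wp_m1_0[of 3] Wp_1_half[of 1] Wp_om_half[of 1] Wp_mom2_0[of 2] Wp_om_0[of 1]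
    by (simp_all add: fls_const_numeral_divide)
  show "- 1 + 32 * wl1 4 - 8 * wl1 1 = - (phi1 ^ 4)"
    using weight2_a unfolding W by (simp add: field_simps)
  show "- 1 + 32 * wl1 4 - 12 * wl1 2 - 36 * wl1 3 + 4 * wl1 1 + 36 * wl1 6 = - (g3 ^ 2)"
    using weight2_e unfolding W by (simp add: field_simps)
  have "4 * (- 1 / 4 + 8 * wl1 4 - 2 * wl1 2 - (- 1 + 36 * wl1 12 - 4 * wl1 4 - 9 * wl1 6 + wl1 2)) = 3 * (g2 * g3)"
    using weight2_b unfolding W by simp
  thus "3 + 48 * wl1 4 - 12 * wl1 2 - 144 * wl1 12 + 36 * wl1 6 = 3 * (g2 * g3)"
    by (simp add: algebra_simps)
  have "12 * (- 1 / 4 + 8 * wl1 2 - 2 * wl1 1 - (- 1 / 3 + 9 * wl1 3 - wl1 1)) = g3 ^ 4 / (phi1 ^ 2 * phi3 ^ 2)"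
    using weight2_i unfolding W by simp
  thus "1 + 96 * wl1 2 - 12 * wl1 1 - 108 * wl1 3 = g3 ^ 4 / (phi1 ^ 2 * phi3 ^ 2)"
    by (simp add: algebra_simps)
  have "4 * (- 1 / 4 + 8 * wl1 6 - 2 * wl1 3 - (wl1 1 - wl1 3)) = - (g2 ^ 4 / (phi1 ^ 2 * phi3 ^ 2))"
    using weight2_j unfolding W Th_1_1_3(2) by simp
  thus "- 1 + 32 * wl1 6 - 4 * wl1 3 - 4 * wl1 1 = - (g2 ^ 4 / (phi1 ^ 2 * phi3 ^ 2))"
    by (simp add: algebra_simps)
qed

lemma g_eq:
  "g1 = (phi1 ^ 2 - phi3 ^ 2) / 4" "g2 = (phi1 ^ 2 + phi3 ^ 2) / 2"
  "g3 = (3 * phi3 ^ 2 - phi1 ^ 2) / 2" "g4 = (phi1 ^ 2 + 3 * phi3 ^ 2) / 4"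
  using level12_relations by simp_all

text \<open>The weight 2 factors of the four Eisenstein series. Each is a rational combination of
  c1, ..., c5; the coefficients solve a linear system in the constant term and the
  \<open>wl1 d\<close> with d dividing 12, with common denominator 20 or 60. The factor X Y clears
  the denominators of c4 and c5.\<close>

lemma weight2_quartic:
  defines "X \<equiv> phi1 ^ 2" and "Y \<equiv> phi3 ^ 2"
  shows "16 * (X * Y) * (- 23 - 24 * wl1 1 + 24 * wl1 2 - 96 * wl1 4 - 216 * wl1 6 + 864 * wl1 12)
      = - 27 * Y^4 - 216 * X * Y^3 - 126 * X^2 * Y^2 + X^4"
    and "64 * (X * Y) * (1 + 6 * wl1 1 - 6 * wl1 2 - 6 * wl1 3 + 6 * wl1 6 - 24 * wl1 12)
      = - 3 * Y^4 + 42 * X^2 * Y^2 + 24 * X^3 * Y + X^4"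
    and "64 * (X * Y) * (1 - 6 * wl1 1 + 6 * wl1 2 + 54 * wl1 3 - 24 * wl1 4 - 54 * wl1 6)
      = - 27 * Y^4 + 216 * X * Y^3 - 126 * X^2 * Y^2 + X^4"
    and "16 * (X * Y) * (1 - 24 * wl1 2 - 24 * wl1 3 + 96 * wl1 4 + 24 * wl1 6 - 96 * wl1 12)
      = - 3 * Y^4 + 42 * X^2 * Y^2 - 24 * X^3 * Y + X^4"
proof -
  define c1 where "c1 = - 1 + 32 * wl1 4 - 8 * wl1 1"
  define c2 where "c2 = - 1 + 32 * wl1 4 - 12 * wl1 2 - 36 * wl1 3 + 4 * wl1 1 + 36 * wl1 6"
  define c3 where "c3 = 3 + 48 * wl1 4 - 12 * wl1 2 - 144 * wl1 12 + 36 * wl1 6"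
  define c4 where "c4 = 1 + 96 * wl1 2 - 12 * wl1 1 - 108 * wl1 3"
  define c5 where "c5 = - 1 + 32 * wl1 6 - 4 * wl1 3 - 4 * wl1 1"
  note c_defs = c1_def c2_def c3_def c4_def c5_def
  have XY: "X \<noteq> 0" "Y \<noteq> 0" by (simp_all add: X_def Y_def)
  have c: "c1 = - (X^2)" "4 * c2 = - ((3 * Y - X) ^ 2)" "4 * c3 = 3 * ((X + Y) * (3 * Y - X))"
    "16 * (X * Y) * c4 = (3 * Y - X) ^ 4" "16 * (X * Y) * c5 = - ((X + Y) ^ 4)"
    unfolding c_defs weight2_lambert g_eq X_def[symmetric] Y_def[symmetric] using XY
    by (simp_all add: X_def[symmetric] power_divide power_mult flip: power_mult) (simp_all add: X_def flip: power_mult)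
  note simps = algebra_simps power2_eq_square power3_eq_cube power4_eq_xxxx
  have c20: "20 * u = 20 * v \<Longrightarrow> u = v" and c60: "60 * u = 60 * v \<Longrightarrow> u = v" for u v :: "complex fls"
    by simp_all
  have "20 * (16 * (X * Y) * (- 23 - 24 * wl1 1 + 24 * wl1 2 - 96 * wl1 4 - 216 * wl1 6 + 864 * wl1 12))
      = 16 * (X * Y) * (96 * c1) + 4 * (X * Y) * (24 * (4 * c2) - 120 * (4 * c3))
        - 7 * (16 * (X * Y) * c4) - 27 * (16 * (X * Y) * c5)"
    unfolding c_defs by (simp add: algebra_simps)
  also have "\<dots> = 20 * (- 27 * Y^4 - 216 * X * Y^3 - 126 * X^2 * Y^2 + X^4)"
    unfolding c by (simp add: simps)
  finally show "16 * (X * Y) * (- 23 - 24 * wl1 1 + 24 * wl1 2 - 96 * wl1 4 - 216 * wl1 6 + 864 * wl1 12)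
      = - 27 * Y^4 - 216 * X * Y^3 - 126 * X^2 * Y^2 + X^4" by (rule c20)
  have "60 * (64 * (X * Y) * (1 + 6 * wl1 1 - 6 * wl1 2 - 6 * wl1 3 + 6 * wl1 6 - 24 * wl1 12))
      = 16 * (X * Y) * (- 116 * c1) + 4 * (X * Y) * (56 * (4 * c2) + 40 * (4 * c3))
        - 3 * (16 * (X * Y) * c4) - 63 * (16 * (X * Y) * c5)"
    unfolding c_defs by (simp add: algebra_simps)
  also have "\<dots> = 60 * (- 3 * Y^4 + 42 * X^2 * Y^2 + 24 * X^3 * Y + X^4)"
    unfolding c by (simp add: simps)
  finally show "64 * (X * Y) * (1 + 6 * wl1 1 - 6 * wl1 2 - 6 * wl1 3 + 6 * wl1 6 - 24 * wl1 12)
      = - 3 * Y^4 + 42 * X^2 * Y^2 + 24 * X^3 * Y + X^4" by (rule c60)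
  have "20 * (64 * (X * Y) * (1 - 6 * wl1 1 + 6 * wl1 2 + 54 * wl1 3 - 24 * wl1 4 - 54 * wl1 6))
      = 16 * (X * Y) * (36 * c1) + 4 * (X * Y) * (- 96 * (4 * c2))
        - 7 * (16 * (X * Y) * c4) - 27 * (16 * (X * Y) * c5)"
    unfolding c_defs by (simp add: algebra_simps)
  also have "\<dots> = 20 * (- 27 * Y^4 + 216 * X * Y^3 - 126 * X^2 * Y^2 + X^4)"
    unfolding c by (simp add: simps)
  finally show "64 * (X * Y) * (1 - 6 * wl1 1 + 6 * wl1 2 + 54 * wl1 3 - 24 * wl1 4 - 54 * wl1 6)
      = - 27 * Y^4 + 216 * X * Y^3 - 126 * X^2 * Y^2 + X^4" by (rule c20)
  have "60 * (16 * (X * Y) * (1 - 24 * wl1 2 - 24 * wl1 3 + 96 * wl1 4 + 24 * wl1 6 - 96 * wl1 12))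
      = 16 * (X * Y) * (64 * c1) + 4 * (X * Y) * (56 * (4 * c2) + 40 * (4 * c3))
        - 3 * (16 * (X * Y) * c4) - 63 * (16 * (X * Y) * c5)"
    unfolding c_defs by (simp add: algebra_simps)
  also have "\<dots> = 60 * (- 3 * Y^4 + 42 * X^2 * Y^2 - 24 * X^3 * Y + X^4)"
    unfolding c by (simp add: simps)
  finally show "16 * (X * Y) * (1 - 24 * wl1 2 - 24 * wl1 3 + 96 * wl1 4 + 24 * wl1 6 - 96 * wl1 12)
      = - 3 * Y^4 + 42 * X^2 * Y^2 - 24 * X^3 * Y + X^4" by (rule c60)
qed

section \<open>Factorisation of the four Eisenstein series\<close>

text \<open>The roots 1/w, z and 1/z, w pair up as i om, -i om and i om^2, -i om^2, where z = -i om
  and w = -i om^2. Doubling turns them into -om^2 and -om at nome q^2, a pair that reduces to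
  \<open>ee\<close>.\<close>

lemma eis_h1_factor: "fps_to_fls (eis chi1 chi12 23) = - (g2 * g3 * g4 / (phi1 * phi3))
     * (- 23 - 24 * wl1 1 + 24 * wl1 2 - 96 * wl1 4 - 216 * wl1 6 + 864 * wl1 12)"
proof -
  let ?z = "- \<i> * om" and ?w = "- \<i> * om^2"
  have inv: "1 / ?w = \<i> * om" "1 / ?z = \<i> * om^2"
    using om_mult_om_sq by (simp_all add: field_simps)
  have sq: "(\<i> * om)^2 = - (om^2)" "(\<i> * om^2)^2 = - om"
    unfolding power_mult_distrib om_sq_sq by simp_all
  have dbl: "qe (\<i> * om) 1 * qe (- \<i> * om) 1 = qe (- (om^2)) 2"
    "qe (\<i> * om^2) 1 * qe (- \<i> * om^2) 1 = qe (- om) 2"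
    using qe_double[of "\<i> * om" 1, unfolded sq] qe_double[of "\<i> * om^2" 1, unfolded sq] by simp_all
  have dblw: "wl (\<i> * om) 1 + wl (- \<i> * om) 1 = 4 * wl (- (om^2)) 2"
    "wl (\<i> * om^2) 1 + wl (- \<i> * om^2) 1 = 4 * wl (- om) 2"
    using wl_double[of "\<i> * om" 1, unfolded sq] wl_double[of "\<i> * om^2" 1, unfolded sq] by simp_all
  have zw: "?z * ?w = - 1" "?z / ?w = om^2" using om_mult_om_sq om_consts(1) by (simp_all add: field_simps)
  have z1: "?z \<noteq> 1"
  proof
    assume z: "?z = 1"
    hence "?w = - 1" using zw(1) by (metis mult_1)
    thus False using zw(2) om_neq(4) unfolding z by simp
  qed
  have w1: "?w \<noteq> 1"
  proof
    assume w: "?w = 1"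
    hence "?z = - 1" using zw(1) by (metis mult.right_neutral)
    thus False using zw(2) om_neq(4) unfolding w by simp
  qed
  have c: "Th ?z 0 1 * Th ?w 0 1 = fls_const (- \<i>) * (ee 12 * ee 2 / (ee 4 * ee 6))"
  proof -
    have "Th ?z 0 1 * Th ?w 0 1 = fls_const ((1 - ?z) * (1 - ?w))
        * ((qe (\<i> * om) 1 * qe (- \<i> * om) 1) * (qe (\<i> * om^2) 1 * qe (- \<i> * om^2) 1))"
      unfolding Th_0 inv by (simp only: fc_mult) (simp only: mult_ac)
    also have "(1 - ?z) * (1 - ?w) = - \<i>"
    proof -
      have "(1 - - \<i> * u) * (1 - - \<i> * v) = 1 + \<i> * (u + v) + (- \<i> * u) * (- \<i> * v)" for u v
        by (simp add: algebra_simps)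
      moreover have "om + om^2 = - 1" using om_sq by simp
      ultimately show ?thesis using zw(1) by simp
    qed
    also have "(qe (\<i> * om) 1 * qe (- \<i> * om) 1) * (qe (\<i> * om^2) 1 * qe (- \<i> * om^2) 1) = ee 12 * ee 2 / (ee 4 * ee 6)"
      unfolding dbl using qe_minus_om[of 2] by (simp add: mult_ac)
    finally show ?thesis .
  qed
  have k: "Th (?z * ?w) (0 + 0) 1 * Th (?z / ?w) (0 - 0) 1 = fls_const (2 * (1 - om^2)) * ((ee 2 / ee 1)^2 * (ee 3 / ee 1))"
  proof -
    have T: "Th (- 1) 0 1 = fls_const 2 * (ee 2 / ee 1)^2" "Th (om^2) 0 1 = fls_const (1 - om^2) * (ee 3 / ee 1)"
      using Th_m1_0[of 1] Th_om2_0[of 1] by simp_all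
    show ?thesis by (simp only: zw T add_0_left diff_zero fc_mult)
  qed
  have "Wp ?w 0 1 - Wp ?z 0 1 = fls_const (?w * (2 * (1 - om^2)) / (- \<i>)^2) * fls_X ^ 0 * ee 1 ^ 4
      * ((ee 2 / ee 1)^2 * (ee 3 / ee 1)) / (ee 12 * ee 2 / (ee 4 * ee 6))^2"
    by (rule Wp_diff[OF _ _ _ _ _ _ _ c k]) (use z1 w1 in auto)
  also have "?w * (2 * (1 - om^2)) / (- \<i>)^2 = kappa"
    using om_sq_sq by (simp add: algebra_simps power2_eq_square[of "om^2"])
  also have "fls_const kappa * fls_X ^ 0 * ee 1 ^ 4 * ((ee 2 / ee 1)^2 * (ee 3 / ee 1)) / (ee 12 * ee 2 / (ee 4 * ee 6))^2
      = fls_const (- kappa) * (- (g2 * g3 * g4 / (phi1 * phi3)))"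
  proof -
    have "ee 1 ^ 4 * ((ee 2 / ee 1)^2 * (ee 3 / ee 1)) / (ee 12 * ee 2 / (ee 4 * ee 6))^2 = g2 * g3 * g4 / (phi1 * phi3)"
      by (simp add: eta_defs divide_simps; algebra?)
    moreover have "fls_const c * fls_X ^ 0 * m * n / d = fls_const (- c) * (- (m * n / d))" for c and m n d :: "complex fls"
    proof -
      have "fls_const (- c) = - fls_const c" by (rule fls_eqI) simp
      thus ?thesis by (simp add: mult.assoc)
    qed
    ultimately show ?thesis by (simp only:)
  qed
  finally have d: "Wp ?w 0 1 - Wp ?z 0 1 = fls_const (- kappa) * (- (g2 * g3 * g4 / (phi1 * phi3)))" .
  have L: "6 * (Wp ?z 0 1 + Wp ?w 0 1) + 1 - 24 * wl1 1
     = - 23 - 24 * wl1 1 + 24 * wl1 2 - 96 * wl1 4 - 216 * wl1 6 + 864 * wl1 12"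
  proof -
    \<comment> \<open>The values -r - 2 and r - 2 add up to -4, whence 6 (-4) + 1 = -23
      below.\<close>
    have cc: "fls_const (?z / (1 - ?z)^2) + fls_const (?w / (1 - ?w)^2) = - 4"
      unfolding torsion_12_const fls_plus_const by simp
    have "Wp ?z 0 1 + Wp ?w 0 1 = (fls_const (?z / (1 - ?z)^2) + fls_const (?w / (1 - ?w)^2))
       + (wl (\<i> * om) 1 + wl (- \<i> * om) 1) + (wl (\<i> * om^2) 1 + wl (- \<i> * om^2) 1)"
      unfolding Wp_0 inv by (simp only: add_ac)
    also have "\<dots> = - 4 + 4 * (wl (- om) 2 + wl (- (om^2)) 2)"
      unfolding cc dblw by (simp add: algebra_simps)
    also have "wl (- om) 2 + wl (- (om^2)) 2 = 36 * wl1 12 - 4 * wl1 4 - 9 * wl1 6 + wl1 2"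
      using wl_minus_om[of 2] by simp
    finally have W: "Wp ?z 0 1 + Wp ?w 0 1 = - 4 + 4 * (36 * wl1 12 - 4 * wl1 4 - 9 * wl1 6 + wl1 2)" .
    show ?thesis unfolding W by (simp add: algebra_simps)
  qed
  have "om^2 \<noteq> om" by (simp add: power2_eq_square del: om_mult)
  hence "fps_to_fls (eis chi1 chi12 23) = - (g2 * g3 * g4 / (phi1 * phi3)) * (6 * (Wp ?z 0 1 + Wp ?w 0 1) + 1 - 24 * wl1 1)"
    by (intro eis_factor[OF eis_h1 _ _ _ _ _ _ _ _ d]) (use z1 w1 in auto)
  thus ?thesis unfolding L .
qed

lemma mod_6_eq_mod_12:
  "m mod 6 = (1::nat) \<longleftrightarrow> m mod 12 = 1 \<or> m mod 12 = 7"
  "m mod 6 = (5::nat) \<longleftrightarrow> m mod 12 = 5 \<or> m mod 12 = 11"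
proof -
  have "m mod 6 = (m mod 12) mod 6" by (simp add: mod_mod_cancel)
  then obtain e where e: "m mod 12 = e" "m mod 6 = e mod 6" "e < 12"
    by (metis mod_less_divisor zero_less_numeral)
  from e(3) have "e = 0 \<or> e = 1 \<or> e = 2 \<or> e = 3 \<or> e = 4 \<or> e = 5 \<or> e = 6 \<or> e = 7 \<or> e = 8 \<or> e = 9 \<or> e = 10 \<or> e = 11"
    by arith
  thus "m mod 6 = (1::nat) \<longleftrightarrow> m mod 12 = 1 \<or> m mod 12 = 7"
    "m mod 6 = (5::nat) \<longleftrightarrow> m mod 12 = 5 \<or> m mod 12 = 11"
    unfolding e by (elim disjE; simp)+
qed

lemma eis_h2_factor: "fps_to_fls (eis chi12 chi1 0) = g1 * g2 * g4 / (phi1 * phi3)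
     * (1 + 6 * wl1 1 - 6 * wl1 2 - 6 * wl1 3 + 6 * wl1 6 - 24 * wl1 12)"
proof -
  let ?r = "\<lambda>a m :: nat. m mod 12 = a"
  have q: "qprod (1::complex) (\<lambda>m. m mod 6 = 1) = qprod 1 (?r 1) * qprod 1 (?r 7)"
    "qprod (1::complex) (\<lambda>m. m mod 6 = 5) = qprod 1 (?r 5) * qprod 1 (?r 11)"
    by (rule qprod_union; simp add: mod_6_eq_mod_12[unfolded One_nat_def])+
  have l: "lam1 (1::complex) (\<lambda>m. m mod 6 = 1) = lam1 1 (?r 1) + lam1 1 (?r 7)"
    "lam1 (1::complex) (\<lambda>m. m mod 6 = 5) = lam1 1 (?r 5) + lam1 1 (?r 11)"
    by (rule lam1_union; simp add: mod_6_eq_mod_12[unfolded One_nat_def])+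
  \<comment> \<open>The classes 1, 5, 7, 11 modulo 12 together are the classes 1, 5 modulo
    6.\<close>
  have "Th 1 5 12 * Th 1 1 12 = Th 1 1 6"
    by (simp add: Th_def qtheta_def q[simplified] fls_times_fps_to_fls)
  hence c: "Th 1 5 12 * Th 1 1 12 = fls_const 1 * (ee 1 * ee 6 / (ee 2 * ee 3))"
    unfolding Th_1_1_6 by simp
  have w: "Wp 1 5 12 + Wp 1 1 12 = wl1 1 - wl1 2 - wl1 3 + wl1 6"
    unfolding Th_1_1_6(2)[symmetric] by (simp add: Wp_def wp_def l[simplified])
  have "Th 1 6 12 = (ee 6 / ee 12)^2" using Th_1_half[of 6] by simp
  hence k: "Th (1 * 1) (5 + 1) 12 * Th (1 / 1) (5 - 1) 12 = fls_const 1 * ((ee 6 / ee 12)^2 * (ee 4 / ee 12))"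
    by (simp add: Th_1_4_12)
  have "Wp 1 1 12 - Wp 1 5 12 = fls_const (1 * 1 / 1^2) * fls_X ^ 1 * ee 12 ^ 4
      * ((ee 6 / ee 12)^2 * (ee 4 / ee 12)) / (ee 1 * ee 6 / (ee 2 * ee 3))^2"
    by (rule Wp_diff[OF _ _ _ _ _ _ _ c k]) auto
  also have "\<dots> = fls_const 1 * (g1 * g2 * g4 / (phi1 * phi3))"
    by (simp add: eta_defs divide_simps; algebra?)
  finally have d: "Wp 1 1 12 - Wp 1 5 12 = fls_const 1 * (g1 * g2 * g4 / (phi1 * phi3))" .
  have "fps_to_fls (eis chi12 chi1 0) = g1 * g2 * g4 / (phi1 * phi3) * (6 * (Wp 1 5 12 + Wp 1 1 12) + 1 - 24 * wl1 12)"
    by (rule eis_factor[OF eis_h2 _ _ _ _ _ _ _ _ d]) auto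
  thus ?thesis unfolding w by (simp add: algebra_simps)
qed

lemma eis_h3_factor: "fps_to_fls (eis chim4 chim3 0) = g1 * g3 * g4 / (phi1 * phi3)
     * (1 - 6 * wl1 1 + 6 * wl1 2 + 54 * wl1 3 - 24 * wl1 4 - 54 * wl1 6)"
proof -
  let ?r = "\<lambda>a m :: nat. m mod 4 = a"
  have q: "qprod x (\<lambda>m. m mod 2 = 1) = qprod x (?r 1) * qprod x (?r 3)" for x :: complex
    by (rule qprod_union; presburger)
  have l: "lam1 x (\<lambda>m. m mod 2 = 1) = lam1 x (?r 1) + lam1 x (?r 3)" for x :: complex
    by (rule lam1_union; presburger)
  have r: "(4 - 1) mod 4 = (3::nat)" "(2 - 1) mod 2 = (1::nat)" by simp_all
  \<comment> \<open>Both om and om^2 occur in both odd classes modulo 4, so together all odd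
    exponents are covered.\<close>
  have "Th om 1 4 * Th (om^2) 1 4 = Th om 1 2"
    unfolding Th_def qtheta_def inverse_om inverse_om_sq fls_times_fps_to_fls[symmetric] r q by (simp add: mult_ac)
  hence c: "Th om 1 4 * Th (om^2) 1 4 = fls_const 1 * (ee 3 * ee 2 / (ee 1 * ee 6))"
    unfolding torsion_2 by simp
  have "Wp om 1 4 + Wp (om^2) 1 4 = Wp om 1 2"
    unfolding Wp_def wp_def inverse_om inverse_om_sq fps_to_fls_plus[symmetric] r l by (simp add: add_ac)
  also have "\<dots> = 9 * wl1 3 - wl1 1 - 9 * wl1 6 + wl1 2" using Wp_om_half[of 1] by simp
  finally have w: "Wp om 1 4 + Wp (om^2) 1 4 = 9 * wl1 3 - wl1 1 - 9 * wl1 6 + wl1 2" .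
  have "Th 1 2 4 = (ee 2 / ee 4)^2" "Th (om^2) 0 4 = fls_const (1 - om^2) * (ee 12 / ee 4)"
    using Th_1_half[of 2] Th_om2_0[of 4] by simp_all
  hence k: "Th (om * om^2) (1 + 1) 4 * Th (om / om^2) (1 - 1) 4 = fls_const (1 - om^2) * ((ee 2 / ee 4)^2 * (ee 12 / ee 4))"
    unfolding om_consts by (simp add: mult_ac numeral_2_eq_2[symmetric])
  have "Wp (om^2) 1 4 - Wp om 1 4 = fls_const (om^2 * (1 - om^2) / 1^2) * fls_X ^ 1 * ee 4 ^ 4
      * ((ee 2 / ee 4)^2 * (ee 12 / ee 4)) / (ee 3 * ee 2 / (ee 1 * ee 6))^2"
    by (rule Wp_diff[OF _ _ _ _ _ _ _ c k]) auto
  also have "om^2 * (1 - om^2) / 1^2 = om^2 - om"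
    using om_sq_sq by (simp add: right_diff_distrib power2_eq_square[of "om^2"])
  also have "fls_const (om^2 - om) * fls_X ^ 1 * ee 4 ^ 4 * ((ee 2 / ee 4)^2 * (ee 12 / ee 4)) / (ee 3 * ee 2 / (ee 1 * ee 6))^2
      = fls_const (om^2 - om) * (g1 * g3 * g4 / (phi1 * phi3))"
  proof -
    have "fls_X ^ 1 * ee 4 ^ 4 * ((ee 2 / ee 4)^2 * (ee 12 / ee 4)) / (ee 3 * ee 2 / (ee 1 * ee 6))^2 = g1 * g3 * g4 / (phi1 * phi3)"
      by (simp add: eta_defs divide_simps; algebra?)
    moreover have "fls_const c * x * m * n / d = fls_const c * (x * m * n / d)" for c and x m n d :: "complex fls"
      by simp
    ultimately show ?thesis by (simp only:)
  qed
  finally have d: "Wp (om^2) 1 4 - Wp om 1 4 = fls_const (om^2 - om) * (g1 * g3 * g4 / (phi1 * phi3))" .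
  have "om^2 - om \<noteq> 0" by (simp add: power2_eq_square del: om_mult)
  hence "fps_to_fls (eis chim4 chim3 0) = g1 * g3 * g4 / (phi1 * phi3) * (6 * (Wp om 1 4 + Wp (om^2) 1 4) + 1 - 24 * wl1 4)"
    by (intro eis_factor[OF eis_h3 _ _ _ _ _ _ _ _ d]) auto
  thus ?thesis unfolding w by (simp add: algebra_simps)
qed

lemma eis_h4_factor: "fps_to_fls (eis chim3 chim4 0) = g1 * g2 * g3 / (phi1 * phi3)
     * (1 - 24 * wl1 2 - 24 * wl1 3 + 96 * wl1 4 + 24 * wl1 6 - 96 * wl1 12)"
proof -
  \<comment> \<open>The points i and -i at nome q^3 double to the point -1 at nome q^6.\<close>
  have c: "Th \<i> 1 3 * Th (- \<i>) 1 3 = fls_const 1 * (ee 4 * ee 6 / (ee 2 * ee 12))"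
    using Th_double(1)[of 1 3 "\<i>"] Th_m1_2_6 by simp
  have w: "Wp \<i> 1 3 + Wp (- \<i>) 1 3 = 4 * (4 * wl1 4 - 4 * wl1 12 - wl1 2 + wl1 6)"
    using Th_double(2)[of 1 3 "\<i>"] Wp_m1_2_6 by simp
  have "Th 1 2 3 = ee 1 / ee 3" using Th_reflect[of 1 3 1] Th_1_1_3(1) by simp
  moreover have "Th (- 1) 0 3 = fls_const 2 * (ee 6 / ee 3)^2" using Th_m1_0[of 3] by simp
  ultimately have k: "Th (\<i> * - \<i>) (1 + 1) 3 * Th (\<i> / - \<i>) (1 - 1) 3 = fls_const 2 * ((ee 1 / ee 3) * (ee 6 / ee 3)^2)"
    by (simp add: numeral_2_eq_2[symmetric])
  have "Wp (- \<i>) 1 3 - Wp \<i> 1 3 = fls_const (- \<i> * 2 / 1^2) * fls_X ^ 1 * ee 3 ^ 4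
      * ((ee 1 / ee 3) * (ee 6 / ee 3)^2) / (ee 4 * ee 6 / (ee 2 * ee 12))^2"
    by (rule Wp_diff[OF _ _ _ _ _ _ _ c k]) auto
  also have "- \<i> * 2 / 1^2 = - 2 * \<i>" by simp
  also have "fls_const (- 2 * \<i>) * fls_X ^ 1 * ee 3 ^ 4 * ((ee 1 / ee 3) * (ee 6 / ee 3)^2) / (ee 4 * ee 6 / (ee 2 * ee 12))^2
      = fls_const (- 2 * \<i>) * (g1 * g2 * g3 / (phi1 * phi3))"
  proof -
    have "fls_X ^ 1 * ee 3 ^ 4 * ((ee 1 / ee 3) * (ee 6 / ee 3)^2) / (ee 4 * ee 6 / (ee 2 * ee 12))^2 = g1 * g2 * g3 / (phi1 * phi3)"
      by (simp add: eta_defs divide_simps; algebra?)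
    moreover have "fls_const c * x * m * n / d = fls_const c * (x * m * n / d)" for c and x m n d :: "complex fls"
      by simp
    ultimately show ?thesis by (simp only:)
  qed
  finally have d: "Wp (- \<i>) 1 3 - Wp \<i> 1 3 = fls_const (- 2 * \<i>) * (g1 * g2 * g3 / (phi1 * phi3))" .
  have "fps_to_fls (eis chim3 chim4 0) = g1 * g2 * g3 / (phi1 * phi3) * (6 * (Wp \<i> 1 3 + Wp (- \<i>) 1 3) + 1 - 24 * wl1 3)"
    by (rule eis_factor[OF eis_h4 _ _ _ _ _ _ _ _ d]) auto
  thus ?thesis unfolding w by (simp add: algebra_simps)
qed

lemma gser_add: "gser A e c + gser A e c' = gser A e (\<lambda>i. c i + c' i)"
  by (rule fps_ext) (simp add: gser_nth sum.distrib)

lemma gser_restrict: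
  assumes "ffib A e"
  shows "gser A e (\<lambda>i. if P i then c i else 0) = gser {i \<in> A. P i} e c"
proof (rule fps_ext)
  fix n
  have "finite {i. i \<in> A \<and> e i = n}" using assms by (auto simp: ffib_def)
  hence "(\<Sum>i | i \<in> A \<and> e i = n. if P i then c i else 0) = (\<Sum>i | i \<in> {i. i \<in> A \<and> e i = n} \<and> P i. c i)"
    by (intro sum.inter_filter [symmetric])
  also have "{i. i \<in> {i. i \<in> A \<and> e i = n} \<and> P i} = {i. i \<in> {i \<in> A. P i} \<and> e i = n}" by auto
  finally show "gser A e (\<lambda>i. if P i then c i else 0) $ n = gser {i \<in> A. P i} e c $ n"
    by (simp add: gser_nth)
qed

subsection \<open>Theta series of quadratic forms\<close>

definition sq_exp :: "nat \<Rightarrow> int \<Rightarrow> nat" where "sq_exp a x = nat (int a * x^2)"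
definition hex_exp :: "nat \<Rightarrow> int \<times> int \<Rightarrow> nat" where
  "hex_exp b = (\<lambda>(x, y). nat (int b * (x^2 + x * y + y^2)))"

text \<open>\<open>sq a\<close> and \<open>asq a\<close> are Ramanujan's phi(q^a) and phi(-q^a); for
  odd a the latter arises from the former by q -> -q. \<open>hx b\<close> is the cubic theta
  function a(q^b) of the Borweins.\<close>

definition sq :: "nat \<Rightarrow> complex fps" where "sq a = gser UNIV (sq_exp a) (\<lambda>_. 1)"
definition asq :: "nat \<Rightarrow> complex fps" where "asq a = gser UNIV (sq_exp a) (\<lambda>x. (-1) powi x)"
definition hx :: "nat \<Rightarrow> complex fps" where "hx b = gser UNIV (hex_exp b) (\<lambda>_. 1)"

lemma hex_form_ge: "2 * (x^2 + x * y + y^2) \<ge> x^2" "2 * (x^2 + x * y + y^2) \<ge> (y::int)^2" "x^2 + x * y + y^2 \<ge> 0"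
proof -
  have "2 * (x^2 + x * y + y^2) = x^2 + (x + y)^2 + y^2" by (simp add: power2_eq_square algebra_simps)
  thus "2 * (x^2 + x * y + y^2) \<ge> x^2" "2 * (x^2 + x * y + y^2) \<ge> y^2" "x^2 + x * y + y^2 \<ge> 0"
    using zero_le_power2[of x] zero_le_power2[of y] zero_le_power2[of "x + y"] by (smt (verit))+
qed

lemma abs_le_square: "\<bar>x::int\<bar> \<le> x^2"
proof -
  have "\<bar>x\<bar> * 1 \<le> \<bar>x\<bar> * \<bar>x\<bar>"
  proof (cases "x = 0")
    case False
    thus ?thesis by (intro mult_left_mono) auto
  qed simp
  thus ?thesis by (simp add: power2_eq_square)
qed

lemma ffib_sq: "a \<ge> 1 \<Longrightarrow> ffib UNIV (sq_exp a)"
  unfolding sq_exp_def[abs_def]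
proof (rule ffib_abs_bound)
  fix x :: int assume "a \<ge> 1"
  hence "1 * x^2 \<le> int a * x^2" by (intro mult_right_mono) auto
  thus "\<bar>x\<bar> - 1 \<le> int a * x^2" using abs_le_square[of x] by linarith
qed

lemma ffib_hex:
  assumes b: "b \<ge> 1" shows "ffib UNIV (hex_exp b)"
  unfolding ffib_def
proof
  fix n
  have "x \<in> {-2 * int n..2 * int n} \<and> y \<in> {-2 * int n..2 * int n}" if "hex_exp b (x, y) = n" for x y
  proof -
    let ?f = "x^2 + x * y + y^2"
    have "1 * ?f \<le> int b * ?f" using b hex_form_ge(3)[of x y] by (intro mult_right_mono) auto
    moreover have "int b * ?f = int n" using that hex_form_ge(3)[of x y] by (auto simp: hex_exp_def)
    ultimately show ?thesis using hex_form_ge(1)[of x y] hex_form_ge(2)[of y x] abs_le_square[of x] abs_le_square[of y]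
      unfolding atLeastAtMost_iff by linarith
  qed
  hence "p \<in> {-2 * int n..2 * int n} \<times> {-2 * int n..2 * int n}" if "hex_exp b p = n" for p
    using that by (metis mem_Sigma_iff prod.collapse)
  hence "{p. p \<in> UNIV \<and> hex_exp b p = n} \<subseteq> {-2 * int n..2 * int n} \<times> {-2 * int n..2 * int n}"
    by blast
  thus "finite {p. p \<in> UNIV \<and> hex_exp b p = n}" by (rule finite_subset) simp
qed

lemma powi_minus_one: "(-1 :: complex) powi n = (if even n then 1 else -1)"
  by (cases "n \<ge> 0") (auto simp: power_int_def even_nat_iff)

lemma tex_double: "tex a (2 * a) n = int a * n^2"
proof -
  have "tex a (2 * a) n = int a * (2 * (n * (n - 1) div 2)) + int a * n" by (simp add: tex_def)
  thus ?thesis unfolding int_mult_pred_div_2 by (simp add: power2_eq_square algebra_simps)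
qed

text \<open>At the half periods x = -q^a and x = q^a of nome q^(2a) the theta exponents become a
  n^2.\<close>

lemma sq_theta: "sq a = theta_ser (-1) a (2 * a)" and asq_theta: "asq a = theta_ser 1 a (2 * a)"
  unfolding sq_def asq_def theta_ser_def tex_double sq_exp_def[abs_def] by (auto intro!: gser_cong)

lemma sq_eta: "a \<ge> 1 \<Longrightarrow> fps_to_fls (sq a) = ee (2 * a) ^ 5 / (ee a ^ 2 * ee (4 * a) ^ 2)"
proof -
  assume a: "a \<ge> 1"
  have "fps_to_fls (sq a) = ee (2 * a) * Th (-1) a (2 * a)"
    unfolding sq_theta using a by (subst jacobi_triple_product) (auto simp: qe_def Th_def fls_times_fps_to_fls)
  also have "\<dots> = ee (2 * a) ^ 5 / (ee a ^ 2 * ee (4 * a) ^ 2)"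
    using a by (simp add: Th_m1_half divide_simps power_numeral_reduce)
  finally show ?thesis .
qed

lemma asq_eta: "a \<ge> 1 \<Longrightarrow> fps_to_fls (asq a) = ee a ^ 2 / ee (2 * a)"
proof -
  assume a: "a \<ge> 1"
  have "fps_to_fls (asq a) = ee (2 * a) * Th 1 a (2 * a)"
    unfolding asq_theta using a by (subst jacobi_triple_product) (auto simp: qe_def Th_def fls_times_fps_to_fls)
  also have "\<dots> = ee a ^ 2 / ee (2 * a)"
    using a by (simp add: Th_1_half divide_simps power2_eq_square)
  finally show ?thesis .
qed

lemma pair_exp_ffib: "a \<ge> 1 \<Longrightarrow> b \<ge> 1 \<Longrightarrow> ffib UNIV (\<lambda>(x, y). sq_exp a x + sq_exp b y)"
  using ffib_Times[OF ffib_sq ffib_sq, of a b] by simp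

lemma sq_sq: "a \<ge> 1 \<Longrightarrow> b \<ge> 1 \<Longrightarrow> sq a * sq b = gser UNIV (\<lambda>(x, y). sq_exp a x + sq_exp b y) (\<lambda>_. 1)"
  unfolding sq_def by (subst gser_mult) (auto simp: ffib_sq intro!: gser_cong)

lemma asq_asq: "a \<ge> 1 \<Longrightarrow> b \<ge> 1 \<Longrightarrow> asq a * asq b
    = gser UNIV (\<lambda>(x, y). sq_exp a x + sq_exp b y) (\<lambda>(x, y). if even (x + y) then 1 else -1)"
  unfolding asq_def by (subst gser_mult) (auto simp: ffib_sq powi_minus_one intro!: gser_cong)

lemma sq_plus_asq:
  assumes "a \<ge> 1" "b \<ge> 1"
  shows "sq a * sq b + asq a * asq b = 2 * gser {(x, y). even (x + y)} (\<lambda>(x, y). sq_exp a x + sq_exp b y) (\<lambda>_. 1)"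
proof -
  have "sq a * sq b + asq a * asq b = gser UNIV (\<lambda>(x, y). sq_exp a x + sq_exp b y)
      (\<lambda>p. if (case p of (x, y) \<Rightarrow> even (x + y)) then 2 else 0)"
    unfolding sq_sq[OF assms] asq_asq[OF assms] gser_add by (intro gser_cong) (simp_all split: prod.split)
  also have "\<dots> = gser {p \<in> UNIV. case p of (x, y) \<Rightarrow> even (x + y)} (\<lambda>(x, y). sq_exp a x + sq_exp b y) (\<lambda>_. 2)"
    by (rule gser_restrict[OF pair_exp_ffib[OF assms]])
  also have "\<dots> = gser {(x, y). even (x + y)} (\<lambda>(x, y). sq_exp a x + sq_exp b y) (\<lambda>_. 1 + 1)"
    by (intro gser_cong) auto
  also have "\<dots> = 2 * gser {(x, y). even (x + y)} (\<lambda>(x, y). sq_exp a x + sq_exp b y) (\<lambda>_. 1)"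
    unfolding gser_add[symmetric] by simp
  finally show ?thesis .
qed

lemma sq_exp_add: "sq_exp a x + sq_exp b y = nat (int a * x^2 + int b * y^2)"
  by (simp add: sq_exp_def nat_add_distrib)

text \<open>Substituting \<open>(x, y) \<mapsto> (x + y, x - y)\<close> in \<open>a x^2 + a y^2\<close> and in \<open>b x^2 + 3 b y^2\<close>.\<close>

lemma sq_double: "a \<ge> 1 \<Longrightarrow> sq a ^ 2 + asq a ^ 2 = 2 * sq (2 * a) ^ 2"
proof -
  assume a: "a \<ge> 1"
  have "gser {(x, y). even (x + y)} (\<lambda>(x, y). sq_exp a x + sq_exp a y) (\<lambda>_. 1) = sq (2 * a) * sq (2 * a)"
    using a unfolding gser_reindex[OF bij_betw_even_sum]
    by (subst sq_sq) (auto simp: sq_exp_add power2_eq_square algebra_simps intro!: gser_cong)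
  thus ?thesis using sq_plus_asq[OF a a] by (simp add: power2_eq_square)
qed

lemma bij_betw_even_sum': "bij_betw (\<lambda>(b, c). (b - c, b + c)) UNIV {(m :: int, n). even (m + n)}"
proof -
  have "bij_betw prod.swap {(m :: int, n). even (m + n)} {(m :: int, n). even (m + n)}"
    by (auto simp: bij_betw_def inj_on_def image_iff add.commute)
  from bij_betw_trans[OF bij_betw_even_sum this] show ?thesis
    by (simp add: comp_def case_prod_unfold)
qed

lemma hex_quad:
  assumes b: "b \<ge> 1"
  shows "2 * hx (4 * b) = sq b * sq (3 * b) + asq b * asq (3 * b)"
proof -
  have "gser {(x, y). even (x + y)} (\<lambda>(x, y). sq_exp b x + sq_exp (3 * b) y) (\<lambda>_. 1) = hx (4 * b)"
    unfolding gser_reindex[OF bij_betw_even_sum'] hx_def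
    by (auto simp: sq_exp_add hex_exp_def power2_eq_square algebra_simps intro!: gser_cong)
  thus ?thesis using sq_plus_asq[of b "3 * b"] b by simp
qed

text \<open>Inclusion-exclusion over the sublattices x even, y even and x + y even: they cover the
  lattice, symmetries of the form carry them into each other, and any two meet in the doubled
  lattice, whose series is \<open>hx (4 * b)\<close>.\<close>

lemma hex_parity:
  assumes b: "b \<ge> 1"
  shows "hx b = 3 * (sq b * sq (3 * b)) - 2 * hx (4 * b)"
proof -
  define G where "G S = gser S (hex_exp b) (\<lambda>_. 1 :: complex)" for S
  have un: "G (S \<union> T) = G S + G T" if "S \<inter> T = {}" for S T
    unfolding G_def
  proof (rule gser_union[OF _ that])
    show "ffib (S \<union> T) (hex_exp b)"
      using ffib_hex[OF b] unfolding ffib_def by (auto intro: finite_subset[rotated])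
  qed
  let ?E = "{(x :: int, y :: int). even x \<and> even y}"
  have y: "G {(x, y). even y} = sq b * sq (3 * b)"
  proof -
    \<comment> \<open>At (u - v, 2 v) the form takes the value u^2 + 3 v^2.\<close>
    have bij: "bij_betw (\<lambda>(u, v). (u - v, 2 * v)) UNIV {(x :: int, y :: int). even y}"
      by (rule bij_betwI[of _ _ _ "\<lambda>(x, y). (x + y div 2, y div 2)"]) auto
    show ?thesis
      unfolding G_def gser_reindex[OF bij] using b
      by (subst sq_sq) (auto simp: sq_exp_add hex_exp_def power2_eq_square algebra_simps intro!: gser_cong)
  qed
  have x: "G {(x, y). even x} = G {(x, y). even y}"
  proof -
    have bij: "bij_betw prod.swap {(x :: int, y :: int). even y} {(x, y). even x}"
      by (auto simp: bij_betw_def inj_on_def image_iff)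
    show ?thesis unfolding G_def gser_reindex[OF bij]
      by (auto simp: hex_exp_def algebra_simps intro!: gser_cong)
  qed
  have xy: "G {(x, y). even (x + y)} = G {(x, y). even x}"
  proof -
    have bij: "bij_betw (\<lambda>(x, y). (x + y, - y)) {(x :: int, y :: int). even (x + y)} {(x, y). even x}"
      by (rule bij_betwI[of _ _ _ "\<lambda>(x, y). (x + y, - y)"]) auto
    show ?thesis unfolding G_def gser_reindex[OF bij]
      by (auto simp: hex_exp_def power2_eq_square algebra_simps intro!: gser_cong)
  qed
  have e: "G ?E = hx (4 * b)"
  proof -
    have bij: "bij_betw (\<lambda>(x, y). (2 * x, 2 * y)) UNIV ?E"
      by (rule bij_betwI[of _ _ _ "\<lambda>(x, y). (x div 2, y div 2)"]) auto
    show ?thesis unfolding G_def gser_reindex[OF bij] hx_def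
      by (auto simp: hex_exp_def power2_eq_square algebra_simps intro!: gser_cong)
  qed
  have 1: "G {(x, y). even x} = G ?E + G {(x, y). even x \<and> odd y}"
    by (subst un[symmetric]) (auto intro!: arg_cong[of _ _ G])
  have 2: "G {(x, y). even (x + y)} = G ?E + G {(x, y). odd x \<and> odd y}"
    by (subst un[symmetric]) (auto intro!: arg_cong[of _ _ G])
  have 3: "G UNIV = G {(x, y). even y} + (G {(x, y). even x \<and> odd y} + G {(x, y). odd x \<and> odd y})"
    by (subst un[symmetric], force, subst un[symmetric]) (auto intro!: arg_cong[of _ _ G])
  have "hx b = G UNIV" by (simp add: G_def hx_def)
  also have "\<dots> = 3 * (sq b * sq (3 * b)) - 2 * hx (4 * b)"
    using 1 2 3 unfolding xy x y e by (simp add: algebra_simps)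
  finally show ?thesis .
qed

section \<open>Generating function of the representation numbers\<close>

definition rep_exp :: "nat \<Rightarrow> nat \<Rightarrow> nat \<Rightarrow> nat \<Rightarrow> nat \<Rightarrow> nat \<Rightarrow> int \<times> int \<times> int \<times> int \<times> (int \<times> int) \<times> (int \<times> int) \<Rightarrow> nat" where
  "rep_exp a1 a2 a3 a4 b1 b2 = (\<lambda>(x1, x2, x3, x4, p, r).
     sq_exp a1 x1 + (sq_exp a2 x2 + (sq_exp a3 x3 + (sq_exp a4 x4 + (hex_exp b1 p + hex_exp b2 r)))))"

lemma ffib_Times': "ffib UNIV e \<Longrightarrow> ffib UNIV e' \<Longrightarrow> ffib UNIV (\<lambda>(i, j). e i + e' j)"
  using ffib_Times[of UNIV e UNIV e'] by simp

lemma gser_mult_1: "ffib UNIV e \<Longrightarrow> ffib UNIV e' \<Longrightarrow>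
   gser UNIV e (\<lambda>_. 1) * gser UNIV e' (\<lambda>_. 1) = (gser UNIV (\<lambda>(i, j). e i + e' j) (\<lambda>_. 1) :: complex fps)"
  by (subst gser_mult) (auto intro!: gser_cong)

theorem Nrep_gf:
  assumes "a1 \<ge> 1" "a2 \<ge> 1" "a3 \<ge> 1" "a4 \<ge> 1" "b1 \<ge> 1" "b2 \<ge> 1"
  shows "of_nat (Nrep a1 a2 a3 a4 b1 b2 n) = (sq a1 * (sq a2 * (sq a3 * (sq a4 * (hx b1 * hx b2))))) $ n"
proof -
  note f = ffib_sq[OF assms(1)] ffib_sq[OF assms(2)] ffib_sq[OF assms(3)] ffib_sq[OF assms(4)]
    ffib_hex[OF assms(5)] ffib_hex[OF assms(6)]
  note F1 = ffib_Times'[OF f(5,6)]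
  note F2 = ffib_Times'[OF f(4) F1]
  note F3 = ffib_Times'[OF f(3) F2]
  note F4 = ffib_Times'[OF f(2) F3]
  have "sq a1 * (sq a2 * (sq a3 * (sq a4 * (hx b1 * hx b2)))) = gser UNIV (rep_exp a1 a2 a3 a4 b1 b2) (\<lambda>_. 1)"
    unfolding sq_def hx_def gser_mult_1[OF f(5,6)] gser_mult_1[OF f(4) F1] gser_mult_1[OF f(3) F2]
      gser_mult_1[OF f(2) F3] gser_mult_1[OF f(1) F4]
    by (intro gser_cong) (auto simp: rep_exp_def)
  hence "(sq a1 * (sq a2 * (sq a3 * (sq a4 * (hx b1 * hx b2))))) $ n
      = of_nat (card {p. rep_exp a1 a2 a3 a4 b1 b2 p = n})"
    by (simp add: gser_nth)
  also have "card {p. rep_exp a1 a2 a3 a4 b1 b2 p = n} = Nrep a1 a2 a3 a4 b1 b2 n"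
    unfolding Nrep_def
  proof (rule bij_betw_same_card)
    let ?f = "\<lambda>(x1, x2, x3, x4, (x5, x6), (x7, x8)). [x1, x2, x3, x4, x5, x6, x7, x8 :: int]"
    let ?g = "\<lambda>x. (x!0, x!1, x!2, x!3, (x!4, x!5), (x!6, x!7))"
    have e: "int (rep_exp a1 a2 a3 a4 b1 b2 (x1, x2, x3, x4, (x5, x6), (x7, x8))) =
        int a1 * x1^2 + int a2 * x2^2 + int a3 * x3^2 + int a4 * x4^2
       + int b1 * (x5^2 + x5 * x6 + x6^2) + int b2 * (x7^2 + x7 * x8 + x8^2)" for x1 x2 x3 x4 x5 x6 x7 x8
      using hex_form_ge(3) by (simp add: rep_exp_def sq_exp_def hex_exp_def)
    have e': "rep_exp a1 a2 a3 a4 b1 b2 p = n \<longleftrightarrow> int n = int (rep_exp a1 a2 a3 a4 b1 b2 p)" for p by auto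
    show "bij_betw ?f {p. rep_exp a1 a2 a3 a4 b1 b2 p = n}
     {x :: int list. length x = 8 \<and>
       int n = int a1 * (x!0)^2 + int a2 * (x!1)^2 + int a3 * (x!2)^2 + int a4 * (x!3)^2
       + int b1 * ((x!4)^2 + (x!4) * (x!5) + (x!5)^2)
       + int b2 * ((x!6)^2 + (x!6) * (x!7) + (x!7)^2)}"
    proof (rule bij_betwI[of _ _ _ ?g], goal_cases)
      case 1
      show ?case unfolding e' by (auto simp: e simp del: of_nat_eq_iff)
    next
      case 2
      show ?case unfolding e' by (auto simp: e simp del: of_nat_eq_iff)
    next
      case (3 p)
      show ?case by (auto split: prod.split)
    next
      case (4 x)
      hence "length x = 8" by simp
      then obtain y1 y2 y3 y4 y5 y6 y7 y8 where "x = [y1, y2, y3, y4, y5, y6, y7, y8]"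
        by (auto simp: length_Suc_conv numeral_eq_Suc)
      thus ?case by simp
    qed
  qed
  finally show ?thesis ..
qed

subsection \<open>Eta quotients and parametrisation of level 12\<close>

text \<open>The substitution q -> c q^k, applied for z -> 2z (c = 1, k = 2) and for q -> -q (c = -1,
  k = 1).\<close>

definition fsub :: "complex \<Rightarrow> nat \<Rightarrow> complex fps \<Rightarrow> complex fps" where
  "fsub c k f = f oo (fps_const c * fps_X ^ k)"

lemma fsub_nth:
  assumes "k \<ge> 1"
  shows "fsub c k f $ n = (if k dvd n then c ^ (n div k) * f $ (n div k) else 0)"
proof -
  have "fsub c k f $ n = (\<Sum>i=0..n. f $ i * (c ^ i * (if n = i * k then 1 else 0)))"
    unfolding fsub_def fps_compose_nth fps_monom_power by (intro sum.cong) auto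
  also have "\<dots> = (\<Sum>i=0..n. if i = n div k \<and> k dvd n then c ^ i * f $ i else 0)"
    using assms by (intro sum.cong refl) auto
  also have "\<dots> = (if k dvd n then c ^ (n div k) * f $ (n div k) else 0)"
    by (cases "k dvd n") (auto simp: sum.delta)
  finally show ?thesis .
qed

lemma fsub_hom:
  assumes "k \<ge> 1"
  shows "fsub c k (f + g) = fsub c k f + fsub c k g" "fsub c k (f - g) = fsub c k f - fsub c k g"
    "fsub c k (f * g) = fsub c k f * fsub c k g" "fsub c k (f ^ n) = fsub c k f ^ n"
    "fsub c k (- f) = - fsub c k f" "fsub c k (numeral m) = numeral m"
proof -
  have 0: "(fps_const c * fps_X ^ k) $ 0 = 0" using assms by simp
  show "fsub c k (f * g) = fsub c k f * fsub c k g" "fsub c k (f ^ n) = fsub c k f ^ n"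
    unfolding fsub_def using fps_compose_mult_distrib[OF 0] fps_compose_power[OF 0] by simp_all
  show "fsub c k (f + g) = fsub c k f + fsub c k g" "fsub c k (f - g) = fsub c k f - fsub c k g"
    "fsub c k (- f) = - fsub c k f"
    unfolding fsub_def by (simp_all add: fps_compose_add_distrib fps_compose_sub_distrib fps_compose_uminus)
  show "fsub c k (numeral m) = numeral m" by (simp add: fsub_def numeral_fps_const)
qed

lemma fsub_double_sq: "fsub 1 2 (sq a) = sq (2 * a)"
proof (rule fps_ext)
  fix n
  have e: "sq_exp (2 * a) x = 2 * sq_exp a x" for x
    by (simp add: sq_exp_def nat_mult_distrib mult.assoc)
  show "fsub 1 2 (sq a) $ n = sq (2 * a) $ n"
  proof (cases "even n")
    case True
    hence "sq_exp (2 * a) x = n \<longleftrightarrow> sq_exp a x = n div 2" for x by (auto simp: e)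
    thus ?thesis using True by (simp add: fsub_nth sq_def gser_nth)
  next
    case False
    hence "sq_exp (2 * a) x \<noteq> n" for x by (auto simp: e)
    thus ?thesis using False by (simp add: fsub_nth sq_def gser_nth)
  qed
qed

lemma fsub_minus_sq: "odd a \<Longrightarrow> fsub (-1) 1 (sq a) = asq a"
proof (rule fps_ext)
  fix n assume a: "odd a"
  have "(-1 :: complex) powi x = (-1) ^ sq_exp a x" for x
    using a by (simp add: powi_minus_one sq_exp_def even_nat_iff)
  thus "fsub (-1) 1 (sq a) $ n = asq a $ n"
    by (simp add: fsub_nth sq_def asq_def gser_nth sum_distrib_left)
qed

section \<open>From truncated rational products to infinite complex ones\<close>

definition rc :: "rat fps \<Rightarrow> complex fps" where "rc f = Abs_fps (\<lambda>n. of_rat (f $ n))"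

lemma of_rat_sum': "of_rat (sum f A) = (\<Sum>i\<in>A. of_rat (f i) :: complex)"
  by (induction A rule: infinite_finite_induct) (auto simp: of_rat_add)

lemma rc_mult: "rc (f * g) = rc f * rc g"
  by (rule fps_ext) (simp add: rc_def fps_mult_nth of_rat_sum' of_rat_mult)

lemma rc_1: "rc 1 = 1"
  by (rule fps_ext) (simp add: rc_def)

lemma rc_power: "rc (f ^ n) = rc f ^ n"
  by (induction n) (simp_all add: rc_1 rc_mult)

lemma rc_prod: "rc (prod f A) = (\<Prod>i\<in>A. rc (f i))"
  by (induction A rule: infinite_finite_induct) (simp_all add: rc_1 rc_mult)

lemma rc_inverse: "f $ 0 \<noteq> 0 \<Longrightarrow> rc (inverse f) = inverse (rc f)"
proof -
  assume f: "f $ 0 \<noteq> 0"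
  have "rc (inverse f) * rc f = 1"
    unfolding rc_mult[symmetric] using f by (simp add: inverse_mult_eq_1 rc_1)
  moreover have "inverse (rc f) * rc f = 1" using f by (simp add: inverse_mult_eq_1 rc_def)
  moreover have "rc f \<noteq> 0" using f by (metis fps_nth_Abs_fps fps_zero_nth of_rat_eq_0_iff rc_def)
  ultimately show ?thesis by (metis mult_right_cancel)
qed

lemma rc_factor: "rc (1 - fps_X ^ (d * m)) = 1 - fps_X ^ (d * m)"
  by (rule fps_ext) (auto simp: rc_def of_rat_diff)

definition cpow :: "complex fps \<Rightarrow> int \<Rightarrow> complex fps" where
  "cpow f e = (if 0 \<le> e then f ^ nat e else inverse f ^ nat (- e))"

lemma rc_fps_pow_int: "f $ 0 \<noteq> 0 \<Longrightarrow> rc (fps_pow_int f e) = cpow (rc f) e"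
  by (simp add: fps_pow_int_def cpow_def rc_power rc_inverse)

lemma agree_inverse:
  assumes "agree n f g" "f $ 0 \<noteq> (0 :: 'a::field)" "g $ 0 \<noteq> 0"
  shows "agree n (inverse f) (inverse g)"
proof (rule agree_cancel_unit)
  have "agree n (f * inverse g) (g * inverse g)" by (intro agree_mult assms agree_refl)
  also have "g * inverse g = f * inverse f"
    using assms by (simp add: inverse_mult_eq_1 mult.commute[of _ "inverse _"])
  finally show "agree n (f * inverse f) (f * inverse g)" by (rule agree_sym)
qed fact

lemma agree_cpow: "agree n f g \<Longrightarrow> f $ 0 \<noteq> 0 \<Longrightarrow> g $ 0 \<noteq> 0 \<Longrightarrow> agree n (cpow f e) (cpow g e)"
  by (simp add: cpow_def agree_power agree_inverse)

definition euler :: "nat \<Rightarrow> complex fps" where "euler d = qprod 1 (\<lambda>m. d dvd m)"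

lemma euler_nth_0 [simp]: "euler d $ 0 = 1"
  by (simp add: euler_def)

lemma agree_euler:
  assumes "d \<ge> 1"
  shows "agree n (\<Prod>m=1..n. 1 - fps_X ^ (d * m)) (euler d)"
proof -
  let ?f = "\<lambda>i. if True then 1 - fps_const (1::complex) * fps_X ^ (d * i) else 1"
  have "padm ?f"
    unfolding padm_def if_True
  proof (intro allI impI agree_one_minus)
    fix m :: nat assume "1 \<le> m"
    moreover have "1 * m \<le> d * m" using assms by (intro mult_right_mono) auto
    ultimately show "m - 1 < d * m" by linarith
  qed
  hence "agree n (infprod ?f) (\<Prod>m=1..n. ?f m)" by (rule agree_infprod) simp
  thus ?thesis unfolding qprod_stretch[OF assms] euler_def by (simp add: agree_sym)
qed

definition eta_quot :: "(nat \<times> int) list \<Rightarrow> complex fps" where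
  "eta_quot L = prod_list (map (\<lambda>(d, e). cpow (euler d) e) L)"

lemma agree_eta_prod:
  assumes "\<And>d e. (d, e) \<in> set L \<Longrightarrow> d \<ge> 1"
  shows "agree n (rc (eta_prod L n)) (eta_quot L)"
  using assms
proof (induction L)
  case Nil
  thus ?case by (simp add: eta_prod_def eta_quot_def rc_1)
next
  case (Cons p L)
  obtain d e where p: "p = (d, e)" by (cases p)
  have d: "d \<ge> 1" using Cons.prems[of d e] p by simp
  let ?P = "\<Prod>m=1..n. 1 - fps_X ^ (d * m) :: rat fps"
  have P0: "?P $ 0 \<noteq> 0"
  proof -
    have "?P $ 0 = (\<Prod>m=1..n. (1 - fps_X ^ (d * m) :: rat fps) $ 0)"
      by (induction n) simp_all
    also have "\<dots> = 1" using d by (intro prod.neutral) auto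
    finally show ?thesis by simp
  qed
  have "rc ?P = (\<Prod>m=1..n. 1 - fps_X ^ (d * m))" by (simp add: rc_prod rc_factor)
  hence "agree n (rc ?P) (euler d)" using agree_euler[OF d, of n] by simp
  hence "agree n (rc (fps_pow_int ?P e)) (cpow (euler d) e)"
    unfolding rc_fps_pow_int[OF P0] by (rule agree_cpow) (use P0 in \<open>simp_all add: rc_def\<close>)
  moreover have "agree n (rc (eta_prod L n)) (eta_quot L)"
    by (rule Cons.IH) (use Cons.prems in auto)
  ultimately have "agree n (rc (fps_pow_int ?P e) * rc (eta_prod L n)) (cpow (euler d) e * eta_quot L)"
    by (rule agree_mult)
  thus ?case by (simp add: p eta_prod_def eta_quot_def rc_mult)
qed

definition vf :: "nat \<Rightarrow> complex fps" where "vf j = Abs_fps (\<lambda>n. of_rat (eta_coeff (v_list j) n))"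

text \<open>Truncation at n is harmless: the coefficient read off has index n - s <= n, where the
  finite product already agrees with the infinite one.\<close>

lemma eta_coeff_eq:
  assumes "\<And>d e. (d, e) \<in> set L \<Longrightarrow> d \<ge> 1" "(\<Sum>(d, e)\<leftarrow>L. int d * e) div 24 = int s"
  shows "Abs_fps (\<lambda>n. of_rat (eta_coeff L n)) = fps_X ^ s * eta_quot L"
proof (rule fps_ext)
  fix n
  have "of_rat (eta_coeff L n) = (if n < s then 0 else rc (eta_prod L n) $ (n - s))"
    unfolding eta_coeff_def assms(2) by (simp add: Let_def rc_def nat_diff_distrib flip: of_nat_diff)
  also have "\<dots> = (fps_X ^ s * eta_quot L) $ n"
    using agreeD[OF agree_eta_prod[of L n], of "n - s"] assms(1) by (simp add: fps_X_power_mult_nth)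
  finally show "Abs_fps (\<lambda>n. of_rat (eta_coeff L n)) $ n = (fps_X ^ s * eta_quot L) $ n"
    by simp
qed

lemma fls_cpow: "fps_to_fls (cpow (euler d) e) = (if 0 \<le> e then ee d ^ nat e else inverse (ee d) ^ nat (- e))"
proof -
  have "subdegree (euler d) = 0" by (simp add: subdegree_eq_0_iff)
  hence "fps_to_fls (inverse (euler d)) = inverse (ee d)"
    by (simp add: fls_inverse_fps_to_fls[symmetric] qe_def euler_def)
  thus ?thesis by (simp add: cpow_def fps_to_fls_power) (simp add: qe_def euler_def)
qed

text \<open>Both sides are a power of q times powers of \<open>ee d\<close>; the monomials on the
  right are found by matching the exponents.\<close>

lemma vf_eta:
  "fps_to_fls (vf 1) = g1 * g2 ^ 3 * g3 * g4 / (phi1 ^ 3 * phi3)"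
  "fps_to_fls (vf 2) = g1 ^ 2 * g2 ^ 2 * g3 * g4 ^ 2 / (phi1 ^ 3 * phi3 ^ 3)"
  "fps_to_fls (vf 3) = g1 ^ 3 * g2 ^ 2 * g3 * g4 / (phi1 ^ 3 * phi3 ^ 3)"
  "fps_to_fls (vf 4) = g1 ^ 3 * g2 * g3 ^ 2 * g4 / (phi1 ^ 3 * phi3 ^ 3)"
proof -
  have 1: "vf 1 = fps_X ^ 1 * eta_quot (v_list 1)" unfolding vf_def by (rule eta_coeff_eq) (auto simp: v_list_def)
  have 2: "vf 2 = fps_X ^ 2 * eta_quot (v_list 2)" unfolding vf_def by (rule eta_coeff_eq) (auto simp: v_list_def)
  have 3: "vf 3 = fps_X ^ 3 * eta_quot (v_list 3)" unfolding vf_def by (rule eta_coeff_eq) (auto simp: v_list_def)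
  have 4: "vf 4 = fps_X ^ 3 * eta_quot (v_list 4)" unfolding vf_def by (rule eta_coeff_eq) (auto simp: v_list_def)
  show "fps_to_fls (vf 1) = g1 * g2 ^ 3 * g3 * g4 / (phi1 ^ 3 * phi3)"
    unfolding 1 by (simp add: eta_quot_def v_list_def fls_times_fps_to_fls fps_to_fls_power fls_cpow)
     (simp add: eta_defs divide_simps; algebra?)
  show "fps_to_fls (vf 2) = g1 ^ 2 * g2 ^ 2 * g3 * g4 ^ 2 / (phi1 ^ 3 * phi3 ^ 3)"
    unfolding 2 by (simp add: eta_quot_def v_list_def fls_times_fps_to_fls fps_to_fls_power fls_cpow)
     (simp add: eta_defs divide_simps; algebra?)
  show "fps_to_fls (vf 3) = g1 ^ 3 * g2 ^ 2 * g3 * g4 / (phi1 ^ 3 * phi3 ^ 3)"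
    unfolding 3 by (simp add: eta_quot_def v_list_def fls_times_fps_to_fls fps_to_fls_power fls_cpow)
     (simp add: eta_defs divide_simps; algebra?)
  show "fps_to_fls (vf 4) = g1 ^ 3 * g2 * g3 ^ 2 * g4 / (phi1 ^ 3 * phi3 ^ 3)"
    unfolding 4 by (simp add: eta_quot_def v_list_def fls_times_fps_to_fls fps_to_fls_power fls_cpow)
     (simp add: eta_defs divide_simps; algebra?)
qed

lemma phi_sq: "fps_to_fls (sq 1) = phi1" "fps_to_fls (sq 3) = phi3"
  using sq_eta[of 1] sq_eta[of 3] by (simp_all add: phi1_def phi3_def)

text \<open>\<open>phi1\<close> and \<open>phi3\<close> parametrise all series of level 12; these are the numerators.\<close>

definition pv1 :: "'a::comm_ring_1 \<Rightarrow> 'a \<Rightarrow> 'a" where "pv1 X Y = Y * (X - Y) * (X + Y)^3 * (3 * Y - X) * (X + 3 * Y)"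
definition pv2 :: "'a::comm_ring_1 \<Rightarrow> 'a \<Rightarrow> 'a" where "pv2 X Y = (X - Y)^2 * (X + Y)^2 * (3 * Y - X) * (X + 3 * Y)^2"
definition pv3 :: "'a::comm_ring_1 \<Rightarrow> 'a \<Rightarrow> 'a" where "pv3 X Y = (X - Y)^3 * (X + Y)^2 * (3 * Y - X) * (X + 3 * Y)"
definition pv4 :: "'a::comm_ring_1 \<Rightarrow> 'a \<Rightarrow> 'a" where "pv4 X Y = (X - Y)^3 * (X + Y) * (3 * Y - X)^2 * (X + 3 * Y)"
definition pe1 :: "'a::comm_ring_1 \<Rightarrow> 'a \<Rightarrow> 'a" where
  "pe1 X Y = (X + Y) * (3 * Y - X) * (X + 3 * Y) * (27 * Y^4 + 216 * X * Y^3 + 126 * X^2 * Y^2 - X^4)"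
definition pe2 :: "'a::comm_ring_1 \<Rightarrow> 'a \<Rightarrow> 'a" where
  "pe2 X Y = (X - Y) * (X + Y) * (X + 3 * Y) * (- 3 * Y^4 + 42 * X^2 * Y^2 + 24 * X^3 * Y + X^4)"
definition pe3 :: "'a::comm_ring_1 \<Rightarrow> 'a \<Rightarrow> 'a" where
  "pe3 X Y = (X - Y) * (3 * Y - X) * (X + 3 * Y) * (- 27 * Y^4 + 216 * X * Y^3 - 126 * X^2 * Y^2 + X^4)"
definition pe4 :: "'a::comm_ring_1 \<Rightarrow> 'a \<Rightarrow> 'a" where
  "pe4 X Y = (X - Y) * (X + Y) * (3 * Y - X) * (- 3 * Y^4 + 42 * X^2 * Y^2 - 24 * X^3 * Y + X^4)"

lemmas p_defs = pv1_def pv2_def pv3_def pv4_def pe1_def pe2_def pe3_def pe4_def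

text \<open>The powers of 2 collect the constants in X - Y = 4 g1, X + Y = 2 g2, 3 Y - X = 2 g3, X +
  3 Y = 4 g4; for example 256 = 4 * 2^3 * 2 * 4 in the first line.\<close>

lemma vf_level12:
  "256 * (sq 1 ^ 3 * sq 3 ^ 3 * vf 1) = pv1 (sq 1 ^ 2) (sq 3 ^ 2)"
  "2048 * (sq 1 ^ 3 * sq 3 ^ 3 * vf 2) = pv2 (sq 1 ^ 2) (sq 3 ^ 2)"
  "2048 * (sq 1 ^ 3 * sq 3 ^ 3 * vf 3) = pv3 (sq 1 ^ 2) (sq 3 ^ 2)"
  "2048 * (sq 1 ^ 3 * sq 3 ^ 3 * vf 4) = pv4 (sq 1 ^ 2) (sq 3 ^ 2)"
  unfolding fps_to_fls_eq_iff[symmetric] p_defs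
  by ((simp add: fls_times_fps_to_fls fps_to_fls_power phi_sq vf_eta level12_relations
        divide_simps del: One_nat_def; algebra?)+)

text \<open>The three linear forms contribute their constants 2 and 4, and the weight 2 factor
  contributes 16 or 64 from \<open>weight2_quartic\<close>; the products are 256 and 2048.\<close>

lemma eis_level12:
  "256 * (sq 1 ^ 3 * sq 3 ^ 3 * eis chi1 chi12 23) = pe1 (sq 1 ^ 2) (sq 3 ^ 2)"
  "2048 * (sq 1 ^ 3 * sq 3 ^ 3 * eis chi12 chi1 0) = pe2 (sq 1 ^ 2) (sq 3 ^ 2)"
  "2048 * (sq 1 ^ 3 * sq 3 ^ 3 * eis chim4 chim3 0) = pe3 (sq 1 ^ 2) (sq 3 ^ 2)"
  "256 * (sq 1 ^ 3 * sq 3 ^ 3 * eis chim3 chim4 0) = pe4 (sq 1 ^ 2) (sq 3 ^ 2)"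
proof -
  have aux: "phi1 ^ 3 * phi3 ^ 3 * (x / (phi1 * phi3) * L) = x * (phi1 ^ 2 * phi3 ^ 2 * L)"
    "phi1 ^ 3 * phi3 ^ 3 * (- (x / (phi1 * phi3)) * L) = - x * (phi1 ^ 2 * phi3 ^ 2 * L)" for x L
    by (simp_all add: divide_simps power2_eq_square power3_eq_cube)
  note Q = weight2_quartic
  note simps = fls_times_fps_to_fls fps_to_fls_power phi_sq level12_relations
  let ?X = "phi1 ^ 2" and ?Y = "phi3 ^ 2"
  have "256 * (phi1 ^ 3 * phi3 ^ 3 * fps_to_fls (eis chi1 chi12 23)) = pe1 ?X ?Y"
  proof -
    have "256 * (phi1 ^ 3 * phi3 ^ 3 * fps_to_fls (eis chi1 chi12 23)) = - (2 * g2) * (2 * g3) * (4 * g4)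
       * (16 * (?X * ?Y) * (- 23 - 24 * wl1 1 + 24 * wl1 2 - 96 * wl1 4 - 216 * wl1 6 + 864 * wl1 12))"
      unfolding eis_h1_factor aux by simp
    thus ?thesis unfolding Q(1) level12_relations[symmetric] pe1_def by (rule trans) algebra
  qed
  thus "256 * (sq 1 ^ 3 * sq 3 ^ 3 * eis chi1 chi12 23) = pe1 (sq 1 ^ 2) (sq 3 ^ 2)"
    unfolding fps_to_fls_eq_iff[symmetric] by (simp add: pe1_def fls_times_fps_to_fls fps_to_fls_power phi_sq del: One_nat_def)
  have "2048 * (phi1 ^ 3 * phi3 ^ 3 * fps_to_fls (eis chi12 chi1 0)) = pe2 ?X ?Y"
  proof -
    have "2048 * (phi1 ^ 3 * phi3 ^ 3 * fps_to_fls (eis chi12 chi1 0)) = (4 * g1) * (2 * g2) * (4 * g4)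
       * (64 * (?X * ?Y) * (1 + 6 * wl1 1 - 6 * wl1 2 - 6 * wl1 3 + 6 * wl1 6 - 24 * wl1 12))"
      unfolding eis_h2_factor aux by simp
    thus ?thesis unfolding Q(2) level12_relations[symmetric] pe2_def by (simp only:)
  qed
  thus "2048 * (sq 1 ^ 3 * sq 3 ^ 3 * eis chi12 chi1 0) = pe2 (sq 1 ^ 2) (sq 3 ^ 2)"
    unfolding fps_to_fls_eq_iff[symmetric] by (simp add: pe2_def fls_times_fps_to_fls fps_to_fls_power phi_sq del: One_nat_def)
  have "2048 * (phi1 ^ 3 * phi3 ^ 3 * fps_to_fls (eis chim4 chim3 0)) = pe3 ?X ?Y"
  proof -
    have "2048 * (phi1 ^ 3 * phi3 ^ 3 * fps_to_fls (eis chim4 chim3 0)) = (4 * g1) * (2 * g3) * (4 * g4)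
       * (64 * (?X * ?Y) * (1 - 6 * wl1 1 + 6 * wl1 2 + 54 * wl1 3 - 24 * wl1 4 - 54 * wl1 6))"
      unfolding eis_h3_factor aux by simp
    thus ?thesis unfolding Q(3) level12_relations[symmetric] pe3_def by (simp only:)
  qed
  thus "2048 * (sq 1 ^ 3 * sq 3 ^ 3 * eis chim4 chim3 0) = pe3 (sq 1 ^ 2) (sq 3 ^ 2)"
    unfolding fps_to_fls_eq_iff[symmetric] by (simp add: pe3_def fls_times_fps_to_fls fps_to_fls_power phi_sq del: One_nat_def)
  have "256 * (phi1 ^ 3 * phi3 ^ 3 * fps_to_fls (eis chim3 chim4 0)) = pe4 ?X ?Y"
  proof -
    have "256 * (phi1 ^ 3 * phi3 ^ 3 * fps_to_fls (eis chim3 chim4 0)) = (4 * g1) * (2 * g2) * (2 * g3)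
       * (16 * (?X * ?Y) * (1 - 24 * wl1 2 - 24 * wl1 3 + 96 * wl1 4 + 24 * wl1 6 - 96 * wl1 12))"
      unfolding eis_h4_factor aux by simp
    thus ?thesis unfolding Q(4) level12_relations[symmetric] pe4_def by (simp only:)
  qed
  thus "256 * (sq 1 ^ 3 * sq 3 ^ 3 * eis chim3 chim4 0) = pe4 (sq 1 ^ 2) (sq 3 ^ 2)"
    unfolding fps_to_fls_eq_iff[symmetric] by (simp add: pe4_def fls_times_fps_to_fls fps_to_fls_power phi_sq del: One_nat_def)
qed

subsection \<open>Level 24\<close>

text \<open>\<open>phi1(-q)^2 = uu (3 phi3^2 - phi1^2)\<close> and \<open>phi3(-q)^2 = uu (phi1^2 + phi3^2)\<close>.\<close>

definition uu :: "complex fls" where "uu = fps_to_fls (asq 1) ^ 2 / (2 * g3)"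

abbreviation "XX \<equiv> phi1 ^ 2"
abbreviation "YY \<equiv> phi3 ^ 2"

lemma asq_13: "fps_to_fls (asq 1) = ee 1 ^ 2 / ee 2" "fps_to_fls (asq 3) = ee 3 ^ 2 / ee 6"
  using asq_eta[of 1] asq_eta[of 3] by simp_all

lemma uu_nonzero [simp]: "uu \<noteq> 0"
  by (simp add: uu_def asq_13 del: One_nat_def)

text \<open>Once the linear forms are replaced by g2 and g3, these are comparisons of monomials in
  \<open>ee d\<close>. The fourth makes uu^2 a rational function of X and Y.\<close>

lemma level24_relations:
  "fps_to_fls (asq 1) ^ 2 = uu * (3 * YY - XX)"
  "fps_to_fls (asq 3) ^ 2 = uu * (XX + YY)"
  "fps_to_fls (asq 1) * fps_to_fls (asq 3) = 4 * phi1 * phi3 * uu ^ 2"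
  "16 * XX * YY * uu ^ 2 = (XX + YY) * (3 * YY - XX)"
  "fps_to_fls (asq 2) * fps_to_fls (asq 6) = 2 * phi1 * phi3 * uu"
proof -
  have e: "fps_to_fls (asq 2) = ee 2 ^ 2 / ee 4" "fps_to_fls (asq 6) = ee 6 ^ 2 / ee 12"
    using asq_eta[of 2] asq_eta[of 6] by simp_all
  show "fps_to_fls (asq 1) ^ 2 = uu * (3 * YY - XX)"
    unfolding uu_def level12_relations by simp
  show "fps_to_fls (asq 3) ^ 2 = uu * (XX + YY)"
    unfolding uu_def level12_relations asq_13 by (simp add: g2_def g3_def divide_simps; algebra?)
  show "fps_to_fls (asq 1) * fps_to_fls (asq 3) = 4 * phi1 * phi3 * uu ^ 2"
    unfolding uu_def asq_13 by (simp add: eta_defs divide_simps; algebra?)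
  show "16 * XX * YY * uu ^ 2 = (XX + YY) * (3 * YY - XX)"
    unfolding level12_relations uu_def asq_13 by (simp add: eta_defs divide_simps; algebra?)
  show "fps_to_fls (asq 2) * fps_to_fls (asq 6) = 2 * phi1 * phi3 * uu"
    unfolding uu_def asq_13 e by (simp add: eta_defs divide_simps; algebra?)
qed

lemma phi_double:
  "2 * fps_to_fls (sq 2) ^ 2 = XX + uu * (3 * YY - XX)"
  "2 * fps_to_fls (sq 6) ^ 2 = YY + uu * (XX + YY)"
proof -
  have "fps_to_fls (sq 1 ^ 2 + asq 1 ^ 2) = fps_to_fls (2 * sq 2 ^ 2)"
    "fps_to_fls (sq 3 ^ 2 + asq 3 ^ 2) = fps_to_fls (2 * sq 6 ^ 2)"
    using sq_double[of 1] sq_double[of 3] by simp_all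
  thus "2 * fps_to_fls (sq 2) ^ 2 = XX + uu * (3 * YY - XX)"
    "2 * fps_to_fls (sq 6) ^ 2 = YY + uu * (XX + YY)"
    unfolding level24_relations(1,2)[symmetric]
    by (simp_all add: fls_times_fps_to_fls fps_to_fls_power phi_sq del: One_nat_def)
qed

lemma sq_nth_0: "a \<ge> 1 \<Longrightarrow> sq a $ 0 = 1" and asq_nth_0: "a \<ge> 1 \<Longrightarrow> asq a $ 0 = 1"
proof -
  assume "a \<ge> 1"
  hence "{x. x \<in> UNIV \<and> sq_exp a x = 0} = {0}"
    by (auto simp: sq_exp_def mult_le_0_iff)
  thus "sq a $ 0 = 1" "asq a $ 0 = 1" by (simp_all add: sq_def asq_def gser_nth)
qed

text \<open>\<open>phi_double\<close> only gives the square of the left side; the quadratic equation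
  for uu makes it the square of the right side, and the sign is fixed at q = 0.\<close>

lemma phi_double_mult:
  "8 * phi1 * phi3 * (fps_to_fls (sq 2) * fps_to_fls (sq 6)) = XX ^ 2 + 3 * YY ^ 2 + 8 * XX * YY * uu"
proof -
  let ?a = "8 * phi1 * phi3 * (fps_to_fls (sq 2) * fps_to_fls (sq 6))"
  let ?b = "XX ^ 2 + 3 * YY ^ 2 + 8 * XX * YY * uu"
  have "?a ^ 2 = 16 * XX * YY * ((2 * fps_to_fls (sq 2) ^ 2) * (2 * fps_to_fls (sq 6) ^ 2))"
    by (simp add: power_mult_distrib)
  also have "\<dots> = ?b ^ 2"
    unfolding phi_double using level24_relations(4) by algebra
  finally have "(?a - ?b) * (?a + ?b) = 0" by algebra
  moreover have "?a + ?b \<noteq> 0"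
  proof
    assume "?a + ?b = 0"
    \<comment> \<open>Writing uu as a product of theta series makes the constant coefficient
      visible: 8 + 1 + 3 + 4 is not 0.\<close>
    also have "?b = XX ^ 2 + 3 * YY ^ 2 + 4 * phi1 * phi3 * (fps_to_fls (asq 2) * fps_to_fls (asq 6))"
      unfolding level24_relations by (simp add: power2_eq_square)
    finally have "fps_to_fls (8 * sq 1 * sq 3 * (sq 2 * sq 6) + (sq 1 ^ 4 + 3 * sq 3 ^ 4 + 4 * sq 1 * sq 3 * (asq 2 * asq 6))) = 0"
      by (simp add: fls_times_fps_to_fls fps_to_fls_power phi_sq del: One_nat_def)
    hence "8 * sq 1 * sq 3 * (sq 2 * sq 6) + (sq 1 ^ 4 + 3 * sq 3 ^ 4 + 4 * sq 1 * sq 3 * (asq 2 * asq 6)) = 0"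
      by (rule iffD1[OF fps_to_fls_eq_0_iff])
    hence "(8 * sq 1 * sq 3 * (sq 2 * sq 6) + (sq 1 ^ 4 + 3 * sq 3 ^ 4 + 4 * sq 1 * sq 3 * (asq 2 * asq 6))) $ 0 = 0 $ 0"
      by (rule arg_cong)
    moreover have "(f ^ n) $ 0 = 1" if "f $ 0 = 1" for f :: "complex fps" and n
      using that by (induction n) simp_all
    ultimately show False by (simp add: sq_nth_0 asq_nth_0)
  qed
  ultimately show ?thesis by simp
qed

text \<open>For b = 1 and 4 only uu^2 occurs, which is rational in X and Y. For b = 2 the term 8 X Y
  uu from \<open>phi_double_mult\<close> cancels against the one in \<open>hx 8\<close>.\<close>

lemma hex_level12:
  "8 * phi1 * phi3 * fps_to_fls (hx 1) = 2 * (XX ^ 2 + 6 * XX * YY - 3 * YY ^ 2)"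
  "8 * phi1 * phi3 * fps_to_fls (hx 2) = 2 * (XX ^ 2 + 3 * YY ^ 2)"
  "8 * phi1 * phi3 * fps_to_fls (hx 4) = - (XX ^ 2) + 6 * XX * YY + 3 * YY ^ 2"
proof -
  note simps = fls_times_fps_to_fls fps_to_fls_power phi_sq
  have c2: "2 * u = 2 * v \<Longrightarrow> u = v" for u v :: "complex fls" by simp
  have 4: "2 * fps_to_fls (hx 4) = phi1 * phi3 + 4 * phi1 * phi3 * uu ^ 2"
    using arg_cong[OF hex_quad[of 1], of fps_to_fls] unfolding level24_relations(3)[symmetric]
    by (simp add: simps[unfolded One_nat_def])
  have 1: "fps_to_fls (hx 1) = 3 * (phi1 * phi3) - 2 * fps_to_fls (hx 4)"
    using arg_cong[OF hex_parity[of 1], of fps_to_fls] by (simp add: simps[unfolded One_nat_def])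
  have 8: "2 * fps_to_fls (hx 8) = fps_to_fls (sq 2) * fps_to_fls (sq 6) + 2 * phi1 * phi3 * uu"
    using arg_cong[OF hex_quad[of 2], of fps_to_fls] unfolding level24_relations(5)[symmetric]
    by (simp add: fls_times_fps_to_fls)
  have 2: "fps_to_fls (hx 2) = 3 * (fps_to_fls (sq 2) * fps_to_fls (sq 6)) - 2 * fps_to_fls (hx 8)"
    using arg_cong[OF hex_parity[of 2], of fps_to_fls] by (simp add: fls_times_fps_to_fls)
  show "8 * phi1 * phi3 * fps_to_fls (hx 1) = 2 * (XX ^ 2 + 6 * XX * YY - 3 * YY ^ 2)"
    unfolding 1 4 using level24_relations(4) by algebra
  have "2 * (8 * phi1 * phi3 * fps_to_fls (hx 4)) = 8 * phi1 * phi3 * (2 * fps_to_fls (hx 4))" by simp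
  also have "\<dots> = 2 * (- (XX ^ 2) + 6 * XX * YY + 3 * YY ^ 2)"
    unfolding 4 using level24_relations(4) by algebra
  finally show "8 * phi1 * phi3 * fps_to_fls (hx 4) = - (XX ^ 2) + 6 * XX * YY + 3 * YY ^ 2" by (rule c2)
  show "8 * phi1 * phi3 * fps_to_fls (hx 2) = 2 * (XX ^ 2 + 3 * YY ^ 2)"
    unfolding 2 8 using phi_double_mult by algebra
qed

text \<open>\<open>evp p\<close> represents, up to scaling, the even part of the series with numerator \<open>p\<close>.\<close>

definition evp :: "(complex fls \<Rightarrow> complex fls \<Rightarrow> complex fls) \<Rightarrow> complex fls" where
  "evp p = 64 * p XX YY + uu * p (3 * YY - XX) (XX + YY)"

section \<open>Eta quotients at 2z\<close>

text \<open>Here x, y, P stand for 2 phi1(q^2)^2, 2 phi3(q^2)^2 and 8 phi1 phi3 phi1(q^2) phi3(q^2).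
  The combinations on the right say that v_j(2z) is a linear combination of even parts of the
  v_i(z).\<close>

lemma vf_double_identities:
  fixes X Y U :: "'a::idom"
  assumes "16 * X * Y * U^2 = (X + Y) * (3 * Y - X)"
  defines "x \<equiv> X + U * (3 * Y - X)" and "y \<equiv> Y + U * (X + Y)" and "P \<equiv> X^2 + 3 * Y^2 + 8 * X * Y * U"
    and "e \<equiv> \<lambda>p. 64 * p X Y + U * p (3 * Y - X) (X + Y)"
  shows "4096 * X^3 * Y^3 * pv1 x y = (e pv2 - e pv3) * P^3"
    and "4096 * X^3 * Y^3 * pv2 x y = - (8 * e pv1 + e pv3 + e pv4) * P^3"
    and "4096 * X^3 * Y^3 * pv3 x y = (- 8 * e pv1 + e pv3 + e pv4) * P^3"
    and "4096 * X^3 * Y^3 * pv4 x y = (8 * e pv1 - 5 * e pv3 - e pv4) * P^3"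
  using assms(1) unfolding assms(2-) p_defs by algebra+

lemma fsub_p:
  assumes "k \<ge> 1"
  shows "fsub c k (pv1 f g) = pv1 (fsub c k f) (fsub c k g)" "fsub c k (pv2 f g) = pv2 (fsub c k f) (fsub c k g)"
    "fsub c k (pv3 f g) = pv3 (fsub c k f) (fsub c k g)" "fsub c k (pv4 f g) = pv4 (fsub c k f) (fsub c k g)"
    "fsub c k (pe1 f g) = pe1 (fsub c k f) (fsub c k g)" "fsub c k (pe4 f g) = pe4 (fsub c k f) (fsub c k g)"
  using assms by (simp_all add: p_defs fsub_hom)

lemma fls_p:
  "fps_to_fls (pv1 f g) = pv1 (fps_to_fls f) (fps_to_fls g)" "fps_to_fls (pv2 f g) = pv2 (fps_to_fls f) (fps_to_fls g)"
  "fps_to_fls (pv3 f g) = pv3 (fps_to_fls f) (fps_to_fls g)" "fps_to_fls (pv4 f g) = pv4 (fps_to_fls f) (fps_to_fls g)"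
  "fps_to_fls (pe1 f g) = pe1 (fps_to_fls f) (fps_to_fls g)" "fps_to_fls (pe2 f g) = pe2 (fps_to_fls f) (fps_to_fls g)"
  "fps_to_fls (pe3 f g) = pe3 (fps_to_fls f) (fps_to_fls g)" "fps_to_fls (pe4 f g) = pe4 (fps_to_fls f) (fps_to_fls g)"
  by (simp_all add: p_defs fls_times_fps_to_fls fps_to_fls_power)

text \<open>Homogeneity of degree 7 gives 128 = 2^7. Multiplying by (8 phi1 phi3 S T)^3 trades the
  factor (S T)^3 natural at 2z for (phi1 phi3)^3.\<close>

lemma fsub_double_level12:
  defines "S \<equiv> fps_to_fls (sq 2)" and "T \<equiv> fps_to_fls (sq 6)"
  assumes f: "k * (S ^ 3 * T ^ 3 * f) = p (S ^ 2) (T ^ 2)"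
    and p: "\<And>x y. p (2 * x) (2 * y) = 128 * p x y"
    and R: "4096 * XX^3 * YY^3 * p (XX + uu * (3 * YY - XX)) (YY + uu * (XX + YY))
          = R * (XX^2 + 3 * YY^2 + 8 * XX * YY * uu)^3"
  shows "1024 * k * (phi1 ^ 3 * phi3 ^ 3 * f) = R"
proof -
  have "128 * (k * (S ^ 3 * T ^ 3 * f)) = p (2 * S ^ 2) (2 * T ^ 2)"
    by (simp add: f p)
  hence "4096 * XX^3 * YY^3 * (128 * (k * (S ^ 3 * T ^ 3 * f)))
      = R * (8 * phi1 * phi3 * (S * T)) ^ 3"
    unfolding S_def T_def phi_double_mult R[symmetric] phi_double by (simp only:)
  hence "(512 * phi1^3 * phi3^3 * S^3 * T^3) * (1024 * k * (phi1 ^ 3 * phi3 ^ 3 * f))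
      = (512 * phi1^3 * phi3^3 * S^3 * T^3) * R"
    by algebra
  moreover have "S \<noteq> 0" "T \<noteq> 0" using sq_nth_0[of 2] sq_nth_0[of 6] by (auto simp: S_def T_def)
  hence "512 * phi1^3 * phi3^3 * S^3 * T^3 \<noteq> 0" by simp
  ultimately show ?thesis by (rule mult_left_cancel[THEN iffD1, rotated])
qed

lemma vf_double:
  "2 ^ 18 * (phi1 ^ 3 * phi3 ^ 3 * fps_to_fls (fsub 1 2 (vf 1))) = evp pv2 - evp pv3"
  "2 ^ 21 * (phi1 ^ 3 * phi3 ^ 3 * fps_to_fls (fsub 1 2 (vf 2))) = - (8 * evp pv1 + evp pv3 + evp pv4)"
  "2 ^ 21 * (phi1 ^ 3 * phi3 ^ 3 * fps_to_fls (fsub 1 2 (vf 3))) = - 8 * evp pv1 + evp pv3 + evp pv4"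
  "2 ^ 21 * (phi1 ^ 3 * phi3 ^ 3 * fps_to_fls (fsub 1 2 (vf 4))) = 8 * evp pv1 - 5 * evp pv3 - evp pv4"
proof -
  have s: "fsub 1 2 (sq 1) = sq 2" "fsub 1 2 (sq 3) = sq 6"
    using fsub_double_sq[of 1] fsub_double_sq[of 3] by simp_all
  note V = vf_level12[THEN arg_cong, of "\<lambda>f. fps_to_fls (fsub 1 2 f)"]
  note I = vf_double_identities[OF level24_relations(4), folded evp_def]
  note simps = fsub_hom fsub_p s[unfolded One_nat_def] fls_p fls_times_fps_to_fls fps_to_fls_power
  have p: "pv1 (2 * x) (2 * y) = 128 * pv1 x y" "pv2 (2 * x) (2 * y) = 128 * pv2 x y"
    "pv3 (2 * x) (2 * y) = 128 * pv3 x y" "pv4 (2 * x) (2 * y) = 128 * pv4 x y" for x y :: "complex fls"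
    unfolding p_defs by algebra+
  show "2 ^ 18 * (phi1 ^ 3 * phi3 ^ 3 * fps_to_fls (fsub 1 2 (vf 1))) = evp pv2 - evp pv3"
    using fsub_double_level12[OF _ p(1) I(1), of 256] V(1) by (simp add: simps)
  show "2 ^ 21 * (phi1 ^ 3 * phi3 ^ 3 * fps_to_fls (fsub 1 2 (vf 2))) = - (8 * evp pv1 + evp pv3 + evp pv4)"
    using fsub_double_level12[OF _ p(2) I(2), of 2048] V(2) by (simp add: simps)
  show "2 ^ 21 * (phi1 ^ 3 * phi3 ^ 3 * fps_to_fls (fsub 1 2 (vf 3))) = - 8 * evp pv1 + evp pv3 + evp pv4"
    using fsub_double_level12[OF _ p(3) I(3), of 2048] V(3) by (simp add: simps)
  show "2 ^ 21 * (phi1 ^ 3 * phi3 ^ 3 * fps_to_fls (fsub 1 2 (vf 4))) = 8 * evp pv1 - 5 * evp pv3 - evp pv4"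
    using fsub_double_level12[OF _ p(4) I(4), of 2048] V(4) by (simp add: simps)
qed

lemma eis_fls:
  "256 * (phi1 ^ 3 * phi3 ^ 3 * fps_to_fls (eis chi1 chi12 23)) = pe1 XX YY"
  "2048 * (phi1 ^ 3 * phi3 ^ 3 * fps_to_fls (eis chi12 chi1 0)) = pe2 XX YY"
  "2048 * (phi1 ^ 3 * phi3 ^ 3 * fps_to_fls (eis chim4 chim3 0)) = pe3 XX YY"
  "256 * (phi1 ^ 3 * phi3 ^ 3 * fps_to_fls (eis chim3 chim4 0)) = pe4 XX YY"
  using eis_level12[THEN arg_cong, of fps_to_fls]
  by (simp_all add: fls_p fls_times_fps_to_fls fps_to_fls_power phi_sq[unfolded One_nat_def])

lemma vf_fls:
  "256 * (phi1 ^ 3 * phi3 ^ 3 * fps_to_fls (vf 1)) = pv1 XX YY"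
  "2048 * (phi1 ^ 3 * phi3 ^ 3 * fps_to_fls (vf 2)) = pv2 XX YY"
  "2048 * (phi1 ^ 3 * phi3 ^ 3 * fps_to_fls (vf 3)) = pv3 XX YY"
  "2048 * (phi1 ^ 3 * phi3 ^ 3 * fps_to_fls (vf 4)) = pv4 XX YY"
  using vf_level12[THEN arg_cong, of fps_to_fls]
  by (simp_all add: fls_p fls_times_fps_to_fls fps_to_fls_power phi_sq[unfolded One_nat_def])

text \<open>Since \<open>psi\<close> vanishes on even numbers, the coefficient at \<open>2 m\<close> only involves divisors of \<open>m\<close>.\<close>

lemma E4coeff_double:
  assumes "\<And>d. even d \<Longrightarrow> psi d = 0" "\<And>k. chi (2 * k) = e * chi k" "m > 0"
  shows "E4coeff chi psi c (2 * m) = of_int e * E4coeff chi psi c m"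
proof -
  have "(\<Sum>d | d dvd 2 * m. psi d * chi (2 * m div d) * int d ^ 3)
      = (\<Sum>d | d dvd m. psi d * chi (2 * m div d) * int d ^ 3)"
  proof (rule sum.mono_neutral_right)
    show "\<forall>d\<in>{d. d dvd 2 * m} - {d. d dvd m}. psi d * chi (2 * m div d) * int d ^ 3 = 0"
    proof
      fix d assume d: "d \<in> {d. d dvd 2 * m} - {d. d dvd m}"
      hence "even d"
        using coprime_dvd_mult_right_iff[of d 2 m] by auto
      thus "psi d * chi (2 * m div d) * int d ^ 3 = 0" by (simp add: assms(1))
    qed
  qed (use assms(3) in auto)
  also have "\<dots> = (\<Sum>d | d dvd m. e * (psi d * chi (m div d) * int d ^ 3))"
  proof (rule sum.cong)
    fix d assume "d \<in> {d. d dvd m}"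
    hence "2 * m div d = 2 * (m div d)" by (auto elim!: dvdE)
    thus "psi d * chi (2 * m div d) * int d ^ 3 = e * (psi d * chi (m div d) * int d ^ 3)"
      by (simp add: assms(2))
  qed simp
  finally show ?thesis
    using assms(3) by (simp add: E4coeff_def sum_distrib_left)
qed

text \<open>By \<open>E4coeff_double\<close> the even part is e times the series at 2z. The
  condition e c = c concerns the constant term, which does not acquire a factor e by itself.\<close>

lemma eis_even_part:
  assumes "\<And>d. even d \<Longrightarrow> psi d = 0" "\<And>k. chi (2 * k) = e * chi k" "e * c = c"
  shows "eis chi psi c + fsub (-1) 1 (eis chi psi c) = 2 * of_int e * fsub 1 2 (eis chi psi c)"
proof (rule fps_ext)
  fix n
  have E: "E4coeff chi psi c (2 * m) = of_int e * E4coeff chi psi c m" for m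
    using E4coeff_double[of psi chi e m c] assms
    by (cases "m = 0") (auto simp: E4coeff_def simp flip: of_int_mult)
  have o: "of_int e = fps_const (of_int e :: complex)" by (simp add: fps_of_int)
  show "(eis chi psi c + fsub (-1) 1 (eis chi psi c)) $ n = (2 * of_int e * fsub 1 2 (eis chi psi c)) $ n"
  proof (cases "even n")
    case True
    then obtain m where "n = 2 * m" by (auto elim: evenE)
    thus ?thesis by (simp add: fsub_nth eis_def E of_rat_mult o mult.assoc numeral_fps_const)
  next
    case False
    thus ?thesis by (simp add: fsub_nth o mult.assoc numeral_fps_const)
  qed
qed

text \<open>Under q -> -q homogeneity produces uu^7 on the right, while (phi1 phi3)^3 becomes 64
  uu^6 (phi1 phi3)^3; so a single uu survives, as in \<open>evp\<close>. The constant is 2^15 = 256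
  * 64 * 2.\<close>

lemma eis_double_level12:
  assumes M: "256 * (sq 1 ^ 3 * sq 3 ^ 3 * M) = p (sq 1 ^ 2) (sq 3 ^ 2)"
    and p: "\<And>c k f g. k \<ge> 1 \<Longrightarrow> fsub c k (p f g) = p (fsub c k f) (fsub c k g)"
    "\<And>f g. fps_to_fls (p f g) = p' (fps_to_fls f) (fps_to_fls g)"
    and p': "\<And>u x y. p' (u * x) (u * y) = u ^ 7 * p' x y"
    and e: "M + fsub (-1) 1 M = 2 * e * fsub 1 2 M"
  shows "2 ^ 15 * fps_to_fls e * (phi1 ^ 3 * phi3 ^ 3 * fps_to_fls (fsub 1 2 M)) = evp p'"
proof -
  let ?M = "fps_to_fls (fsub (-1) 1 M)"
  have s: "fsub (-1) 1 (sq 1) = asq 1" "fsub (-1) 1 (sq 3) = asq 3"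
    using fsub_minus_sq[of 1] fsub_minus_sq[of 3] by simp_all
  note simps = fsub_hom p s[unfolded One_nat_def] fls_times_fps_to_fls fps_to_fls_power
    phi_sq[unfolded One_nat_def] level24_relations(1,2)[unfolded One_nat_def]
  have 1: "256 * (phi1 ^ 3 * phi3 ^ 3 * fps_to_fls M) = p' XX YY"
    using M[THEN arg_cong, of fps_to_fls] by (simp add: simps)
  have "256 * (fps_to_fls (asq 1) ^ 3 * fps_to_fls (asq 3) ^ 3 * ?M) = uu ^ 7 * p' (3 * YY - XX) (XX + YY)"
    using M[THEN arg_cong, of "\<lambda>f. fps_to_fls (fsub (-1) 1 f)"] by (simp add: simps p')
  also have "fps_to_fls (asq 1) ^ 3 * fps_to_fls (asq 3) ^ 3 = uu ^ 6 * (64 * (phi1 ^ 3 * phi3 ^ 3))"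
    unfolding power_mult_distrib[symmetric] level24_relations(3) by (simp add: power_mult_distrib)
  finally have "uu ^ 6 * (256 * 64 * (phi1 ^ 3 * phi3 ^ 3 * ?M)) = uu ^ 6 * (uu * p' (3 * YY - XX) (XX + YY))"
    by algebra
  hence "256 * 64 * (phi1 ^ 3 * phi3 ^ 3 * ?M) = uu * p' (3 * YY - XX) (XX + YY)"
    by (rule mult_left_cancel[THEN iffD1, rotated]) simp
  hence "evp p' = 256 * 64 * (phi1 ^ 3 * phi3 ^ 3 * (fps_to_fls M + ?M))"
    unfolding evp_def 1[symmetric] by (simp add: algebra_simps)
  also have "fps_to_fls M + ?M = 2 * fps_to_fls e * fps_to_fls (fsub 1 2 M)"
    using arg_cong[OF e, of fps_to_fls] by (simp add: fls_times_fps_to_fls)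
  finally show ?thesis by simp
qed

text \<open>The factor e is chi(2): it is 1 for the trivial character and -1 for
  \<open>chim3\<close>, hence the sign in the second formula.\<close>

lemma eis_double:
  "2 ^ 15 * (phi1 ^ 3 * phi3 ^ 3 * fps_to_fls (fsub 1 2 (eis chi1 chi12 23))) = evp pe1"
  "2 ^ 15 * (phi1 ^ 3 * phi3 ^ 3 * fps_to_fls (fsub 1 2 (eis chim3 chim4 0))) = - evp pe4"
proof -
  have p: "pe1 (u * x) (u * y) = u ^ 7 * pe1 x y" "pe4 (u * x) (u * y) = u ^ 7 * pe4 x y"
    for u x y :: "complex fls"
    unfolding p_defs by algebra+
  have c12: "chi12 d = 0" and c4: "chim4 d = 0" if "even d" for d
  proof -
    have "even (d mod 12)" "even (d mod 4)" using that by (simp_all add: dvd_mod_iff)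
    thus "chi12 d = 0" "chim4 d = 0" by (auto simp: chi12_def chim4_def)
  qed
  have c3: "chim3 (2 * k) = -1 * chim3 k" for k
  proof -
    have "(2 * k) mod 3 = 2 * (k mod 3) mod 3" by (simp add: mod_mult_right_eq)
    moreover have "k mod 3 < 3" by simp
    hence "k mod 3 = 0 \<or> k mod 3 = 1 \<or> k mod 3 = 2" by linarith
    ultimately show ?thesis by (auto simp: chim3_def)
  qed
  have e1: "eis chi1 chi12 23 + fsub (-1) 1 (eis chi1 chi12 23) = 2 * of_int 1 * fsub 1 2 (eis chi1 chi12 23)"
    by (rule eis_even_part) (simp_all add: c12 chi1_def)
  have e4: "eis chim3 chim4 0 + fsub (-1) 1 (eis chim3 chim4 0) = 2 * of_int (-1) * fsub 1 2 (eis chim3 chim4 0)"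
    by (rule eis_even_part) (simp_all add: c4 c3)
  show "2 ^ 15 * (phi1 ^ 3 * phi3 ^ 3 * fps_to_fls (fsub 1 2 (eis chi1 chi12 23))) = evp pe1"
    using eis_double_level12[OF eis_level12(1) fsub_p(5) fls_p(5) p(1) e1] by simp
  have "- (2 ^ 15 * (phi1 ^ 3 * phi3 ^ 3 * fps_to_fls (fsub 1 2 (eis chim3 chim4 0)))) = evp pe4"
    using eis_double_level12[OF eis_level12(4) fsub_p(6) fls_p(8) p(2) e4] by simp
  thus "2 ^ 15 * (phi1 ^ 3 * phi3 ^ 3 * fps_to_fls (fsub 1 2 (eis chim3 chim4 0))) = - evp pe4"
    by (simp add: minus_equation_iff)
qed

subsection \<open>The table\<close>

definition hexp :: "nat \<Rightarrow> 'a::comm_ring_1 \<Rightarrow> 'a \<Rightarrow> 'a" where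
  "hexp b X Y = (if b = 1 then 2 * (X ^ 2 + 6 * X * Y - 3 * Y ^ 2)
     else if b = 2 then 2 * (X ^ 2 + 3 * Y ^ 2) else - (X ^ 2) + 6 * X * Y + 3 * Y ^ 2)"

text \<open>A row of the table after multiplication by \<open>2^21 phi1^3 phi3^3\<close>; \<open>n\<^sub>6 = n\<^sub>7 = 0\<close> in every row.\<close>

definition rowp :: "int list \<Rightarrow> 'a::comm_ring_1 \<Rightarrow> 'a \<Rightarrow> 'a \<Rightarrow> 'a" where
  "rowp ns X Y U = (let e = (\<lambda>p. 64 * p X Y + U * p (3 * Y - X) (X + Y)) in
     8192 * of_int (ns ! 0) * pe1 X Y + 1024 * of_int (ns ! 1) * pe2 X Y
   + 1024 * of_int (ns ! 2) * pe3 X Y + 8192 * of_int (ns ! 3) * pe4 X Y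
   + 64 * of_int (ns ! 4) * e pe1 - 64 * of_int (ns ! 7) * e pe4
   + 8192 * of_int (ns ! 8) * pv1 X Y + 1024 * of_int (ns ! 9) * pv2 X Y
   + 1024 * of_int (ns ! 10) * pv3 X Y + 1024 * of_int (ns ! 11) * pv4 X Y
   + 8 * of_int (ns ! 12) * (e pv2 - e pv3) - of_int (ns ! 13) * (8 * e pv1 + e pv3 + e pv4)
   + of_int (ns ! 14) * (- 8 * e pv1 + e pv3 + e pv4) + of_int (ns ! 15) * (8 * e pv1 - 5 * e pv3 - e pv4))"

abbreviation b_range :: "(nat \<times> nat) set" where
  "b_range \<equiv> {(1,1), (1,2), (1,4), (2,2), (2,4), (4,4)}"

text \<open>Here X, Y, U are free, with no relation imposed. The constant is 23 * 2^15 = 23 * 2^21 /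
  8^2, since each hexagonal series carries a factor 8; for (1,2,2,3) it is halved because X + U (3 Y
  - X) stands for 2 phi1(q^2)^2.\<close>

lemma rowp_table:
  fixes X Y U :: "'a::idom"
  shows "\<forall>b\<in>b_range. rowp (gamma_num (1,1,1,3) b) X Y U = 753664 * X^2 * Y * hexp (fst b) X Y * hexp (snd b) X Y"
    and "\<forall>b\<in>b_range. rowp (gamma_num (1,3,3,3) b) X Y U = 753664 * X * Y^2 * hexp (fst b) X Y * hexp (snd b) X Y"
    and "\<forall>b\<in>b_range. rowp (gamma_num (1,2,2,3) b) X Y U
          = 376832 * X * Y * (X + U * (3 * Y - X)) * hexp (fst b) X Y * hexp (snd b) X Y"
proof -
  have t: "u = u' \<Longrightarrow> v = v' \<Longrightarrow> u' = v' \<Longrightarrow> u = v" for u u' v v' :: 'a by simp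
  show "\<forall>b\<in>b_range. rowp (gamma_num (1,1,1,3) b) X Y U = 753664 * X^2 * Y * hexp (fst b) X Y * hexp (snd b) X Y"
    by (intro ballI, elim insertE emptyE; hypsubst, rule t, simp add: gamma_num_def rowp_def Let_def,
      simp add: hexp_def, unfold p_defs, algebra)
  show "\<forall>b\<in>b_range. rowp (gamma_num (1,3,3,3) b) X Y U = 753664 * X * Y^2 * hexp (fst b) X Y * hexp (snd b) X Y"
    by (intro ballI, elim insertE emptyE; hypsubst, rule t, simp add: gamma_num_def rowp_def Let_def,
      simp add: hexp_def, unfold p_defs, algebra)
  show "\<forall>b\<in>b_range. rowp (gamma_num (1,2,2,3) b) X Y U
          = 376832 * X * Y * (X + U * (3 * Y - X)) * hexp (fst b) X Y * hexp (snd b) X Y"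
    by (intro ballI, elim insertE emptyE; hypsubst, rule t, simp add: gamma_num_def rowp_def Let_def,
      simp add: hexp_def, unfold p_defs, algebra)
qed

section \<open>Assembly of the rows\<close>

definition hser :: "nat \<Rightarrow> complex fps" where "hser i = Abs_fps (\<lambda>n. of_rat (C i n))"

lemma hser_eq:
  "hser 1 = eis chi1 chi12 23" "hser 2 = eis chi12 chi1 0" "hser 3 = eis chim4 chim3 0"
  "hser 4 = eis chim3 chim4 0" "hser 5 = fsub 1 2 (eis chi1 chi12 23)" "hser 8 = fsub 1 2 (eis chim3 chim4 0)"
  "hser 9 = vf 1" "hser 10 = vf 2" "hser 11 = vf 3" "hser 12 = vf 4"
  "hser 13 = fsub 1 2 (vf 1)" "hser 14 = fsub 1 2 (vf 2)" "hser 15 = fsub 1 2 (vf 3)" "hser 16 = fsub 1 2 (vf 4)"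
  by (rule fps_ext; simp add: hser_def C_def C1_def eis_def vf_def fsub_nth)+

lemma sum_1_16: "(\<Sum>i = 1..16. f i) = f 1 + f 2 + f 3 + f 4 + f 5 + f 6 + f 7 + f 8
    + f 9 + f 10 + f 11 + f 12 + f 13 + f 14 + f 15 + f (16::nat)"
  by (simp add: numeral_eq_Suc add.assoc)

text \<open>2^21 is the largest of the normalising factors 2^8, 2^11, 2^15, 2^18, 2^21 of the single
  series; the weights in \<open>rowp\<close> are the quotients.\<close>

lemma rowp_hser:
  assumes "ns ! 5 = 0" "ns ! 6 = 0"
  shows "2 ^ 21 * (phi1 ^ 3 * phi3 ^ 3 * fps_to_fls (\<Sum>i = 1..16. of_int (ns ! (i - 1)) * hser i)) = rowp ns XX YY uu"
proof -
  have o: "fps_to_fls (of_int k) = of_int k" for k :: int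
    by (simp add: fps_of_int[symmetric] fls_of_int flip: fls_const_def)
  let ?m = "\<lambda>f. phi1 ^ 3 * phi3 ^ 3 * fps_to_fls f"
  have "2 ^ 21 * ?m (\<Sum>i = 1..16. of_int (ns ! (i - 1)) * hser i)
    = 8192 * of_int (ns ! 0) * (256 * ?m (hser 1)) + 1024 * of_int (ns ! 1) * (2048 * ?m (hser 2))
    + 1024 * of_int (ns ! 2) * (2048 * ?m (hser 3)) + 8192 * of_int (ns ! 3) * (256 * ?m (hser 4))
    + 64 * of_int (ns ! 4) * (2 ^ 15 * ?m (hser 5)) + 64 * of_int (ns ! 7) * (2 ^ 15 * ?m (hser 8))
    + 8192 * of_int (ns ! 8) * (256 * ?m (hser 9)) + 1024 * of_int (ns ! 9) * (2048 * ?m (hser 10))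
    + 1024 * of_int (ns ! 10) * (2048 * ?m (hser 11)) + 1024 * of_int (ns ! 11) * (2048 * ?m (hser 12))
    + 8 * of_int (ns ! 12) * (2 ^ 18 * ?m (hser 13)) + of_int (ns ! 13) * (2 ^ 21 * ?m (hser 14))
    + of_int (ns ! 14) * (2 ^ 21 * ?m (hser 15)) + of_int (ns ! 15) * (2 ^ 21 * ?m (hser 16))"
    unfolding sum_1_16 using assms by (simp add: fls_times_fps_to_fls o distrib_left mult_ac)
  also have "\<dots> = rowp ns XX YY uu"
    unfolding hser_eq eis_fls vf_fls eis_double vf_double unfolding rowp_def evp_def Let_def by algebra
  finally show ?thesis .
qed

lemma hex_hexp:
  assumes "b \<in> {1, 2, 4}"
  shows "8 * phi1 * phi3 * fps_to_fls (hx b) = hexp b XX YY"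
  using assms hex_level12 by (auto simp: hexp_def)

lemma gamma_num_zeros: "gamma_num a b ! 5 = 0" "gamma_num a b ! 6 = 0"
  by (simp_all add: gamma_num_def)

lemma theta_product:
  assumes "a \<in> {(1,1,1,3), (1,2,2,3), (1,3,3,3)}" "b \<in> b_range"
  defines "F \<equiv> (\<lambda>(a1, a2, a3, a4) (b1, b2). sq a1 * (sq a2 * (sq a3 * (sq a4 * (hx b1 * hx b2)))))"
  shows "2 ^ 21 * (phi1 ^ 3 * phi3 ^ 3 * (23 * fps_to_fls (F a b))) = rowp (gamma_num a b) XX YY uu"
proof -
  obtain b1 b2 where b: "b = (b1, b2)" by (cases b)
  have "b1 \<in> {1, 2, 4}" "b2 \<in> {1, 2, 4}" using assms(2) b by auto
  note h = this[THEN hex_hexp, symmetric]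
  note S = fls_times_fps_to_fls phi_sq
  consider "a = (1,1,1,3)" | "a = (1,3,3,3)" | "a = (1,2,2,3)" using assms(1) by auto
  thus ?thesis
  proof cases
    case 1
    have e: "fps_to_fls (F a b) = phi1 ^ 3 * phi3 * fps_to_fls (hx b1) * fps_to_fls (hx b2)"
      unfolding F_def 1 b prod.case S by algebra
    show ?thesis unfolding e unfolding 1 rowp_table(1)[THEN bspec, OF assms(2)[unfolded b], unfolded fst_conv snd_conv] b h by (simp add: power2_eq_square power3_eq_cube mult_ac)
  next
    case 2
    have e: "fps_to_fls (F a b) = phi1 * phi3 ^ 3 * fps_to_fls (hx b1) * fps_to_fls (hx b2)"
      unfolding F_def 2 b prod.case S by algebra
    show ?thesis unfolding e unfolding 2 rowp_table(2)[THEN bspec, OF assms(2)[unfolded b], unfolded fst_conv snd_conv] b h by (simp add: power2_eq_square power3_eq_cube mult_ac)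
  next
    case 3
    have e: "fps_to_fls (F a b) = phi1 * phi3 * fps_to_fls (sq 2) ^ 2 * fps_to_fls (hx b1) * fps_to_fls (hx b2)"
      unfolding F_def 3 b prod.case S by algebra
    show ?thesis unfolding e unfolding 3 rowp_table(3)[THEN bspec, OF assms(2)[unfolded b], unfolded fst_conv snd_conv] b h phi_double(1)[symmetric]
      by (simp add: power2_eq_square power3_eq_cube mult_ac)
  qed
qed

theorem theorem2p1:
  fixes a1 a2 a3 a4 b1 b2 n :: nat
  assumes "(a1, a2, a3, a4) \<in> {(1,1,1,3), (1,2,2,3), (1,3,3,3)}"
    and "(b1, b2) \<in> {(1,1), (1,2), (1,4), (2,2), (2,4), (4,4)}"
  shows "of_nat (Nrep a1 a2 a3 a4 b1 b2 n) =
           (\<Sum>i = 1..16. gamma (a1, a2, a3, a4) (b1, b2) i * C i n)"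
proof -
  let ?F = "sq a1 * (sq a2 * (sq a3 * (sq a4 * (hx b1 * hx b2))))"
  let ?g = "gamma_num (a1, a2, a3, a4) (b1, b2)"
  let ?S = "\<Sum>i = 1..16. of_int (?g ! (i - 1)) * hser i"
  have "2 ^ 21 * (phi1 ^ 3 * phi3 ^ 3 * (23 * fps_to_fls ?F)) = 2 ^ 21 * (phi1 ^ 3 * phi3 ^ 3 * fps_to_fls ?S)"
    using theta_product[OF assms] rowp_hser[OF gamma_num_zeros] by simp
  \<comment> \<open>The theta constants are nonzero Laurent series, so the common factor
    cancels.\<close>
  hence "23 * fps_to_fls ?F = fps_to_fls ?S"
    by simp
  hence "fps_to_fls (23 * ?F) = fps_to_fls ?S"
    by (simp only: fls_times_fps_to_fls fps_to_fls_numeral)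
  hence "23 * ?F = ?S" by (rule fps_to_fls_eq_iff[THEN iffD1])
  hence "(23 * ?F) $ n = ?S $ n" by simp
  moreover have "(23 * f) $ n = 23 * f $ n" "(of_int k * f) $ n = of_int k * f $ n" for f :: "complex fps" and k
    by (simp_all add: numeral_fps_const flip: fps_of_int)
  moreover have "?F $ n = of_nat (Nrep a1 a2 a3 a4 b1 b2 n)"
    using assms by (intro Nrep_gf[symmetric]) auto
  ultimately have "23 * of_nat (Nrep a1 a2 a3 a4 b1 b2 n)
      = (\<Sum>i = 1..16. of_int (?g ! (i - 1)) * of_rat (C i n) :: complex)"
    by (simp add: fps_sum_nth hser_def)
  also have "\<dots> = of_rat (\<Sum>i = 1..16. of_int (?g ! (i - 1)) * C i n)"
    by (simp add: of_rat_sum' of_rat_mult)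
  finally have "of_rat (23 * of_nat (Nrep a1 a2 a3 a4 b1 b2 n))
      = (of_rat (\<Sum>i = 1..16. of_int (?g ! (i - 1)) * C i n) :: complex)"
    by (simp add: of_rat_mult)
  hence "23 * of_nat (Nrep a1 a2 a3 a4 b1 b2 n) = (\<Sum>i = 1..16. of_int (?g ! (i - 1)) * C i n)"
    by (rule of_rat_eq_iff[THEN iffD1])
  hence "of_nat (Nrep a1 a2 a3 a4 b1 b2 n) = (\<Sum>i = 1..16. of_int (?g ! (i - 1)) * C i n) / 23"
    by simp
  thus ?thesis by (simp add: gamma_def sum_divide_distrib)
qed

end
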